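(* Let $G$ be a finite simple graph and let $\mathcal{T}^\circ=\{T^\circ_1,\dots,T^\circ_n\}$ be a maximal tubing on $G$. Then the collection of cones \[ \mathcal{C}^*(G,\mathcal{T}^\circ)=\Bigl\{\mathbb{R}_{\ge 0}\{\mathbf{d}^*(T,\mathcal{T}^\circ)\,:\,T\in\mathcal{T}\}\;:\;\mathcal{T}\text{ a tubing on }G\Bigr\} \] is a complete simplicial fan in $\mathbb{R}^n$ which realizes the nested complex $\mathcal{N}(G)$; that is, for every tubing $\mathcal{T}$ the vectors $\mathbf{d}^*(T,\mathcal{T}^\circ)$, $T\in\mathcal{T}$, are linearly independent, these cones form a complete simplicial fan, and $\mathcal{T}\mapsto$ its cone is an isomorphism from $\mathcal{N}(G)$ to the face poset of this fan.
   Context: Let $G$ be a finite simple graph with vertex set $V$; let $\kappa(G)$ be its set of connected components and $n=|V|-|\kappa(G)|$. A tube of $G$ is a nonempty subset of $V$ inducing a connected subgraph; it is proper if it is not a connected component. Two tubes $T,T'$ are compatible if they are nested or disjoint and non-adjacent (i.e. $T\cup T'$ is not a tube). A tubing is a set of pairwise compatible proper tubes; the nested complex $\mathcal{N}(G)$ is the simplicial complex of all tubings. Maximal tubings have exactly $n$ tubes. The compatibility degree is $\delta(T\,\|\,T')=-1$ if $T=T'$; $\delta(T\,\|\,T')=$ the number of vertices of $T'\setminus T$ adjacent to some vertex of $T$ if $T\not\subseteq T'$; and $0$ otherwise. For a maximal tubing $\mathcal{T}^\circ=\{T^\circ_1,\dots,T^\circ_n\}$ and a tube $T$, the dual compatibility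 vector is $\mathbf{d}^*(T,\mathcal{T}^\circ)=(\delta(T\,\|\,T^\circ_1),\dots,\delta(T\,\|\,T^\circ_n))\in\mathbb{R}^n$. $\mathbb{R}_{\ge0}X$ denotes the cone generated by $X$. *)

theory Defs
  imports "HOL-Analysis.Analysis" "Graph_Theory.Digraph_Component"
begin

section \<open>Tubes and tubings\<close>

text \<open>
  A finite simple graph is rendered by the locale \<open>graph\<close> of \<open>Graph_Theory\<close>: a finite digraph,
  symmetric, without loops and without parallel arcs. Thus \<open>u \<rightarrow>\<^bsub>G\<^esub> v\<close> is adjacency. The bare name
  \<open>connected\<close> is ambiguous with topological connectedness, hence the qualification.
\<close>

definition tube :: "('a, 'b) pre_digraph \<Rightarrow> 'a set \<Rightarrow> bool" where
  "tube G T \<longleftrightarrow> T \<noteq> {} \<and> T \<subseteq> verts G \<and> Digraph_Component.connected (G \<restriction> T)"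

text \<open>Connected components are represented by their vertex sets.\<close>

definition components_of :: "('a, 'b) pre_digraph \<Rightarrow> 'a set set" where
  "components_of G = {C. tube G C \<and> (\<forall>T. tube G T \<and> C \<subseteq> T \<longrightarrow> T = C)}"

definition proper_tube :: "('a, 'b) pre_digraph \<Rightarrow> 'a set \<Rightarrow> bool" where
  "proper_tube G T \<longleftrightarrow> tube G T \<and> T \<notin> components_of G"

definition compatible_tubes :: "('a, 'b) pre_digraph \<Rightarrow> 'a set \<Rightarrow> 'a set \<Rightarrow> bool" where
  "compatible_tubes G T T' \<longleftrightarrow>
     T \<subseteq> T' \<or> T' \<subseteq> T \<or> (T \<inter> T' = {} \<and> \<not> tube G (T \<union> T'))"

definition tubing :: "('a, 'b) pre_digraph \<Rightarrow> 'a set set \<Rightarrow> bool" where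
  "tubing G \<T> \<longleftrightarrow> (\<forall>T\<in>\<T>. proper_tube G T) \<and> (\<forall>T\<in>\<T>. \<forall>T'\<in>\<T>. compatible_tubes G T T')"

definition nested_complex :: "('a, 'b) pre_digraph \<Rightarrow> 'a set set set" where
  "nested_complex G = {\<T>. tubing G \<T>}"

definition maximal_tubing :: "('a, 'b) pre_digraph \<Rightarrow> 'a set set \<Rightarrow> bool" where
  "maximal_tubing G \<T> \<longleftrightarrow> tubing G \<T> \<and> (\<forall>\<T>'. tubing G \<T>' \<and> \<T> \<subseteq> \<T>' \<longrightarrow> \<T>' = \<T>)"

section \<open>Dual compatibility vectors\<close>

definition compat_degree :: "('a, 'b) pre_digraph \<Rightarrow> 'a set \<Rightarrow> 'a set \<Rightarrow> int" where
  "compat_degree G T T' =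
     (if T = T' then - 1
      else if \<not> T \<subseteq> T' then int (card {v \<in> T' - T. \<exists>u\<in>T. u \<rightarrow>\<^bsub>G\<^esub> v})
      else 0)"

text \<open>
  The space of real vectors indexed by a set \<open>I\<close> is the coordinate subspace of \<open>real ^ 'n\<close>
  of vectors supported on \<open>I\<close>. For \<open>I = UNIV\<close> this is all of \<open>real ^ 'n\<close>. Allowing proper subsets
  (in particular \<open>I = {}\<close>) is what admits dimension zero, which no type \<open>real ^ 'n\<close> has and which
  occurs for graphs without edges.
\<close>

definition coord_space :: "'n::finite set \<Rightarrow> (real ^ 'n) set" where
  "coord_space I = {x. \<forall>i. i \<notin> I \<longrightarrow> x $ i = 0}"

text \<open>The tubing of reference is enumerated as \<open>T0 i\<close> for \<open>i \<in> I\<close>.\<close>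

definition dual_compat_vector ::
    "('a, 'b) pre_digraph \<Rightarrow> 'n::finite set \<Rightarrow> ('n \<Rightarrow> 'a set) \<Rightarrow> 'a set \<Rightarrow> real ^ 'n" where
  "dual_compat_vector G I T0 T =
     (\<chi> i. if i \<in> I then real_of_int (compat_degree G T (T0 i)) else 0)"

definition dual_compat_cone ::
    "('a, 'b) pre_digraph \<Rightarrow> 'n::finite set \<Rightarrow> ('n \<Rightarrow> 'a set) \<Rightarrow> 'a set set \<Rightarrow> (real ^ 'n) set" where
  "dual_compat_cone G I T0 \<T> = convex_cone hull (dual_compat_vector G I T0 ` \<T>)"

definition dual_compat_fan ::
    "('a, 'b) pre_digraph \<Rightarrow> 'n::finite set \<Rightarrow> ('n \<Rightarrow> 'a set) \<Rightarrow> (real ^ 'n) set set" where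
  "dual_compat_fan G I T0 = {dual_compat_cone G I T0 \<T> | \<T>. tubing G \<T>}"

section \<open>Fans\<close>

definition polyhedral_cone :: "'v::euclidean_space set \<Rightarrow> bool" where
  "polyhedral_cone C \<longleftrightarrow> (\<exists>X. finite X \<and> C = convex_cone hull X)"

definition simplicial_cone :: "'v::euclidean_space set \<Rightarrow> bool" where
  "simplicial_cone C \<longleftrightarrow> (\<exists>X. finite X \<and> independent X \<and> C = convex_cone hull X)"

text \<open>The empty set is a \<open>face_of\<close> every set, but it is not a face of a cone.\<close>

definition cone_face :: "'v::euclidean_space set \<Rightarrow> 'v set \<Rightarrow> bool" where
  "cone_face F C \<longleftrightarrow> F face_of C \<and> F \<noteq> {}"

definition fan :: "'v::euclidean_space set set \<Rightarrow> bool" where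
  "fan \<F> \<longleftrightarrow> finite \<F> \<and> (\<forall>C\<in>\<F>. polyhedral_cone C)
     \<and> (\<forall>C\<in>\<F>. \<forall>F. cone_face F C \<longrightarrow> F \<in> \<F>)
     \<and> (\<forall>C\<in>\<F>. \<forall>D\<in>\<F>. cone_face (C \<inter> D) C \<and> cone_face (C \<inter> D) D)"

text \<open>Completeness is relative to the ambient subspace \<open>W\<close>.\<close>

definition complete_simplicial_fan :: "'v::euclidean_space set \<Rightarrow> 'v set set \<Rightarrow> bool" where
  "complete_simplicial_fan W \<F> \<longleftrightarrow> fan \<F> \<and> (\<forall>C\<in>\<F>. simplicial_cone C) \<and> \<Union>\<F> = W"

text \<open>
  The face poset of a fan is the set of its cones ordered by inclusion (within a fan, a cone is
  contained in another one iff it is a face of it); that of a simplicial complex is the set of all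
  its faces, the empty one included, ordered by inclusion.
\<close>

definition face_poset_iso ::
    "('c set \<Rightarrow> 'v set) \<Rightarrow> 'c set set \<Rightarrow> 'v::euclidean_space set set \<Rightarrow> bool" where
  "face_poset_iso \<phi> \<Delta> \<F> \<longleftrightarrow>
     bij_betw \<phi> \<Delta> \<F> \<and> (\<forall>A\<in>\<Delta>. \<forall>B\<in>\<Delta>. A \<subseteq> B \<longleftrightarrow> \<phi> A \<subseteq> \<phi> B)"

end

theory Submission
  imports Defs
begin

text \<open>
  A height function \<open>h\<close> on the vertices has nonnegative tube weights
  \<open>max 0 (Min (h ` T) - Max (h ` N T))\<close>, where \<open>N T\<close> is the outer neighbourhood of \<open>T\<close>. Their
  supports are exactly the tubings, and up to constants on components \<open>h\<close> is determined by its
  weights. So the assertion says that the piecewise linear map \<open>\<Phi>\<close> sending \<open>h\<close> to the combination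
  of dual compatibility vectors with these weights is a bijection onto the space of vectors.

  Over the complement of finitely many subspaces of codimension two, \<open>\<Phi>\<close> is locally injective: the vectors of a
  maximal tubing are independent, and those of two flipped tubes lie on opposite sides of the
  hyperplane spanned by their common tubes. Both facts come from the functionals that vanish on
  the common tubes. Summing the coefficients of such a functional over the tubes of reference that
  contain a vertex gives a function \<open>k\<close> on vertices, and vanishing on \<open>T\<close> becomes
  \<open>(\<Sum>u\<in>U T. k u - k (m T)) = 0\<close> for a vertex \<open>m T\<close> of \<open>T\<close> and a nonempty \<open>U T \<subseteq> N T\<close>;
  these equations are solved from the outermost tubes inwards. A proper map that is locally
  injective off codimension two is open by invariance of domain, because such a set does not
  separate a ball. Hence the set of points with several preimages is open, and its trace off
  codimension two is closed as well. It misses the negative orthant, the cone of the tubing of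
  reference, so it is empty.
\<close>

section \<open>Proper maps that are locally injective off codimension two\<close>

text \<open>Heights supply the manifold: the weights parametrise the nested complex by a Euclidean
  space, so invariance of domain applies to \<Phi> directly. Around a tubing with at most n - 2
  tubes there is no local control over how the cones fit together; the spans of such tubings are the
  exceptional subspaces. The equations for k come from one identity. For every proper tube T and
  every proper tube of reference T', the degree of T against T' equals the sum over u in U T of
  [u in T'] - [m T in T'], and this covers the values -1 and 0 as well. Pairing a functional with
  the vector of T thus only involves differences of k. Across a flip the functional is shown to have
  a nonpositive product on the two tubes; strictness comes from the fact that a functional vanishing
  on a maximal tubing is 0. Uniqueness over the negative orthant rests on signs: -1 at T = T' is the
  only negative value of a degree.\<close>

lemma open_diff_lowdim_nonempty:
  fixes B :: "'a::euclidean_space set"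
  assumes "open B" "B \<noteq> {}" "finite \<S>" "\<And>S. S \<in> \<S> \<Longrightarrow> dim S < DIM('a)"
  shows "\<exists>x\<in>B. x \<notin> \<Union>\<S>"
proof -
  have "negligible (\<Union>\<S>)"
    using assms by (intro negligible_Union negligible_lowdim) auto
  then have "\<not> B \<subseteq> \<Union>\<S>"
    using open_not_negligible[OF assms(1,2)] negligible_subset by blast
  then show ?thesis by auto
qed

text \<open>Two points x and y are joined by segments through a third point c. The segment from x to
  c misses S once c lies outside the span of x and S. Codimension two keeps that span a proper
  subspace, so a generic c in B serves all S and both endpoints.\<close>

lemma connected_convex_diff_codim2:
  fixes B :: "'a::euclidean_space set"
  assumes "open B" "convex B" "finite \<S>"
    and sub: "\<And>S. S \<in> \<S> \<Longrightarrow> subspace S" and dim: "\<And>S. S \<in> \<S> \<Longrightarrow> dim S + 2 \<le> DIM('a)"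
  shows "topological_space_class.connected (B - \<Union>\<S>)"
proof -
  have avoid: "closed_segment x c \<inter> S = {}"
    if "S \<in> \<S>" "x \<notin> S" "c \<notin> span (insert x S)" for x c S
  proof (rule ccontr)
    assume "closed_segment x c \<inter> S \<noteq> {}"
    then obtain u where u: "0 \<le> u" "u \<le> 1" "(1 - u) *\<^sub>R x + u *\<^sub>R c \<in> S"
      by (auto simp: in_segment)
    have "u \<noteq> 0" using u that by auto
    let ?y = "(1 - u) *\<^sub>R x + u *\<^sub>R c"
    have "?y - (1 - u) *\<^sub>R x \<in> span (insert x S)"
      using u(3) by (intro span_diff span_scale) (auto intro: span_base)
    then have "u *\<^sub>R c \<in> span (insert x S)" by simp
    then have "(1 / u) *\<^sub>R (u *\<^sub>R c) \<in> span (insert x S)"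
      by (rule span_scale)
    then show False using that \<open>u \<noteq> 0\<close> by simp
  qed
  have join: "\<exists>C. topological_space_class.connected C \<and> C \<subseteq> B - \<Union>\<S> \<and> x \<in> C \<and> y \<in> C"
    if xy: "x \<in> B - \<Union>\<S>" "y \<in> B - \<Union>\<S>" for x y
  proof -
    let ?R = "(\<lambda>S. span (insert x S)) ` \<S> \<union> (\<lambda>S. span (insert y S)) ` \<S>"
    have d: "dim (span (insert z S)) < DIM('a)" if "S \<in> \<S>" for z S
      using dim[OF that] by (simp add: dim_insert)
    obtain c where c: "c \<in> B" "c \<notin> \<Union>?R"
      using open_diff_lowdim_nonempty[of B ?R] assms(1,3) xy d by blast
    have "closed_segment x c \<subseteq> B" "closed_segment y c \<subseteq> B"
      using xy c assms(2) by (auto simp: closed_segment_subset)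
    moreover have "closed_segment x c \<inter> \<Union>\<S> = {}" "closed_segment y c \<inter> \<Union>\<S> = {}"
      using avoid[of _ x c] avoid[of _ y c] xy c by blast+
    moreover have "topological_space_class.connected (closed_segment x c \<union> closed_segment y c)"
      by (rule connected_Un) auto
    ultimately show ?thesis
      by (intro exI[of _ "closed_segment x c \<union> closed_segment y c"]) auto
  qed
  show ?thesis
    using join by (subst connected_iff_connected_component) (simp add: connected_component_def)
qed

text \<open>The exceptional set lies in the codomain, so \<open>loc\<close> is a condition on the
  value at p. \<open>dense\<close> keeps the preimage of that set from having interior,
  \<open>fibre\<close> yields small spheres that avoid a given fibre, and \<open>proper\<close>
  makes images of closed sets closed.\<close>

lemma bij_if_locally_inj_off_codim2:
  fixes \<Phi> :: "'a::euclidean_space \<Rightarrow> 'a" and \<S> :: "'a set set"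
  assumes cont: "continuous_on UNIV \<Phi>"
    and fin\<S>: "finite \<S>"
    and sub: "\<And>S. S \<in> \<S> \<Longrightarrow> subspace S" and dim: "\<And>S. S \<in> \<S> \<Longrightarrow> dim S + 2 \<le> DIM('a)"
    and proper: "\<And>K. bounded K \<Longrightarrow> bounded (\<Phi> -` K)"
    and fibre: "\<And>y. finite (\<Phi> -` {y})"
    and dense: "\<And>U. open U \<Longrightarrow> U \<noteq> {} \<Longrightarrow> \<exists>V\<subseteq>U. open V \<and> V \<noteq> {} \<and> inj_on \<Phi> V"
    and loc: "\<And>p. \<Phi> p \<notin> \<Union>\<S> \<Longrightarrow> \<exists>V. open V \<and> p \<in> V \<and> inj_on \<Phi> V"
    and uniq: "open Q" "Q \<noteq> {}" "\<And>z z'. \<Phi> z \<in> Q \<Longrightarrow> \<Phi> z = \<Phi> z' \<Longrightarrow> z = z'"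
  shows "bij \<Phi>"
proof -
  let ?M = "\<Union>\<S>"
  have lowdim: "\<exists>y\<in>U. y \<notin> ?M" if "open U" "U \<noteq> {}" for U
    using open_diff_lowdim_nonempty[OF that fin\<S>] dim by fastforce
  have clM: "closed ?M"
    using fin\<S> sub closed_subspace by blast
  have opim: "open (\<Phi> ` V)" if "open V" "inj_on \<Phi> V" for V
    using invariance_of_domain[OF continuous_on_subset[OF cont] that] by simp
  have clim: "closed (\<Phi> ` S)" if S: "closed S" for S
    unfolding closed_sequential_limits
  proof safe
    fix f y assume f: "\<forall>n. f n \<in> \<Phi> ` S" and lim: "f \<longlonglongrightarrow> y"
    then obtain x where x: "\<And>n. x n \<in> S" "\<And>n. f n = \<Phi> (x n)"
      unfolding image_iff by metis
    have "bounded (\<Phi> -` range f)"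
      using convergent_imp_bounded[OF lim] by (rule proper)
    moreover have "range x \<subseteq> \<Phi> -` range f" using x by auto
    ultimately have "bounded (range x)" by (rule bounded_subset)
    then obtain l and r :: "nat \<Rightarrow> nat" where l: "strict_mono r" "(x \<circ> r) \<longlonglongrightarrow> l"
      using bounded_imp_convergent_subsequence by blast
    have "l \<in> S" using closed_sequentially[OF S _ l(2)] x by auto
    moreover have "(\<lambda>n. \<Phi> ((x \<circ> r) n)) \<longlonglongrightarrow> \<Phi> l"
      using continuous_on_tendsto_compose[OF cont l(2)] by simp
    then have "(f \<circ> r) \<longlonglongrightarrow> \<Phi> l" using x by (simp add: comp_def)
    with LIMSEQ_subseq_LIMSEQ[OF lim l(1)] have "y = \<Phi> l" using LIMSEQ_unique by blast
    ultimately show "y \<in> \<Phi> ` S" by blast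
  qed
  have offM: "\<exists>z\<in>U. \<Phi> z \<notin> ?M" if U: "open U" "U \<noteq> {}" for U
  proof -
    obtain V where V: "V \<subseteq> U" "open V" "V \<noteq> {}" "inj_on \<Phi> V" using dense[OF U] by blast
    then show ?thesis using lowdim[of "\<Phi> ` V"] opim by blast
  qed
  have nbhd: "\<exists>d>0. ball (\<Phi> h) d \<subseteq> \<Phi> ` ball h e" if e: "e > 0" for h e
  proof -
    \<comment> \<open>Only finitely many radii are excluded, so some sphere around h of radius below
      e carries no point of the fibre. Its compact image keeps a positive distance d from \<Phi>
      h.\<close>
    have "finite (dist h ` (\<Phi> -` {\<Phi> h}))" using fibre by blast
    then have "infinite ({0<..<e} - dist h ` (\<Phi> -` {\<Phi> h}))"
      using infinite_Ioo[OF e] by simp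
    then have "{0<..<e} - dist h ` (\<Phi> -` {\<Phi> h}) \<noteq> {}" by (rule infinite_imp_nonempty)
    then obtain r where "r \<in> {0<..<e} - dist h ` (\<Phi> -` {\<Phi> h})" by blast
    then have r: "0 < r" "r < e" "r \<notin> dist h ` (\<Phi> -` {\<Phi> h})" by simp_all
    let ?K = "\<Phi> ` sphere h r"
    have "compact ?K" by (intro compact_continuous_image continuous_on_subset[OF cont]) auto
    moreover have "\<Phi> h \<notin> ?K" using r by (auto simp: image_iff dest: sym)
    moreover have "closed ?K" using calculation(1) by (rule compact_imp_closed)
    ultimately obtain d where "d > 0" "ball (\<Phi> h) d \<subseteq> - ?K"
      using openE[of "- ?K" "\<Phi> h"] by (metis ComplI open_Compl)
    then have d: "d > 0" "ball (\<Phi> h) d \<inter> ?K = {}" by auto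
    \<comment> \<open>\<open>?A\<close> is clopen in the connected set \<open>?B - ?M\<close>:
      within \<open>?B\<close> the images of the open and the closed ball of radius r agree, which
      gives closedness, and local injectivity gives openness. So it is everything, and closedness of
      the image of \<open>cball h r\<close> fills in the points of \<open>?M\<close>.\<close>
    let ?B = "ball (\<Phi> h) d" and ?A = "\<Phi> ` ball h r \<inter> (ball (\<Phi> h) d - ?M)"
    have conn: "topological_space_class.connected (?B - ?M)"
      using fin\<S> sub dim by (intro connected_convex_diff_codim2) auto
    have "?A = (\<Phi> ` cball h r) \<inter> (?B - ?M)"
      using d(2) by (auto simp: cball_def ball_def sphere_def order_le_less)
    moreover have "closed (\<Phi> ` cball h r)" using clim by auto
    ultimately have "closedin (top_of_set (?B - ?M)) ?A"
      by (metis closedin_closed_Int inf_commute)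
    moreover have "open ?A"
      unfolding open_subopen[of ?A]
    proof safe
      fix z assume z: "z \<in> ball h r" "\<Phi> z \<in> ?B" "\<Phi> z \<notin> ?M"
      obtain V where V: "open V" "z \<in> V" "inj_on \<Phi> V" using loc[OF z(3)] by blast
      have "open (\<Phi> ` (V \<inter> ball h r))" by (rule opim) (use V in \<open>auto intro: inj_on_subset\<close>)
      then have "open (\<Phi> ` (V \<inter> ball h r) \<inter> (?B - ?M))"
        using clM by (intro open_Int open_Diff) auto
      then show "\<exists>T. open T \<and> \<Phi> z \<in> T \<and> T \<subseteq> ?A" using z V
        by (intro exI[of _ "\<Phi> ` (V \<inter> ball h r) \<inter> (?B - ?M)"]) blast
    qed
    then have "openin (top_of_set (?B - ?M)) ?A" by (metis inf_le2 open_subset)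
    moreover have "?A \<noteq> {}"
    proof -
      have "open (\<Phi> -` ?B)" using cont open_ball continuous_on_open_vimage[of UNIV \<Phi>] by auto
      then have "open (ball h r \<inter> \<Phi> -` ?B)" by auto
      moreover have "h \<in> ball h r \<inter> \<Phi> -` ?B" using r d by auto
      ultimately obtain z where "z \<in> ball h r \<inter> \<Phi> -` ?B" "\<Phi> z \<notin> ?M" using offM by blast
      then show ?thesis by blast
    qed
    ultimately have eq: "?A = ?B - ?M"
      using conn unfolding connected_clopen by blast
    have "?B \<subseteq> \<Phi> ` cball h r"
    proof (rule ccontr)
      assume "\<not> ?B \<subseteq> \<Phi> ` cball h r"
      then have "open (?B - \<Phi> ` cball h r)" "?B - \<Phi> ` cball h r \<noteq> {}"
        using clim by auto
      then obtain y where "y \<in> ?B - \<Phi> ` cball h r" "y \<notin> ?M" using lowdim by blast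
      then show False using eq ball_subset_cball[of h r] by blast
    qed
    moreover have "cball h r \<subseteq> ball h e" using r by auto
    ultimately show ?thesis using d by (meson image_mono subset_trans)
  qed
  have open\<Phi>: "open (\<Phi> ` U)" if U: "open U" for U
    unfolding open_contains_ball
  proof safe
    fix h assume "h \<in> U"
    then obtain e where e: "e > 0" "ball h e \<subseteq> U" using U openE by blast
    then show "\<exists>d>0. ball (\<Phi> h) d \<subseteq> \<Phi> ` U"
      using nbhd[OF e(1), of h] by (meson image_mono subset_trans)
  qed
  have "\<Phi> ` UNIV = UNIV"
    using clopen[of "\<Phi> ` UNIV"] open\<Phi>[OF open_UNIV] clim[OF closed_UNIV] by auto
  let ?D = "{y. \<exists>z z'. z \<noteq> z' \<and> \<Phi> z = y \<and> \<Phi> z' = y}"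
  have "open ?D"
    unfolding open_subopen[of ?D]
  proof safe
    fix z z' assume z: "z \<noteq> z'" "\<Phi> z' = \<Phi> z"
    obtain U U' where U: "open U" "open U'" "z \<in> U" "z' \<in> U'" "U \<inter> U' = {}"
      using hausdorff[OF z(1)] by blast
    show "\<exists>T. open T \<and> \<Phi> z \<in> T \<and> T \<subseteq> ?D"
    proof (intro exI conjI)
      show "open (\<Phi> ` U \<inter> \<Phi> ` U')" using open\<Phi> U by blast
      show "\<Phi> z \<in> \<Phi> ` U \<inter> \<Phi> ` U'" using U z by (metis IntI imageI)
      show "\<Phi> ` U \<inter> \<Phi> ` U' \<subseteq> ?D"
      proof safe
        fix a b assume "\<Phi> a = \<Phi> b" "a \<in> U" "b \<in> U'"
        then show "\<exists>z z'. z \<noteq> z' \<and> \<Phi> z = \<Phi> a \<and> \<Phi> z' = \<Phi> a"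
          using U(5) by (metis disjoint_iff)
      qed
    qed
  qed
  moreover have "open (- ?D - ?M)"
    unfolding open_subopen[of "- ?D - ?M"]
  proof
    fix y assume "y \<in> - ?D - ?M"
    then have y: "\<nexists>z z'. z \<noteq> z' \<and> \<Phi> z = y \<and> \<Phi> z' = y" "y \<notin> ?M" by auto
    obtain z where z: "\<Phi> z = y" using \<open>\<Phi> ` UNIV = UNIV\<close> by (metis UNIV_I image_iff)
    obtain V where V: "open V" "z \<in> V" "inj_on \<Phi> V" using loc z y(2) by blast
    \<comment> \<open>A point outside the image of \<open>- V\<close> has all its preimages in V,
      where \<Phi> is injective.\<close>
    let ?O = "- \<Phi> ` (- V) - ?M"
    have "open ?O" using clim[of "- V"] V(1) clM by (intro open_Diff) (auto simp: closed_def)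
    moreover have "y \<notin> \<Phi> ` (- V)"
    proof
      assume "y \<in> \<Phi> ` (- V)"
      then obtain z' where "y = \<Phi> z'" "z' \<in> - V" by blast
      moreover from this have "z \<noteq> z'" using V(2) by auto
      ultimately show False using y(1) z by metis
    qed
    then have "y \<in> ?O" using y(2) by simp
    moreover have "?O \<subseteq> - ?D - ?M"
    proof
      fix x assume x: "x \<in> ?O"
      have "z = z'" if "\<Phi> z = x" "\<Phi> z' = x" for z z'
      proof -
        have "\<Phi> z \<notin> \<Phi> ` (- V)" "\<Phi> z' \<notin> \<Phi> ` (- V)" using x that by simp_all
        then have "z \<in> V" "z' \<in> V" by blast+
        then show ?thesis using inj_onD[OF V(3)] that by simp
      qed
      then show "x \<in> - ?D - ?M" using x by auto
    qed
    ultimately show "\<exists>T. open T \<and> y \<in> T \<and> T \<subseteq> - ?D - ?M" by blast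
  qed
  ultimately have D: "open ?D" "open (- ?D - ?M)" by blast+
  have "topological_space_class.connected (UNIV - ?M)"
    using fin\<S> sub dim by (intro connected_convex_diff_codim2) auto
  then have "?D \<inter> (UNIV - ?M) = {} \<or> (- ?D - ?M) \<inter> (UNIV - ?M) = {}"
    using connectedD[of "UNIV - ?M" ?D "- ?D - ?M"] D by blast
  moreover obtain y where "y \<in> Q" "y \<notin> ?M" using lowdim[OF uniq(1,2)] by blast
  then have "y \<in> - ?D - ?M" using uniq(3) by auto
  ultimately have "?D \<subseteq> ?M" by blast
  then have "?D = {}" using lowdim[OF D(1)] by blast
  then have "inj \<Phi>" unfolding inj_def by blast
  then show ?thesis using \<open>\<Phi> ` UNIV = UNIV\<close> by (simp add: bij_def)
qed

section \<open>Nests of tubes\<close>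

lemma finite_maximal_set:
  assumes "finite A" "A \<noteq> {}"
  obtains K where "K \<in> A" "\<And>L. L \<in> A \<Longrightarrow> K \<subseteq> L \<Longrightarrow> K = L"
  using finite_has_maximal[OF assms] by blast

lemma finite_minimal_set:
  assumes "finite A" "A \<noteq> {}"
  obtains K where "K \<in> A" "\<And>L. L \<in> A \<Longrightarrow> L \<subseteq> K \<Longrightarrow> L = K"
  using finite_has_minimal[OF assms] by blast

locale fin_graph =
  fixes V :: "'a set" and adj :: "'a \<Rightarrow> 'a \<Rightarrow> bool"
  assumes finite_V: "finite V"
    and adj_sym: "adj u v \<Longrightarrow> adj v u"
begin

definition ngh :: "'a set \<Rightarrow> 'a set" where
  "ngh T = {v \<in> V - T. \<exists>u\<in>T. adj u v}"

text \<open>Connectedness in cut form instead of walks, because the arguments below always ask for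
  an edge leaving a part of T. \<open>tube_iff_conn\<close> compares it with reachability.\<close>

definition conn :: "'a set \<Rightarrow> bool" where
  "conn T \<longleftrightarrow> T \<noteq> {} \<and> T \<subseteq> V \<and> (\<forall>A\<subseteq>T. A \<noteq> {} \<longrightarrow> A \<noteq> T \<longrightarrow> ngh A \<inter> T \<noteq> {})"

definition comps :: "'a set set" where
  "comps = {C. conn C \<and> ngh C = {}}"

definition ptube :: "'a set \<Rightarrow> bool" where
  "ptube T \<longleftrightarrow> conn T \<and> ngh T \<noteq> {}"

definition compat_tubes :: "'a set \<Rightarrow> 'a set \<Rightarrow> bool" where
  "compat_tubes T T' \<longleftrightarrow> T \<subseteq> T' \<or> T' \<subseteq> T \<or> (T \<inter> T' = {} \<and> ngh T \<inter> T' = {})"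

text \<open>Components are adjoined so that every vertex is owned by some tube and every proper tube
  has a parent.\<close>

definition nest :: "'a set set \<Rightarrow> bool" where
  "nest \<N> \<longleftrightarrow> (\<forall>T\<in>\<N>. conn T) \<and> (\<forall>T\<in>\<N>. \<forall>T'\<in>\<N>. compat_tubes T T') \<and> comps \<subseteq> \<N>"

text \<open>These sets label the nodes of the inclusion forest of a nest and partition V; the nest
  is maximal exactly when all of them are singletons.\<close>

definition own :: "'a set set \<Rightarrow> 'a set \<Rightarrow> 'a set" where
  "own \<N> T = {v \<in> T. \<forall>T'\<in>\<N>. T' \<subset> T \<longrightarrow> v \<notin> T'}"

definition child :: "'a set set \<Rightarrow> 'a set \<Rightarrow> 'a set \<Rightarrow> bool" where
  "child \<N> P T \<longleftrightarrow> T \<in> \<N> \<and> T \<subset> P \<and> (\<forall>T'\<in>\<N>. T \<subset> T' \<longrightarrow> P \<subseteq> T')"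

section \<open>Connected sets, components and compatibility\<close>

lemma connD: "conn T \<Longrightarrow> T \<noteq> {}" "conn T \<Longrightarrow> T \<subseteq> V" "conn T \<Longrightarrow> finite T"
  using finite_V finite_subset by (auto simp: conn_def)

lemma finite_ngh: "finite (ngh T)" and ngh_subset: "ngh T \<subseteq> V" and ngh_disjoint: "ngh T \<inter> T = {}"
  using finite_V by (auto simp: ngh_def)

lemma finite_conn: "finite {T. conn T}"
  by (rule finite_subset[of _ "Pow V"]) (use connD(2) finite_V in auto)

lemma ngh_sym: "T \<subseteq> V \<Longrightarrow> T \<inter> S = {} \<Longrightarrow> ngh T \<inter> S \<noteq> {} \<Longrightarrow> ngh S \<inter> T \<noteq> {}"
  using adj_sym by (fastforce simp: ngh_def)

lemma conn_cut: "conn T \<Longrightarrow> A \<subseteq> T \<Longrightarrow> A \<noteq> {} \<Longrightarrow> A \<noteq> T \<Longrightarrow> ngh A \<inter> T \<noteq> {}"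
  by (simp add: conn_def)

lemma conn_subset:
  assumes "conn T" "T \<inter> K \<noteq> {}" "T \<inter> ngh K = {}"
  shows "T \<subseteq> K"
proof (rule ccontr)
  assume "\<not> T \<subseteq> K"
  then have "ngh (T \<inter> K) \<inter> T \<noteq> {}" using assms by (intro conn_cut) auto
  then show False using assms(3) by (auto simp: ngh_def)
qed

lemma conn_Un:
  assumes "conn S" "conn T" "S \<inter> T \<noteq> {} \<or> ngh S \<inter> T \<noteq> {}"
  shows "conn (S \<union> T)"
  unfolding conn_def
proof (intro conjI allI impI notI subsetI)
  fix A assume A: "A \<subseteq> S \<union> T" "A \<noteq> {}" "A \<noteq> S \<union> T" "ngh A \<inter> (S \<union> T) = {}"
  have S: "S \<subseteq> A" if "S \<inter> A \<noteq> {}" using conn_subset[OF assms(1) that] A by auto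
  have T: "T \<subseteq> A" if "T \<inter> A \<noteq> {}" using conn_subset[OF assms(2) that] A by auto
  consider "S \<inter> A = {}" "T \<subseteq> A" | "S \<subseteq> A" "T \<inter> A = {}" using S T A by blast
  then show False
  proof cases
    case 1
    then have "ngh S \<inter> T \<noteq> {}" using assms(3) by auto
    then have "ngh T \<inter> S \<noteq> {}" using ngh_sym[of S T] connD[OF assms(1)] 1 by blast
    then have "ngh A \<inter> S \<noteq> {}" using 1 by (auto simp: ngh_def)
    then show False using A by auto
  next
    case 2
    then have "ngh S \<inter> T \<noteq> {}" using assms(3) by auto
    then have "ngh A \<inter> T \<noteq> {}" using 2 by (auto simp: ngh_def)
    then show False using A by auto
  qed
next
  show "S \<union> T = {} \<Longrightarrow> False" using connD(1)[OF assms(1)] by auto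
next
  fix x assume "x \<in> S \<union> T"
  then show "x \<in> V" using connD(2)[OF assms(1)] connD(2)[OF assms(2)] by auto
qed

lemma conn_sing: "v \<in> V \<Longrightarrow> conn {v}"
  by (auto simp: conn_def)

lemma component_exists:
  assumes "X \<subseteq> V" "v \<in> X"
  obtains K where "conn K" "v \<in> K" "K \<subseteq> X" "ngh K \<inter> X = {}"
proof -
  let ?A = "{K. conn K \<and> v \<in> K \<and> K \<subseteq> X}"
  have "finite ?A" using finite_subset[OF _ finite_conn, of ?A] by auto
  moreover have "{v} \<in> ?A" using assms conn_sing by auto
  ultimately obtain K where K: "K \<in> ?A" "\<And>L. L \<in> ?A \<Longrightarrow> K \<subseteq> L \<Longrightarrow> K = L"
    using finite_maximal_set[of ?A] by (metis (lifting) empty_iff)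
  have "ngh K \<inter> X = {}"
  proof (rule ccontr)
    assume "ngh K \<inter> X \<noteq> {}"
    then obtain u where u: "u \<in> ngh K" "u \<in> X" by auto
    then have "conn (K \<union> {u})" using K(1) conn_sing[of u] assms by (intro conn_Un) auto
    then have "K = K \<union> {u}" using K u by (intro K(2)) auto
    then show False using u by (auto simp: ngh_def)
  qed
  then show ?thesis using that K(1) by blast
qed

lemma compsD: "C \<in> comps \<Longrightarrow> conn C" "C \<in> comps \<Longrightarrow> ngh C = {}"
  by (auto simp: comps_def)

lemma comp_superset: "conn T \<Longrightarrow> C \<in> comps \<Longrightarrow> T \<inter> C \<noteq> {} \<Longrightarrow> T \<subseteq> C"
  using conn_subset compsD by blast

lemma comp_maximal: "conn T \<Longrightarrow> C \<in> comps \<Longrightarrow> C \<subseteq> T \<Longrightarrow> T = C"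
  using comp_superset[of T C] connD(1)[OF compsD(1)[of C]] by fastforce

lemma comp_exists:
  assumes "conn T" obtains C where "C \<in> comps" "T \<subseteq> C"
proof -
  obtain v where v: "v \<in> T" "v \<in> V" using connD[OF assms] by auto
  obtain C where "conn C" "v \<in> C" "ngh C \<inter> V = {}"
    by (rule component_exists[of V v]) (use v in auto)
  then have "C \<in> comps" using ngh_subset[of C] by (auto simp: comps_def)
  then show ?thesis using that comp_superset[OF assms] v \<open>v \<in> C\<close> by blast
qed

lemma comp_ngh: "conn T \<Longrightarrow> C \<in> comps \<Longrightarrow> T \<subseteq> C \<Longrightarrow> ngh T \<subseteq> C"
  using compsD(2)[of C] by (auto simp: ngh_def)

lemma ptube_iff: "ptube T \<longleftrightarrow> conn T \<and> T \<notin> comps"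
  by (auto simp: ptube_def comps_def)

lemma compat_tubes_sym: "T \<subseteq> V \<Longrightarrow> T' \<subseteq> V \<Longrightarrow> compat_tubes T T' \<Longrightarrow> compat_tubes T' T"
  using ngh_sym[of T' T] by (auto simp: compat_tubes_def)

lemma compat_comp: "conn T \<Longrightarrow> C \<in> comps \<Longrightarrow> compat_tubes T C" "conn T \<Longrightarrow> C \<in> comps \<Longrightarrow> compat_tubes C T"
proof -
  show "compat_tubes C T" if T: "conn T" "C \<in> comps" for T
    using comp_superset[OF T] compsD(2)[OF T(2)] by (auto simp: compat_tubes_def)
  then show "compat_tubes T C" if "conn T" "C \<in> comps" for T
    using that compat_tubes_sym connD(2) compsD(1) by meson
qed

section \<open>Inclusion structure of a nest\<close>

lemma nestD:
  assumes "nest \<N>"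
  shows "T \<in> \<N> \<Longrightarrow> conn T" "T \<in> \<N> \<Longrightarrow> T' \<in> \<N> \<Longrightarrow> compat_tubes T T'" "comps \<subseteq> \<N>" "finite \<N>"
  using assms finite_subset[OF _ finite_conn, of \<N>] by (auto simp: nest_def)

lemma nest_ngh_psubset:
  assumes "nest \<N>" "T \<in> \<N>" "S \<in> \<N>" "u \<in> ngh T" "u \<in> S"
  shows "T \<subset> S"
  using nestD(2)[OF assms(1-3)] ngh_disjoint[of T] assms(4,5) by (auto simp: compat_tubes_def)

lemma own_subset: "own \<N> T \<subseteq> T"
  by (auto simp: own_def)

lemma own_least:
  assumes "nest \<N>" "S \<in> \<N>" "T \<in> \<N>" "x \<in> own \<N> S" "x \<in> T"
  shows "S \<subseteq> T"
  using nestD(2)[OF assms(1-3)] assms(3-5) by (auto simp: compat_tubes_def own_def)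

text \<open>The tubes containing X form a chain, so there is a least one S. If X avoided the own
  vertices of S, smaller tubes would cover X; a maximal one T that meets X has no neighbour in X,
  since that neighbour would lie in a larger tube below S. Then X lies in T, against minimality of
  S.\<close>

lemma nest_hull:
  assumes N: "nest \<N>" and X: "conn X"
  obtains S where "S \<in> \<N>" "X \<subseteq> S" "\<And>T. T \<in> \<N> \<Longrightarrow> X \<subseteq> T \<Longrightarrow> S \<subseteq> T" "X \<inter> own \<N> S \<noteq> {}"
proof -
  let ?A = "{T \<in> \<N>. X \<subseteq> T}"
  have "?A \<noteq> {}" using comp_exists[OF X] nestD(3)[OF N] by blast
  moreover have "finite ?A" using nestD(4)[OF N] by auto
  ultimately obtain S where S: "S \<in> ?A" "\<And>T. T \<in> ?A \<Longrightarrow> T \<subseteq> S \<Longrightarrow> T = S"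
    using finite_minimal_set[of ?A] by blast
  have least: "S \<subseteq> T" if "T \<in> \<N>" "X \<subseteq> T" for T
  proof -
    have "compat_tubes S T" using nestD(2)[OF N] S that by auto
    then show ?thesis using that S connD(1)[OF X] by (auto simp: compat_tubes_def)
  qed
  moreover have "X \<inter> own \<N> S \<noteq> {}"
  proof
    assume no: "X \<inter> own \<N> S = {}"
    let ?B = "{T \<in> \<N>. T \<subset> S \<and> T \<inter> X \<noteq> {}}"
    have "?B \<noteq> {}"
    proof -
      obtain x where x: "x \<in> X" using connD(1)[OF X] by blast
      then have "x \<in> S" "x \<notin> own \<N> S" using S(1) no by blast+
      then show ?thesis using x unfolding own_def by blast
    qed
    moreover have "finite ?B" using nestD(4)[OF N] by auto
    ultimately obtain T where T: "T \<in> ?B" "\<And>T'. T' \<in> ?B \<Longrightarrow> T \<subseteq> T' \<Longrightarrow> T = T'"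
      using finite_maximal_set[of ?B] by (metis (lifting))
    have "X \<inter> ngh T = {}"
    proof (rule ccontr)
      assume "X \<inter> ngh T \<noteq> {}"
      then obtain u where u: "u \<in> X" "u \<in> ngh T" by auto
      then have "u \<in> S" "u \<notin> own \<N> S" using S(1) no by blast+
      then obtain T' where T': "T' \<in> \<N>" "T' \<subset> S" "u \<in> T'" unfolding own_def by blast
      have "T \<subset> T'" using nest_ngh_psubset[OF N _ T'(1) u(2) T'(3)] T by auto
      then show False using T(2)[of T'] T' u by auto
    qed
    then have "X \<subseteq> T" using T(1) by (intro conn_subset[OF X]) auto
    then show False using least T(1) by auto
  qed
  ultimately show ?thesis using that S(1) by blast
qed

lemma own_nonempty: assumes "nest \<N>" "S \<in> \<N>" shows "own \<N> S \<noteq> {}"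
proof -
  obtain S' where "S' \<in> \<N>" "S \<subseteq> S'" "\<And>T. T \<in> \<N> \<Longrightarrow> S \<subseteq> T \<Longrightarrow> S' \<subseteq> T" "S \<inter> own \<N> S' \<noteq> {}"
    using nest_hull[OF assms(1) nestD(1)[OF assms]] by blast
  then show ?thesis using assms(2) by (metis inf_le2 subset_antisym subset_empty subset_refl)
qed

lemma own_exists:
  assumes "nest \<N>" "v \<in> V" obtains S where "S \<in> \<N>" "v \<in> own \<N> S"
  using nest_hull[OF assms(1) conn_sing[OF assms(2)]] by (metis disjoint_insert(2) inf_bot_left insert_disjoint(1))

lemma child_exists:
  assumes N: "nest \<N>" and P: "P \<in> \<N>" "x \<in> P" "x \<notin> own \<N> P"
  obtains T where "child \<N> P T" "x \<in> T"
proof -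
  let ?B = "{T \<in> \<N>. T \<subset> P \<and> x \<in> T}"
  have "?B \<noteq> {}" using P by (auto simp: own_def)
  moreover have "finite ?B" using nestD(4)[OF N] by auto
  ultimately obtain T where T: "T \<in> ?B" "\<And>T'. T' \<in> ?B \<Longrightarrow> T \<subseteq> T' \<Longrightarrow> T = T'"
    using finite_maximal_set[of ?B] by (metis (lifting))
  have "P \<subseteq> T'" if "T' \<in> \<N>" "T \<subset> T'" for T'
    using nestD(2)[OF N that(1) P(1)] T that P by (auto simp: compat_tubes_def)
  then have "child \<N> P T" using T(1) unfolding child_def by blast
  then show ?thesis using that T(1) by blast
qed

lemma parent_exists:
  assumes N: "nest \<N>" and T: "T \<in> \<N>" "T \<notin> comps"
  obtains P where "P \<in> \<N>" "child \<N> P T"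
proof -
  let ?B = "{P \<in> \<N>. T \<subset> P}"
  obtain C where "C \<in> comps" "T \<subseteq> C" using comp_exists[OF nestD(1)[OF N T(1)]] .
  then have "C \<in> ?B" using nestD(3)[OF N] T(2) by blast
  then have "?B \<noteq> {}" by blast
  moreover have "finite ?B" using nestD(4)[OF N] by auto
  ultimately obtain P where P: "P \<in> ?B" "\<And>T'. T' \<in> ?B \<Longrightarrow> T' \<subseteq> P \<Longrightarrow> T' = P"
    using finite_minimal_set[of ?B] by (metis (lifting))
  have "P \<subseteq> T'" if "T' \<in> \<N>" "T \<subset> T'" for T'
    using nestD(2)[OF N that(1), of P] P that connD(1)[OF nestD(1)[OF N T(1)]]
    by (auto simp: compat_tubes_def)
  then have "child \<N> P T" using P(1) T(1) unfolding child_def by blast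
  then show ?thesis using that P(1) by blast
qed

text \<open>A tube below P containing a neighbour of T would contain T strictly, contrary to P being
  the next tube above T.\<close>

lemma child_ngh:
  assumes N: "nest \<N>" and P: "P \<in> \<N>" "child \<N> P T"
  shows "ngh T \<inter> P \<noteq> {}" "ngh T \<inter> P \<subseteq> own \<N> P"
proof -
  have T: "T \<in> \<N>" "T \<subset> P" using P by (auto simp: child_def)
  then show "ngh T \<inter> P \<noteq> {}" using conn_cut[of P T] nestD(1)[OF N] P(1) connD(1) by blast
  show "ngh T \<inter> P \<subseteq> own \<N> P"
  proof
    fix u assume u: "u \<in> ngh T \<inter> P"
    have "u \<notin> T'" if "T' \<in> \<N>" "T' \<subset> P" for T'
    proof
      assume "u \<in> T'"
      then have "T \<subset> T'" using nest_ngh_psubset[OF N T(1) that(1)] u by blast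
      then show False using P(2) that unfolding child_def by blast
    qed
    then show "u \<in> own \<N> P" using u by (auto simp: own_def)
  qed
qed

section \<open>Counting tubes by their own vertices\<close>

lemma sum_card_own:
  assumes N: "nest \<N>"
  shows "(\<Sum>T\<in>\<N>. card (own \<N> T)) = card V"
proof -
  have "V = (\<Union>T\<in>\<N>. own \<N> T)"
  proof
    show "V \<subseteq> (\<Union>T\<in>\<N>. own \<N> T)" using own_exists[OF N] by blast
    show "(\<Union>T\<in>\<N>. own \<N> T) \<subseteq> V"
      using own_subset[of \<N>] connD(2)[OF nestD(1)[OF N]] by (meson UN_least subset_trans)
  qed
  moreover have "card (\<Union>T\<in>\<N>. own \<N> T) = (\<Sum>T\<in>\<N>. card (own \<N> T))"
  proof (rule card_UN_disjoint)
    show "finite \<N>" using nestD(4)[OF N] .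
    show "\<forall>T\<in>\<N>. finite (own \<N> T)"
      using finite_subset[OF own_subset] connD(3)[OF nestD(1)[OF N]] by blast
    show "\<forall>T\<in>\<N>. \<forall>T'\<in>\<N>. T \<noteq> T' \<longrightarrow> own \<N> T \<inter> own \<N> T' = {}"
      using own_least[OF N] own_subset[of \<N>] by blast
  qed
  ultimately show ?thesis by simp
qed

lemma card_own_pos: "nest \<N> \<Longrightarrow> T \<in> \<N> \<Longrightarrow> 1 \<le> card (own \<N> T)"
  using own_nonempty[of \<N> T] finite_subset[OF own_subset] connD(3) nestD(1)
  by (metis One_nat_def Suc_leI card_gt_0_iff)

lemma card_nest_le: "nest \<N> \<Longrightarrow> card \<N> \<le> card V"
  using sum_card_own sum_mono[of \<N> "\<lambda>_. 1" "\<lambda>T. card (own \<N> T)"] card_own_pos by fastforce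

lemma card_nest_eq:
  assumes N: "nest \<N>" and "card \<N> = card V" and T: "T \<in> \<N>"
  shows "card (own \<N> T) = 1"
proof -
  have "(\<Sum>T\<in>\<N>. 1) = (\<Sum>T\<in>\<N>. card (own \<N> T))" using sum_card_own[OF N] assms by simp
  then show ?thesis
    using sum_mono_inv[of "\<lambda>_. 1" \<N> "\<lambda>T. card (own \<N> T)" T] card_own_pos[OF N] nestD(4)[OF N] T
    by auto
qed

text \<open>One tube short of maximal: own sets are nonempty and partition V, so exactly one surplus
  vertex remains and a single tube S receives it. This S is where a flip takes place.\<close>

lemma card_nest_Suc:
  assumes N: "nest \<N>" and c: "card \<N> + 1 = card V"
  obtains S where "S \<in> \<N>" "card (own \<N> S) = 2" "\<And>T. T \<in> \<N> \<Longrightarrow> T \<noteq> S \<Longrightarrow> card (own \<N> T) = 1"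
proof -
  have "\<exists>S\<in>\<N>. card (own \<N> S) \<noteq> 1"
  proof (rule ccontr)
    assume "\<not> ?thesis"
    then have "(\<Sum>T\<in>\<N>. card (own \<N> T)) = card \<N>" by simp
    then show False using sum_card_own[OF N] c by simp
  qed
  then obtain S where S: "S \<in> \<N>" "card (own \<N> S) \<noteq> 1" by blast
  then have S2: "card (own \<N> S) \<ge> 2" using card_own_pos[OF N S(1)] by linarith
  let ?N = "\<N> - {S}"
  have fin: "finite ?N" using nestD(4)[OF N] by simp
  have cN: "card ?N + 2 = card V" using c S nestD(4)[OF N] by (simp add: card_Diff_singleton card_gt_0_iff)
      (metis One_nat_def Suc_pred card_gt_0_iff empty_iff)
  have sum: "card (own \<N> S) + (\<Sum>T\<in>?N. card (own \<N> T)) = card V"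
    using sum.remove[OF nestD(4)[OF N] S(1), of "\<lambda>T. card (own \<N> T)"] sum_card_own[OF N] by simp
  have pos: "1 \<le> card (own \<N> T)" if "T \<in> ?N" for T using card_own_pos[OF N] that by auto
  have le: "card ?N \<le> (\<Sum>T\<in>?N. card (own \<N> T))"
    using sum_mono[of ?N "\<lambda>_. 1" "\<lambda>T. card (own \<N> T)"] pos by simp
  then have "card (own \<N> S) = 2" "(\<Sum>T\<in>?N. 1) = (\<Sum>T\<in>?N. card (own \<N> T))"
    using S2 sum cN by simp_all
  moreover have "card (own \<N> T) = 1" if "T \<in> \<N>" "T \<noteq> S" for T
    using sum_mono_inv[OF calculation(2), of T] pos fin that by auto
  ultimately show ?thesis using that S by blast
qed

text \<open>The new tube is the component of S - {s} that contains t; inside S its only possible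
  neighbour is s. A smaller tube of the nest does not contain s, so it is either inside the new tube
  or apart from it.\<close>

lemma nest_insert:
  assumes N: "nest \<N>" and S: "S \<in> \<N>" and st: "s \<in> own \<N> S" "t \<in> own \<N> S" "s \<noteq> t"
  obtains T where "T \<notin> \<N>" "conn T" "nest (insert T \<N>)"
proof -
  have "S \<subseteq> V" using N S nestD connD by blast
  obtain T where T: "conn T" "t \<in> T" "T \<subseteq> S - {s}" "ngh T \<inter> (S - {s}) = {}"
    using component_exists[of "S - {s}" t] st \<open>S \<subseteq> V\<close> own_subset[of \<N> S] by blast
  have "T \<subset> S" using T st own_subset[of \<N> S] by blast
  then have "T \<notin> \<N>" using st T(2) by (auto simp: own_def)
  moreover have c: "compat_tubes T' T" if T': "T' \<in> \<N>" for T'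
  proof -
    consider "S \<subseteq> T'" | "S \<inter> T' = {}" "ngh T' \<inter> S = {}" | "T' \<subset> S"
      using nestD(2)[OF N T' S] by (auto simp: compat_tubes_def)
    then show ?thesis
    proof cases
      case 3
      then have sT': "T' \<inter> ngh T = {}" using st T' T(4) by (auto simp: own_def)
      have "conn T'" using N T' nestD by blast
      show ?thesis
      proof (cases "T' \<inter> T = {}")
        case True
        then have "ngh T' \<inter> T = {}" using ngh_sym[of T' T] sT' connD(2)[OF \<open>conn T'\<close>] by blast
        then show ?thesis using True by (auto simp: compat_tubes_def)
      next
        case False
        then show ?thesis using conn_subset[OF \<open>conn T'\<close>, of T] sT' by (auto simp: compat_tubes_def)
      qed
    qed (use \<open>T \<subset> S\<close> in \<open>auto simp: compat_tubes_def\<close>)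
  qed
  moreover have "compat_tubes T T'" if "T' \<in> \<N>" for T'
    using compat_tubes_sym[OF _ _ c[OF that]] connD(2) nestD(1)[OF N that] T(1) by blast
  moreover have "compat_tubes T T" by (auto simp: compat_tubes_def)
  ultimately have "nest (insert T \<N>)" using T(1) N unfolding nest_def by blast
  then show ?thesis using that \<open>T \<notin> \<N>\<close> T(1) by blast
qed

lemma maximal_nest_card:
  assumes N: "nest \<N>" and max: "\<And>T. conn T \<Longrightarrow> nest (insert T \<N>) \<Longrightarrow> T \<in> \<N>"
  shows "card \<N> = card V"
proof -
  have "card (own \<N> T) = 1" if T: "T \<in> \<N>" for T
  proof (rule ccontr)
    assume "card (own \<N> T) \<noteq> 1"
    moreover obtain s where s: "s \<in> own \<N> T" using own_nonempty[OF N T] by blast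
    ultimately obtain t where "t \<in> own \<N> T" "s \<noteq> t"
      by (metis is_singletonI' is_singleton_altdef empty_iff)
    then show False using nest_insert[OF N T s] max by blast
  qed
  then show ?thesis using sum_card_own[OF N] by simp
qed

section \<open>Functionals vanishing on a nest\<close>

text \<open>
  The data that the tubing of reference induces: \<open>m T\<close> is the vertex of \<open>T\<close> that lies in the fewest
  tubes of reference, and \<open>U T\<close> consists of the neighbours of \<open>T\<close> inside the least tube of
  reference that contains \<open>T\<close> or, if \<open>T\<close> itself is one, of the outermost vertex of its parent.
\<close>

definition selection :: "('a set \<Rightarrow> 'a) \<Rightarrow> ('a set \<Rightarrow> 'a set) \<Rightarrow> bool" where
  "selection m U \<longleftrightarrow> (\<forall>T. conn T \<longrightarrow> m T \<in> T)
     \<and> (\<forall>T. ptube T \<longrightarrow> U T \<noteq> {} \<and> U T \<subseteq> ngh T)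
     \<and> (\<forall>T S. conn T \<longrightarrow> conn S \<longrightarrow> T \<subseteq> S \<longrightarrow> m S \<in> T \<longrightarrow> m T = m S \<and> ngh T \<inter> S \<subseteq> U T)"

lemma selectionD:
  assumes "selection m U"
  shows "conn T \<Longrightarrow> m T \<in> T" "ptube T \<Longrightarrow> U T \<noteq> {}" "ptube T \<Longrightarrow> U T \<subseteq> ngh T" "ptube T \<Longrightarrow> finite (U T)"
    "conn T \<Longrightarrow> conn S \<Longrightarrow> T \<subseteq> S \<Longrightarrow> m S \<in> T \<Longrightarrow> m T = m S"
    "conn T \<Longrightarrow> conn S \<Longrightarrow> T \<subseteq> S \<Longrightarrow> m S \<in> T \<Longrightarrow> ngh T \<inter> S \<subseteq> U T"
  using assms finite_subset[OF _ finite_ngh, of "U T" T] unfolding selection_def by blast+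

text \<open>For k = \<open>tube_sum y\<close> and a proper tube T this is the pairing of y with the
  dual compatibility vector of T; see \<open>selection_ref_nest\<close>.\<close>

definition slope :: "('a set \<Rightarrow> 'a) \<Rightarrow> ('a set \<Rightarrow> 'a set) \<Rightarrow> ('a \<Rightarrow> real) \<Rightarrow> 'a set \<Rightarrow> real" where
  "slope m U k T = (\<Sum>u\<in>U T. k u - k (m T))"

lemma slope_const:
  fixes k :: "'a \<Rightarrow> real"
  assumes "\<And>u. u \<in> U T \<Longrightarrow> k u = c"
  shows "slope m U k T = card (U T) * (c - k (m T))"
  using assms by (simp add: slope_def)

lemma slope_single:
  fixes k :: "'a \<Rightarrow> real"
  assumes "finite (U T)" "w \<in> U T" "k (m T) = c" "\<And>u. u \<in> U T \<Longrightarrow> u \<noteq> w \<Longrightarrow> k u = c"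
  shows "slope m U k T = k w - c"
proof -
  have "slope m U k T = k w - c + (\<Sum>u\<in>U T - {w}. k u - c)"
    using sum.remove[OF assms(1,2), of "\<lambda>u. k u - c"] assms(3) by (simp add: slope_def)
  also have "(\<Sum>u\<in>U T - {w}. k u - c) = 0" using assms(4) by (intro sum.neutral) auto
  finally show ?thesis by simp
qed

lemma slope_pair:
  fixes k :: "'a \<Rightarrow> real"
  assumes "finite (U T)" "v \<in> U T" "w \<in> U T" "v \<noteq> w" "k (m T) = c"
    "\<And>u. u \<in> U T \<Longrightarrow> u \<noteq> v \<Longrightarrow> u \<noteq> w \<Longrightarrow> k u = c"
  shows "slope m U k T = (k v - c) + (k w - c)"
proof -
  have "slope m U k T = k v - c + (k w - c + (\<Sum>u\<in>U T - {v} - {w}. k u - c))"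
    using sum.remove[OF assms(1,2), of "\<lambda>u. k u - c"]
      sum.remove[of "U T - {v}" w "\<lambda>u. k u - c"] assms by (simp add: slope_def)
  also have "(\<Sum>u\<in>U T - {v} - {w}. k u - c) = 0" using assms(6) by (intro sum.neutral) auto
  finally show ?thesis by simp
qed

text \<open>The equation of T solved for the value at one neighbour w, for a tube whose value at
  \<open>m T\<close> is still unknown.\<close>

lemma slope_single_gen:
  fixes k :: "'a \<Rightarrow> real"
  assumes "finite (U T)" "w \<in> U T" "\<And>u. u \<in> U T \<Longrightarrow> u \<noteq> w \<Longrightarrow> k u = c" "slope m U k T = 0"
  shows "k w - c = card (U T) * (k (m T) - c)"
proof -
  have "(\<Sum>u\<in>U T. k u - c) = k w - c + (\<Sum>u\<in>U T - {w}. k u - c)"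
    using sum.remove[OF assms(1,2)] .
  also have "(\<Sum>u\<in>U T - {w}. k u - c) = 0" using assms(3) by (intro sum.neutral) auto
  finally have "(\<Sum>u\<in>U T. k u - c) = k w - c" by simp
  moreover have "slope m U k T = (\<Sum>u\<in>U T. (k u - c) - (k (m T) - c))"
    by (simp add: slope_def)
  moreover have "\<dots> = (\<Sum>u\<in>U T. k u - c) - card (U T) * (k (m T) - c)"
    by (subst sum_subtractf) simp
  ultimately show ?thesis using assms(4) by simp
qed

section \<open>Functions with vanishing slopes and their signs across a flip\<close>

context
  fixes m U and k :: "'a \<Rightarrow> real" and \<N>
  assumes sel: "selection m U" and N: "nest \<N>"
    and zero: "\<forall>T\<in>\<N> - comps. slope m U k T = 0"
begin

lemma nest_ptube: "T \<in> \<N> \<Longrightarrow> T \<notin> comps \<Longrightarrow> ptube T"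
  using nestD(1)[OF N] by (simp add: ptube_iff)

text \<open>All neighbours of T are owned by strictly larger tubes, where k already has the value c
  = \<open>k (m C)\<close>. For a proper tube T the slope therefore collapses to
  \<open>card (U T) * (c - k (m T))\<close>, with a nonzero first factor.\<close>

lemma kernel_anchor:
  assumes T: "T \<in> \<N>" and C: "C \<in> comps" "T \<subseteq> C"
    and above: "\<forall>P\<in>\<N>. T \<subset> P \<longrightarrow> (\<forall>v\<in>own \<N> P. k v = k (m C))"
  shows "\<forall>u\<in>ngh T. k u = k (m C)" "k (m T) = k (m C)"
proof -
  show nT: "\<forall>u\<in>ngh T. k u = k (m C)"
  proof
    fix u assume u: "u \<in> ngh T"
    then obtain P where "P \<in> \<N>" "u \<in> own \<N> P"
      using own_exists[OF N, of u] ngh_subset[of T] by blast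
    then show "k u = k (m C)"
      using above nest_ngh_psubset[OF N T _ u] own_subset[of \<N> P] by blast
  qed
  show "k (m T) = k (m C)"
  proof (cases "T \<in> comps")
    case True
    then have "C = T" using comp_maximal[of C T] C compsD(1) by blast
    then show ?thesis by simp
  next
    case False
    then have pt: "ptube T" using nest_ptube[OF T] by blast
    then have "slope m U k T = card (U T) * (k (m C) - k (m T))"
      using selectionD(3)[OF sel pt] nT by (intro slope_const) blast
    then show ?thesis using bspec[OF zero, of T] T False selectionD(2,4)[OF sel pt] by auto
  qed
qed

text \<open>If w is not \<open>m T\<close>, then \<open>m T\<close> lies in a child A of T and
  equals \<open>m A\<close>. The only neighbour of A inside T is w and the others are neighbours of
  T, so the slope of A reduces to k w - k (m C).\<close>

lemma kernel_own:
  assumes T: "T \<in> \<N>" and C: "C \<in> comps" "T \<subseteq> C"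
    and above: "\<forall>P\<in>\<N>. T \<subset> P \<longrightarrow> (\<forall>v\<in>own \<N> P. k v = k (m C))"
    and single: "own \<N> T = {w}"
  shows "k w = k (m C)"
proof (cases "m T = w")
  case True
  then show ?thesis using kernel_anchor(2)[OF T C above] by blast
next
  case False
  note anchor = kernel_anchor[OF T C above]
  have cT: "conn T" using nestD(1)[OF N T] .
  have "m T \<in> T" using selectionD(1)[OF sel cT] .
  then obtain A where A: "child \<N> T A" "m T \<in> A"
    using child_exists[OF N T] single False by blast
  have A': "A \<in> \<N>" "A \<subset> T" and cA: "conn A" using A(1) nestD(1)[OF N] by (auto simp: child_def)
  have ncA: "A \<notin> comps" using A'(2) comp_maximal[OF cT] by blast
  then have pA: "ptube A" using nest_ptube[OF A'(1)] by blast
  have mA: "m A = m T" "ngh A \<inter> T \<subseteq> U A"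
    using selectionD(5,6)[OF sel cA cT] A A' by auto
  have w: "ngh A \<inter> T = {w}" using child_ngh[OF N T A(1)] single by (metis subset_singletonD)
  have "slope m U k A = k w - k (m C)"
  proof (rule slope_single)
    show "finite (U A)" using selectionD(4)[OF sel pA] .
    show "w \<in> U A" using w mA by blast
    show "k (m A) = k (m C)" using mA anchor(2) by simp
    fix u assume u: "u \<in> U A" "u \<noteq> w"
    then have "u \<in> ngh A" "u \<notin> T" using selectionD(3)[OF sel pA] w by auto
    then have "u \<in> ngh T" using A'(2) by (auto simp: ngh_def)
    then show "k u = k (m C)" using anchor(1) by blast
  qed
  then show ?thesis using zero A'(1) ncA by simp
qed

text \<open>Induction downwards from the component, on the size of C - T. The parameter S cuts off a
  tube where own vertices may fail to be unique: it is {} for a maximal tubing and the tube with two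
  own vertices for a flip.\<close>

lemma kernel_constant:
  assumes "\<forall>T\<in>\<N>. \<not> T \<subseteq> S \<longrightarrow> card (own \<N> T) = 1"
    and "T \<in> \<N>" "\<not> T \<subseteq> S" "C \<in> comps" "T \<subseteq> C" "v \<in> own \<N> T"
  shows "k v = k (m C)"
  using assms(2-)
proof (induction "card (C - T)" arbitrary: T v rule: less_induct)
  case less
  have own: "own \<N> T = {v}"
    using assms(1) less.prems by (auto simp: card_1_singleton_iff)
  have "k v' = k (m C)" if P: "P \<in> \<N>" "T \<subset> P" "v' \<in> own \<N> P" for P v'
  proof (rule less.hyps)
    have cP: "conn P" and "conn T" using nestD(1)[OF N] P less.prems(1) by auto
    then have "P \<inter> C \<noteq> {}" using connD(1)[of T] P less.prems(4) by blast
    then show PC: "P \<subseteq> C" using comp_superset[OF cP less.prems(3)] by blast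
    have "C - P \<subset> C - T" using P(2) PC by blast
    then show "card (C - P) < card (C - T)"
      using psubset_card_mono[of "C - T"] connD(3)[OF compsD(1)[OF less.prems(3)]] by blast
    show "\<not> P \<subseteq> S" using P(2) less.prems(2) by blast
  qed (use P less.prems(3) in auto)
  then have "\<forall>P\<in>\<N>. T \<subset> P \<longrightarrow> (\<forall>v\<in>own \<N> P. k v = k (m C))" by blast
  then show ?case using kernel_own[OF less.prems(1,3,4) _ own] by blast
qed

text \<open>The case where the anchor of \<open>S\<close> lies in \<open>T2\<close>; the other one is symmetric.\<close>

lemma flip_slopes_aux:
  assumes S: "S \<in> \<N>" "own \<N> S = {s, t}" "s \<noteq> t"
    and kS: "\<forall>u\<in>ngh S. k u = c" "k (m S) = c"
    and T1: "conn T1" "T1 \<subset> S" "t \<in> T1" "ngh T1 \<inter> S = {s}" "\<forall>A\<in>\<N>. compat_tubes A T1"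
    and T2: "conn T2" "T2 \<subset> S" "s \<in> T2" "ngh T2 \<inter> S = {t}" "\<forall>A\<in>\<N>. compat_tubes A T2"
    and m2: "m S \<in> T2"
  shows "slope m U k T1 * slope m U k T2 \<le> 0"
proof -
  have cS: "conn S" using nestD(1)[OF N S(1)] .
  have sT1: "s \<notin> T1" and tT2: "t \<notin> T2"
    using T1(4) T2(4) ngh_disjoint[of T1] ngh_disjoint[of T2] by blast+
  have p1: "ptube T1" and p2: "ptube T2" using T1(1,4) T2(1,4) by (auto simp: ptube_def)
  have ngS: "u \<in> ngh S" if "u \<in> ngh A" "u \<notin> S" "A \<subseteq> S" for u A
    using that by (auto simp: ngh_def)
  have U1: "k u = c" if "u \<in> U T1" "u \<noteq> s" for u
  proof -
    have "u \<in> ngh T1" using selectionD(3)[OF sel p1] that by blast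
    then show ?thesis using kS(1) T1(2,4) ngS[of u T1] that by blast
  qed
  have U2: "k u = c" if "u \<in> U T2" "u \<noteq> t" for u
  proof -
    have "u \<in> ngh T2" using selectionD(3)[OF sel p2] that by blast
    then show ?thesis using kS(1) T2(2,4) ngS[of u T2] that by blast
  qed
  \<comment> \<open>Inside S, a child of S sees at most s and t. It lies in T1 exactly when it sees
    t, and in T2 exactly when it sees s, because T1 contains t but not s and T2 contains s but not
    t.\<close>
  have childS: "conn A \<and> ptube A \<and> slope m U k A = 0 \<and> A \<subset> S \<and> s \<notin> A \<and> t \<notin> A
      \<and> ngh A \<inter> S \<subseteq> {s, t} \<and> (\<forall>u\<in>U A. u \<noteq> s \<longrightarrow> u \<noteq> t \<longrightarrow> k u = c)
      \<and> (t \<in> ngh A \<or> A \<inter> T1 \<noteq> {} \<longrightarrow> A \<subseteq> T1) \<and> (A \<subseteq> T1 \<longrightarrow> t \<in> ngh A)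
      \<and> (s \<in> ngh A \<or> A \<inter> T2 \<noteq> {} \<longrightarrow> A \<subseteq> T2) \<and> (A \<subseteq> T2 \<longrightarrow> s \<in> ngh A)"
    if A: "child \<N> S A" for A
  proof -
    have A': "A \<in> \<N>" "A \<subset> S" using A by (auto simp: child_def)
    have cA: "conn A" using nestD(1)[OF N A'(1)] .
    have nc: "A \<notin> comps" using A'(2) comp_maximal[OF cS] by blast
    have pA: "ptube A" using nest_ptube[OF A'(1) nc] .
    have st: "s \<notin> A" "t \<notin> A" using S(2) A' by (auto simp: own_def)
    have ngA: "ngh A \<inter> S \<subseteq> {s, t}" using child_ngh(2)[OF N S(1) A] S(2) by simp
    have "A \<subseteq> T1" if "t \<in> ngh A \<or> A \<inter> T1 \<noteq> {}"
      using bspec[OF T1(5) A'(1)] that st T1(3) by (auto simp: compat_tubes_def)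
    moreover have "t \<in> ngh A" if "A \<subseteq> T1"
      using conn_cut[OF T1(1) that connD(1)[OF cA]] st T1(2,3) sT1 ngA by blast
    moreover have "A \<subseteq> T2" if "s \<in> ngh A \<or> A \<inter> T2 \<noteq> {}"
      using bspec[OF T2(5) A'(1)] that st T2(3) by (auto simp: compat_tubes_def)
    moreover have "s \<in> ngh A" if "A \<subseteq> T2"
      using conn_cut[OF T2(1) that connD(1)[OF cA]] st T2(2,3) tT2 ngA by blast
    moreover have "k u = c" if "u \<in> U A" "u \<noteq> s" "u \<noteq> t" for u
    proof -
      have "u \<in> ngh A" using selectionD(3)[OF sel pA] that by blast
      then show ?thesis using kS(1) A'(2) ngA ngS[of u A] that by blast
    qed
    ultimately show ?thesis using cA pA bspec[OF zero, of A] nc A' st ngA by blast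
  qed
  have mT2: "m T2 = m S" and UT2: "t \<in> U T2"
    using selectionD(5,6)[OF sel T2(1) cS _ m2] T2(2,4) by auto
  have sl2: "slope m U k T2 = k t - c"
    using selectionD(4)[OF sel p2] UT2 mT2 kS(2) U2 by (intro slope_single) auto
  show ?thesis
  proof (cases "m S \<in> T1")
    \<comment> \<open>\<open>m S\<close> lies in both tubes, hence in a child A of S that sees both
      s and t. The equation of A reads (k s - c) + (k t - c) = 0, and the two slopes are these
      summands.\<close>
    case True
    have mT1: "m T1 = m S" and UT1: "s \<in> U T1"
      using selectionD(5,6)[OF sel T1(1) cS _ True] T1(2,4) by auto
    have sl1: "slope m U k T1 = k s - c"
      using selectionD(4)[OF sel p1] UT1 mT1 kS(2) U1 by (intro slope_single) auto
    have "m S \<noteq> s" "m S \<noteq> t" using True m2 sT1 tT2 by auto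
    moreover have "m S \<in> S" using selectionD(1)[OF sel cS] .
    ultimately obtain A where A: "child \<N> S A" "m S \<in> A"
      using child_exists[OF N S(1)] S(2) by blast
    note cA = childS[OF A(1)]
    have AT: "s \<in> ngh A" "t \<in> ngh A" using cA A(2) True m2 by blast+
    have mA: "m A = m S" "ngh A \<inter> S \<subseteq> U A"
      using selectionD(5,6)[OF sel _ cS _ A(2)] cA by auto
    have sS: "s \<in> S" "t \<in> S" using S(2) own_subset[of \<N> S] by auto
    have "slope m U k A = (k s - c) + (k t - c)"
    proof (rule slope_pair)
      show "finite (U A)" using selectionD(4)[OF sel] cA by blast
    qed (use AT mA sS S(3) kS(2) cA in auto)
    then have "k t - c = - (k s - c)" using cA by simp
    then show ?thesis using sl1 sl2 by (metis mult_minus_right neg_le_0_iff_le zero_le_square)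
  next
    \<comment> \<open>Unless \<open>m S\<close> is s, the child of S that contains it sees s but not
      t, and its equation forces k s = c.\<close>
    case False
    have ks: "k s = c"
    proof (cases "m S = s")
      case True then show ?thesis using kS(2) by simp
    next
      case neq: False
      have "m S \<noteq> t" using m2 tT2 by auto
      moreover have "m S \<in> S" using selectionD(1)[OF sel cS] .
      ultimately obtain A where A: "child \<N> S A" "m S \<in> A"
        using child_exists[OF N S(1)] S(2) neq by blast
      note cA = childS[OF A(1)]
      have AT: "s \<in> ngh A" "t \<notin> ngh A" using cA A(2) False m2 by blast+
      have mA: "m A = m S" "ngh A \<inter> S \<subseteq> U A"
        using selectionD(5,6)[OF sel _ cS _ A(2)] cA by auto
      have sS: "s \<in> S" using S(2) own_subset[of \<N> S] by auto
      have "slope m U k A = k s - c"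
      proof (rule slope_single)
        show "finite (U A)" using selectionD(4)[OF sel] cA by blast
        show "s \<in> U A" using AT mA sS by blast
        show "k (m A) = c" using mA kS(2) by simp
        fix u assume u: "u \<in> U A" "u \<noteq> s"
        then have "u \<noteq> t" using AT selectionD(3)[OF sel] cA by blast
        then show "k u = c" using cA u by blast
      qed
      then show ?thesis using cA by simp
    qed
    have sl1: "slope m U k T1 = card (U T1) * (c - k (m T1))"
      using U1 ks by (intro slope_const) auto
    have mT1: "m T1 \<in> T1" using selectionD(1)[OF sel T1(1)] .
    \<comment> \<open>Both slopes become multiples of k (m T1) - c, with the factors
      \<open>- card (U T1)\<close> and q. Here q is 1 if t is \<open>m T1\<close>, and otherwise
      \<open>card (U A)\<close> by the equation of the child A that contains
      \<open>m T1\<close>.\<close>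
    have "\<exists>q\<ge>0. k t - c = q * (k (m T1) - c)"
    proof (cases "m T1 = t")
      case True then show ?thesis by (intro exI[of _ 1]) auto
    next
      case neq: False
      have "m T1 \<noteq> s" "m T1 \<in> S" using mT1 sT1 T1(2) by auto
      then obtain A where A: "child \<N> S A" "m T1 \<in> A"
        using child_exists[OF N S(1)] S(2) neq by blast
      note cA = childS[OF A(1)]
      have AT: "t \<in> ngh A" "A \<subseteq> T1" using cA A(2) mT1 by blast+
      have mA: "m A = m T1" "ngh A \<inter> T1 \<subseteq> U A"
        using selectionD(5,6)[OF sel _ T1(1) AT(2) A(2)] cA by auto
      have "k t - c = card (U A) * (k (m A) - c)"
      proof (rule slope_single_gen)
        show "finite (U A)" using selectionD(4)[OF sel] cA by blast
        show "t \<in> U A" using AT mA T1(3) by blast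
        show "slope m U k A = 0" using cA by blast
        show "k u = c" if "u \<in> U A" "u \<noteq> t" for u
          using cA that ks by (cases "u = s") simp_all
      qed
      then show ?thesis using mA by (intro exI[of _ "real (card (U A))"]) auto
    qed
    then obtain q where q: "q \<ge> 0" "k t - c = q * (k (m T1) - c)" by blast
    have "slope m U k T1 * slope m U k T2 = - (card (U T1) * q * (k (m T1) - c)\<^sup>2)"
      unfolding sl1 sl2 q(2) by (simp add: power2_eq_square algebra_simps)
    also have "\<dots> \<le> 0" using q(1) by simp
    finally show ?thesis .
  qed
qed

end

text \<open>Let P be the least tube of the nest containing T. Both T and P - T contain an own vertex
  of P: the first by \<open>nest_hull\<close>, the second because P still owns a vertex after T is
  inserted. So P owns two vertices and must be S.\<close>

lemma flip_tube:
  assumes N: "nest \<N>" and S: "S \<in> \<N>" and single: "\<forall>T\<in>\<N>. T \<noteq> S \<longrightarrow> card (own \<N> T) = 1"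
    and T: "T \<notin> \<N>" "nest (insert T \<N>)"
  shows "T \<subset> S" "T \<inter> own \<N> S \<noteq> {}" "ngh T \<inter> S \<noteq> {}" "ngh T \<inter> S \<subseteq> own \<N> S - T"
proof -
  have cT: "conn T" using nestD(1)[OF T(2)] by blast
  obtain P where P: "P \<in> \<N>" "T \<subseteq> P" "\<And>Q. Q \<in> \<N> \<Longrightarrow> T \<subseteq> Q \<Longrightarrow> P \<subseteq> Q" "T \<inter> own \<N> P \<noteq> {}"
    using nest_hull[OF N cT] by metis
  have TP: "T \<subset> P" using P T(1) by blast
  obtain x where x: "x \<in> own (insert T \<N>) P"
    using own_nonempty[OF T(2), of P] P(1) by blast
  then have x': "x \<in> own \<N> P" "x \<notin> T" using TP by (auto simp: own_def)
  obtain y where y: "y \<in> T" "y \<in> own \<N> P" using P(4) by blast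
  have PS: "P = S"
  proof (rule ccontr)
    assume "P \<noteq> S"
    then have "card (own \<N> P) = 1" using single P(1) by blast
    then have "x = y" using x' y by (auto simp: card_1_singleton_iff)
    then show False using x' y by blast
  qed
  show "T \<subset> S" "T \<inter> own \<N> S \<noteq> {}" using TP P(4) PS by blast+
  have ch: "child (insert T \<N>) S T" using TP P(3) PS by (auto simp: child_def)
  have S': "S \<in> insert T \<N>" using S by blast
  show "ngh T \<inter> S \<noteq> {}" using child_ngh(1)[OF T(2) S' ch] .
  show "ngh T \<inter> S \<subseteq> own \<N> S - T"
    using child_ngh(2)[OF T(2) S' ch] ngh_disjoint[of T] by (auto simp: own_def)
qed

text \<open>The two tubes divide the two own vertices of S: each contains one and has the other as
  its only neighbour inside S. The vanishing case of the inequality is settled in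
  \<open>flip_no_relation\<close>.\<close>

lemma flip_slopes:
  assumes sel: "selection m U" and N: "nest \<N>" and c: "card \<N> + 1 = card V"
    and zero: "\<forall>T\<in>\<N> - comps. slope m U k T = 0"
    and T1: "T1 \<notin> \<N>" "nest (insert T1 \<N>)" and T2: "T2 \<notin> \<N>" "nest (insert T2 \<N>)"
    and ne: "T1 \<noteq> T2"
  shows "slope m U k T1 * slope m U k T2 \<le> 0"
proof -
  obtain S where S: "S \<in> \<N>" "card (own \<N> S) = 2"
    and single: "\<forall>T\<in>\<N>. T \<noteq> S \<longrightarrow> card (own \<N> T) = 1"
    using card_nest_Suc[OF N c] by metis
  note F1 = flip_tube[OF N S(1) single T1] and F2 = flip_tube[OF N S(1) single T2]
  have c1: "conn T1" and c2: "conn T2" using nestD(1)[OF T1(2)] nestD(1)[OF T2(2)] by blast+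
  obtain a b where ab: "own \<N> S = {a, b}" "a \<noteq> b" using S(2) by (auto simp: card_2_iff)
  obtain t where t: "t \<in> T1" "t \<in> own \<N> S" using F1(2) by blast
  obtain s where s: "s \<in> own \<N> S" "s \<notin> T1" using F1(3,4) by blast
  have st: "own \<N> S = {s, t}" "s \<noteq> t" using ab s t by auto
  have n1: "ngh T1 \<inter> S = {s}" using F1(3,4) st t by auto
  \<comment> \<open>If both tubes contained t, then s would be the only neighbour of either inside
    S, and each tube would contain the other.\<close>
  have tT2: "t \<notin> T2"
  proof
    assume "t \<in> T2"
    then have "ngh T2 \<inter> S \<subseteq> {s} - T2" using F2(4) st(1) by blast
    then have n2: "ngh T2 \<inter> S = {s}" "s \<notin> T2" using F2(3) by blast+
    have ne': "T1 \<inter> T2 \<noteq> {}" "T2 \<inter> T1 \<noteq> {}" using t \<open>t \<in> T2\<close> by blast+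
    have "T1 \<inter> ngh T2 = {}" using n2 F1(1) s(2) by auto
    then have "T1 \<subseteq> T2" using conn_subset[OF c1 ne'(1)] by blast
    moreover have "T2 \<inter> ngh T1 = {}" using n1 F2(1) n2(2) by auto
    then have "T2 \<subseteq> T1" using conn_subset[OF c2 ne'(2)] by blast
    ultimately show False using ne by blast
  qed
  then have sT2: "s \<in> T2" using F2(2) st by auto
  have n2: "ngh T2 \<inter> S = {t}" using F2(3,4) st sT2 by auto
  obtain C where C: "C \<in> comps" "S \<subseteq> C" using comp_exists[OF nestD(1)[OF N S(1)]] .
  have "k v = k (m C)" if P: "P \<in> \<N>" "S \<subset> P" "v \<in> own \<N> P" for P v
  proof (rule kernel_constant[OF sel N zero])
    show "\<forall>T\<in>\<N>. \<not> T \<subseteq> S \<longrightarrow> card (own \<N> T) = 1" using single by blast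
    have "conn P" using nestD(1)[OF N P(1)] .
    then show "P \<subseteq> C"
      using comp_superset[of P C] C connD(1)[OF nestD(1)[OF N S(1)]] P(2) by blast
    show "\<not> P \<subseteq> S" using P(2) by blast
  qed (use P C in auto)
  then have above: "\<forall>P\<in>\<N>. S \<subset> P \<longrightarrow> (\<forall>v\<in>own \<N> P. k v = k (m C))" by blast
  note kS = kernel_anchor[OF sel N zero S(1) C above]
  have cc: "\<forall>A\<in>\<N>. compat_tubes A T1" "\<forall>A\<in>\<N>. compat_tubes A T2"
    using nestD(2)[OF T1(2)] nestD(2)[OF T2(2)] by blast+
  have cS: "conn S" using nestD(1)[OF N S(1)] .
  have mS: "m S \<in> S" using selectionD(1)[OF sel cS] .
  \<comment> \<open>\<open>m S\<close> is s or t, or lies in a child of S; that child sees s or t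
    and, by compatibility, lies in the tube containing that vertex.\<close>
  have "m S \<in> T1 \<or> m S \<in> T2"
  proof (cases "m S \<in> own \<N> S")
    case True then show ?thesis using st t sT2 by auto
  next
    case False
    then obtain A where A: "child \<N> S A" "m S \<in> A" using child_exists[OF N S(1) mS] by blast
    have A': "A \<in> \<N>" "A \<subset> S" using A(1) by (auto simp: child_def)
    then have stA: "s \<notin> A" "t \<notin> A" using st(1) by (auto simp: own_def)
    have "t \<in> ngh A \<or> s \<in> ngh A" using child_ngh[OF N S(1) A(1)] st(1) by auto
    then have "A \<subseteq> T1 \<or> A \<subseteq> T2"
      using bspec[OF cc(1) A'(1)] bspec[OF cc(2) A'(1)] stA t sT2 by (auto simp: compat_tubes_def)
    then show ?thesis using A(2) by blast
  qed
  then show ?thesis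
  proof
    assume "m S \<in> T2"
    then show ?thesis
      using flip_slopes_aux[OF sel N zero S(1) st kS c1 F1(1) t(1) n1 cc(1) c2 F2(1) sT2 n2 cc(2)] by blast
  next
    assume *: "m S \<in> T1"
    have st': "own \<N> S = {t, s}" "t \<noteq> s" using st by auto
    show ?thesis
      using flip_slopes_aux[OF sel N zero S(1) st' kS c2 F2(1) sT2 n2 cc(2) c1 F1(1) t(1) n1 cc(1) *]
      by (simp add: mult.commute)
  qed
qed

section \<open>Compatibility degrees as slopes\<close>

definition cdegree :: "'a set \<Rightarrow> 'a set \<Rightarrow> real" where
  "cdegree T T' = (if T = T' then - 1 else if T \<subseteq> T' then 0 else card (ngh T \<inter> T'))"

text \<open>In the proof f T is the least tube of the nest containing T, p T the parent and w S the
  own vertex of S. Compare [u in T'] for u in \<open>U T\<close> with [m T in T']. If T lies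
  strictly in T', all brackets are 1; if T is not inside T', then m T is not in T' and neighbours
  are counted; if T = T', only [m T in T] survives and gives -1.\<close>

lemma selection_of_nest:
  assumes N: "nest \<N>" and single: "\<forall>T\<in>\<N>. card (own \<N> T) = 1"
  obtains m U where "selection m U"
    and "\<And>y T. ptube T \<Longrightarrow> (\<Sum>T'\<in>\<N> - comps. y T' * cdegree T T')
           = slope m U (\<lambda>v. \<Sum>T'\<in>\<N> - comps. if v \<in> T' then y T' else 0) T"
proof -
  have "\<forall>T. \<exists>S. conn T \<longrightarrow> S \<in> \<N> \<and> T \<subseteq> S \<and> (\<forall>T'\<in>\<N>. T \<subseteq> T' \<longrightarrow> S \<subseteq> T') \<and> T \<inter> own \<N> S \<noteq> {}"
    using nest_hull[OF N] by metis
  then obtain f where f: "\<And>T. conn T \<Longrightarrow> f T \<in> \<N>" "\<And>T. conn T \<Longrightarrow> T \<subseteq> f T"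
    "\<And>T T'. conn T \<Longrightarrow> T' \<in> \<N> \<Longrightarrow> T \<subseteq> T' \<Longrightarrow> f T \<subseteq> T'" "\<And>T. conn T \<Longrightarrow> T \<inter> own \<N> (f T) \<noteq> {}"
    by metis
  have "\<forall>T. \<exists>P. T \<in> \<N> \<longrightarrow> T \<notin> comps \<longrightarrow> P \<in> \<N> \<and> child \<N> P T"
    using parent_exists[OF N] by metis
  then obtain p where p: "\<And>T. T \<in> \<N> \<Longrightarrow> T \<notin> comps \<Longrightarrow> p T \<in> \<N>"
    "\<And>T. T \<in> \<N> \<Longrightarrow> T \<notin> comps \<Longrightarrow> child \<N> (p T) T"
    by metis
  define w where "w = (\<lambda>S. the_elem (own \<N> S))"
  have w: "own \<N> S = {w S}" if "S \<in> \<N>" for S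
    using single that by (metis w_def card_1_singleton_iff One_nat_def the_elem_eq)
  define m where "m = (\<lambda>T. w (f T))"
  define U where "U = (\<lambda>T. if T \<in> \<N> then {w (p T)} else ngh T \<inter> f T)"
  have m: "m T \<in> T" "m T \<in> own \<N> (f T)" if "conn T" for T
    using f(1,4)[OF that] w[OF f(1)[OF that]] by (auto simp: m_def)
  have sub_iff: "T \<subseteq> T' \<longleftrightarrow> m T \<in> T'" if "conn T" "T' \<in> \<N>" for T T'
    using m[OF that(1)] f(2)[OF that(1)] own_least[OF N f(1)[OF that(1)] that(2) m(2)[OF that(1)]] by blast
  have fN: "f T = T" if "T \<in> \<N>" for T
    using f(2,3)[OF nestD(1)[OF N that]] that by blast
  have par: "w (p T) \<in> ngh T \<and> T \<subset> p T \<and> p T \<in> \<N> \<and> w (p T) \<in> own \<N> (p T)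
      \<and> (\<forall>T'\<in>\<N>. T \<subset> T' \<longrightarrow> p T \<subseteq> T')"
    if "T \<in> \<N>" "T \<notin> comps" for T
  proof -
    have P: "p T \<in> \<N>" "child \<N> (p T) T" using p that by blast+
    then have "ngh T \<inter> p T \<noteq> {}" "ngh T \<inter> p T \<subseteq> {w (p T)}"
      using child_ngh[OF N P] w by auto
    then have "w (p T) \<in> ngh T" by blast
    then show ?thesis using P w[OF P(1)] by (auto simp: child_def)
  qed
  have "selection m U"
    unfolding selection_def
  proof (intro conjI allI impI)
    fix T assume "conn T" then show "m T \<in> T" using m by blast
  next
    fix T assume T: "ptube T"
    then have cT: "conn T" "T \<notin> comps" by (auto simp: ptube_iff)
    show "U T \<noteq> {}"
    proof (cases "T \<in> \<N>")
      case False
      then have "T \<noteq> f T" using f(1)[OF cT(1)] by metis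
      then have "ngh T \<inter> f T \<noteq> {}"
        using conn_cut[OF nestD(1)[OF N f(1)[OF cT(1)]] f(2)[OF cT(1)]] connD(1)[OF cT(1)] by blast
      then show ?thesis using False by (simp add: U_def)
    qed (simp add: U_def)
    show "U T \<subseteq> ngh T" using par cT by (auto simp: U_def)
  next
    fix T S assume T: "conn T" "conn S" "T \<subseteq> S" "m S \<in> T"
    have "f T \<subseteq> f S" using f(3)[OF T(1) f(1)[OF T(2)]] T(3) f(2)[OF T(2)] by blast
    moreover have "f S \<subseteq> f T"
      using own_least[OF N f(1)[OF T(2)] f(1)[OF T(1)] m(2)[OF T(2)]] T(4) f(2)[OF T(1)] by blast
    ultimately have eq: "f T = f S" by blast
    then show "m T = m S" by (simp add: m_def)
    show "ngh T \<inter> S \<subseteq> U T"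
    proof (cases "T \<in> \<N>")
      case True
      then have "S \<subseteq> T" using fN eq f(2)[OF T(2)] by auto
      then show ?thesis using ngh_disjoint[of T] by blast
    next
      case False
      then show ?thesis using eq f(2)[OF T(2)] by (auto simp: U_def)
    qed
  qed
  moreover have "(\<Sum>T'\<in>\<N> - comps. y T' * cdegree T T')
      = slope m U (\<lambda>v. \<Sum>T'\<in>\<N> - comps. if v \<in> T' then y T' else 0) T" if T: "ptube T" for y T
  proof -
    have cT: "conn T" "T \<notin> comps" using T by (auto simp: ptube_iff)
    have deg: "cdegree T T' = (\<Sum>u\<in>U T. of_bool (u \<in> T') - of_bool (m T \<in> T'))"
      if T': "T' \<in> \<N>" for T'
    proof (cases "T \<in> \<N>")
      case True
      note P = par[OF True cT(2)]
      have UT: "U T = {w (p T)}" using True by (simp add: U_def)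
      have wp: "w (p T) \<in> T' \<longleftrightarrow> T \<subset> T'"
      proof
        assume "w (p T) \<in> T'"
        then have "p T \<subseteq> T'" using own_least[OF N, of "p T" T' "w (p T)"] P T' by simp
        then show "T \<subset> T'" using P by (meson psubset_subset_trans)
      next
        assume "T \<subset> T'"
        then show "w (p T) \<in> T'" using P T' own_subset[of \<N> "p T"] by blast
      qed
      have "ngh T \<inter> T' = {}" if "\<not> T \<subseteq> T'"
        using nest_ngh_psubset[OF N True T'] that by blast
      then show ?thesis
        using sub_iff[OF cT(1) T'] wp unfolding UT cdegree_def by auto
    next
      case False
      then have UT: "U T = ngh T \<inter> f T" and ne: "T \<noteq> T'" using T' by (auto simp: U_def)
      show ?thesis
      proof (cases "T \<subseteq> T'")
        case True
        then have "u \<in> T'" if "u \<in> U T" for u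
          using f(3)[OF cT(1) T'] UT that by blast
        then show ?thesis using True ne sub_iff[OF cT(1) T'] by (simp add: cdegree_def)
      next
        case F: False
        \<comment> \<open>Restricting \<open>U T\<close> to f T loses no neighbour in T': one
          outside f T would be a neighbour of f T, forcing f T and hence T into T'.\<close>
        have "u \<in> f T" if u: "u \<in> ngh T" "u \<in> T'" for u
        proof (rule ccontr)
          assume "u \<notin> f T"
          then have "u \<in> ngh (f T)" using u f(2)[OF cT(1)] by (auto simp: ngh_def)
          then have "f T \<subset> T'" using nest_ngh_psubset[OF N f(1)[OF cT(1)] T'] u by blast
          then show False using F f(2)[OF cT(1)] by blast
        qed
        then have "ngh T \<inter> T' = {u \<in> U T. u \<in> T'}" using UT by blast
        moreover have "finite (U T)" using UT finite_ngh by simp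
        ultimately show ?thesis
          using F ne sub_iff[OF cT(1) T'] by (simp add: cdegree_def sum.If_cases of_bool_def Int_def)
      qed
    qed
    have "(\<Sum>T'\<in>\<N> - comps. y T' * cdegree T T')
        = (\<Sum>T'\<in>\<N> - comps. \<Sum>u\<in>U T. y T' * (of_bool (u \<in> T') - of_bool (m T \<in> T')))"
      by (intro sum.cong) (simp_all add: deg sum_distrib_left)
    also have "\<dots> = (\<Sum>u\<in>U T. \<Sum>T'\<in>\<N> - comps. y T' * (of_bool (u \<in> T') - of_bool (m T \<in> T')))"
      by (rule sum.swap)
    also have "\<dots> = slope m U (\<lambda>v. \<Sum>T'\<in>\<N> - comps. if v \<in> T' then y T' else 0) T"
      unfolding slope_def sum_subtractf[symmetric] by (intro sum.cong refl) (auto simp: of_bool_def)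
    finally show ?thesis .
  qed
  ultimately show ?thesis using that by blast
qed

section \<open>Weights of a height function\<close>

definition weight :: "('a \<Rightarrow> real) \<Rightarrow> 'a set \<Rightarrow> real" where
  "weight h T = max 0 (Min (h ` T) - Max (h ` ngh T))"

lemma weight_nonneg: "0 \<le> weight h T"
  by (simp add: weight_def)

lemma weight_pos_iff:
  assumes "ptube T"
  shows "0 < weight h T \<longleftrightarrow> (\<forall>u\<in>T. \<forall>v\<in>ngh T. h v < h u)"
proof -
  have "finite T" "T \<noteq> {}" "ngh T \<noteq> {}" using assms connD by (auto simp: ptube_def)
  have "0 < weight h T \<longleftrightarrow> Max (h ` ngh T) < Min (h ` T)"
    by (simp add: weight_def less_max_iff_disj)
  also have "\<dots> \<longleftrightarrow> (\<forall>v\<in>ngh T. h v < Min (h ` T))"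
    using finite_ngh[of T] \<open>ngh T \<noteq> {}\<close> by (subst Max_less_iff) auto
  also have "\<dots> \<longleftrightarrow> (\<forall>v\<in>ngh T. \<forall>u\<in>T. h v < h u)"
    using \<open>finite T\<close> \<open>T \<noteq> {}\<close> by simp
  finally show ?thesis by blast
qed

text \<open>Two incompatible connected sets each contain a neighbour of the other; positive weights
  would order the heights of these two vertices both ways.\<close>

lemma weight_pos_compat:
  assumes T: "ptube T" "0 < weight h T" and T': "ptube T'" "0 < weight h T'"
  shows "compat_tubes T T'"
proof (rule ccontr)
  assume nc: "\<not> compat_tubes T T'"
  have c: "conn T" "conn T'" using T T' by (auto simp: ptube_def)
  have meet: "A \<inter> ngh B \<noteq> {}" if "conn A" "conn B" "\<not> compat_tubes A B" for A B
  proof (cases "A \<inter> B = {}")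
    case True
    then have "ngh A \<inter> B \<noteq> {}" using that(3) by (auto simp: compat_tubes_def)
    then show ?thesis using ngh_sym[of A B] connD(2)[OF that(1)] True by blast
  next
    case False
    then show ?thesis using conn_subset[OF that(1) False] that(3) by (auto simp: compat_tubes_def)
  qed
  have "\<not> compat_tubes T' T" using nc compat_tubes_sym[of T' T] connD(2) c by blast
  then have "T' \<inter> ngh T \<noteq> {}" "T \<inter> ngh T' \<noteq> {}"
    using meet[OF c nc] meet[OF c(2,1)] by blast+
  then obtain u v where "u \<in> T" "u \<in> ngh T'" "v \<in> T'" "v \<in> ngh T" by blast
  then have "h v < h u" "h u < h v" using weight_pos_iff T T' by blast+
  then show False by simp
qed

lemma weight_shift:
  assumes "ptube T" "\<And>v. v \<in> T \<union> ngh T \<Longrightarrow> h' v = h v + c"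
  shows "weight h' T = weight h T"
proof -
  have "finite T" "T \<noteq> {}" "ngh T \<noteq> {}" using assms(1) connD by (auto simp: ptube_def)
  moreover have "h' ` T = (\<lambda>x. x + c) ` h ` T" "h' ` ngh T = (\<lambda>x. x + c) ` h ` ngh T"
    using assms(2) by (auto simp: image_iff)
  ultimately show ?thesis
    using finite_ngh[of T] by (simp add: weight_def image_image Min_add_commute Max_add_commute)
qed

text \<open>Induction on the number of vertices of C below v. K is the component of v in the
  superlevel set of h at h v. If K is not C, let u be its highest neighbour: K has weight h v - h u,
  and the other tubes of positive weight through v are exactly those through u.\<close>

lemma sum_weight:
  assumes C: "C \<in> comps" and v: "v \<in> C"
  shows "h v - Min (h ` C) = (\<Sum>T | ptube T \<and> v \<in> T. weight h T)"
  using v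
proof (induction "card {w \<in> C. h w < h v}" arbitrary: v rule: less_induct)
  case less
  have finP: "finite {T. ptube T \<and> Q T}" for Q
    by (rule finite_subset[OF _ finite_conn]) (auto simp: ptube_def)
  have cC: "conn C" and CV: "C \<subseteq> V" and finC: "finite C"
    using compsD(1)[OF C] connD by auto
  let ?X = "{w \<in> V. h v \<le> h w}"
  obtain K where K: "conn K" "v \<in> K" "K \<subseteq> ?X" "ngh K \<inter> ?X = {}"
    using component_exists[of ?X v] less.prems CV by blast
  have low: "h u < h v" if "u \<in> ngh K" for u
    using that K(4) ngh_subset[of K] by force
  have KC: "K \<subseteq> C" using comp_superset[OF K(1) C] K(2) less.prems by blast
  have minK: "Min (h ` K) = h v"
    using K(2,3) connD(3)[OF K(1)] by (intro Min_eqI) auto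
  \<comment> \<open>A tube through v strictly inside K has a neighbour in K, which is at least as
    high as v.\<close>
  have inside: "weight h T = 0" if T: "ptube T" "v \<in> T" "T \<subset> K" for T
  proof (rule ccontr)
    assume "weight h T \<noteq> 0"
    then have pos: "0 < weight h T" using weight_nonneg[of h T] by simp
    have "ngh T \<inter> K \<noteq> {}" using conn_cut[OF K(1), of T] T by blast
    then obtain u where u: "u \<in> ngh T" "u \<in> K" by blast
    then have "h u < h v" using weight_pos_iff[OF T(1)] pos T(2) by blast
    then show False using u K(3) by force
  qed
  show ?case
  proof (cases "ngh K = {}")
    case True
    then have KC': "K = C" using K(1) comp_superset[OF cC, of K] KC K(2) less.prems
      by (auto simp: comps_def)
    have "weight h T = 0" if T: "ptube T" "v \<in> T" for T
    proof -
      have "conn T" "T \<notin> comps" using T(1) by (auto simp: ptube_iff)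
      then have "T \<subset> K" using comp_superset[of T C] C T(2) less.prems KC' by blast
      then show ?thesis using inside T by blast
    qed
    then show ?thesis using minK KC' by simp
  next
    case False
    then have pK: "ptube K" using K(1) by (simp add: ptube_def)
    let ?M = "Max (h ` ngh K)"
    have "?M \<in> h ` ngh K" using False finite_ngh by (intro Max_in) auto
    then obtain u where u: "u \<in> ngh K" "h u = ?M" by auto
    have umax: "h u' \<le> h u" if "u' \<in> ngh K" for u'
      using that u(2) finite_ngh[of K] by simp
    have uC: "u \<in> C" using u(1) comp_ngh[OF K(1) C KC] by blast
    have lamK: "weight h K = h v - h u" using minK u low[OF u(1)] by (simp add: weight_def)
    have posK: "0 < weight h K" using lamK low[OF u(1)] by simp
    have iff: "ptube T \<and> v \<in> T \<and> 0 < weight h T \<longleftrightarrow> T = K \<or> ptube T \<and> u \<in> T \<and> 0 < weight h T" for T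
    proof
      assume T: "ptube T \<and> v \<in> T \<and> 0 < weight h T"
      then have "compat_tubes T K" using weight_pos_compat pK posK by blast
      then consider "T \<subset> K" | "T = K" | "K \<subset> T"
        using T K(2) by (auto simp: compat_tubes_def)
      then show "T = K \<or> ptube T \<and> u \<in> T \<and> 0 < weight h T"
      proof cases
        case 1 then show ?thesis using inside T by force
      next
        case 3
        have cT: "conn T" using T by (simp add: ptube_def)
        have "ngh K \<inter> T \<noteq> {}" using conn_cut[OF cT, of K] 3 K(2) by blast
        then obtain u' where u': "u' \<in> ngh K" "u' \<in> T" by blast
        have "u \<in> T"
        proof (rule ccontr)
          assume "u \<notin> T"
          then have "u \<in> ngh T" using u(1) 3 by (auto simp: ngh_def)
          then have "h u < h u'" using weight_pos_iff[of T h] T u' by blast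
          then show False using umax[OF u'(1)] by simp
        qed
        then show ?thesis using T by blast
      qed auto
    next
      assume T: "T = K \<or> ptube T \<and> u \<in> T \<and> 0 < weight h T"
      then show "ptube T \<and> v \<in> T \<and> 0 < weight h T"
      proof
        assume "T = K" then show ?thesis using pK posK K(2) by blast
      next
        assume T: "ptube T \<and> u \<in> T \<and> 0 < weight h T"
        then have "compat_tubes K T" using weight_pos_compat pK posK by blast
        then have "K \<subseteq> T" using u(1) T ngh_disjoint[of K] by (auto simp: compat_tubes_def)
        then show ?thesis using T K(2) by blast
      qed
    qed
    have drop: "(\<Sum>T | ptube T \<and> x \<in> T. weight h T) = (\<Sum>T | ptube T \<and> x \<in> T \<and> 0 < weight h T. weight h T)" for x
    proof (rule sum.mono_neutral_right)
      show "finite {T. ptube T \<and> x \<in> T}" using finP .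
      show "\<forall>T\<in>{T. ptube T \<and> x \<in> T} - {T. ptube T \<and> x \<in> T \<and> 0 < weight h T}. weight h T = 0"
        using weight_nonneg[of h] by (auto simp: order_le_less)
    qed auto
    have "{w \<in> C. h w < h u} \<subset> {w \<in> C. h w < h v}" using low[OF u(1)] uC by auto
    then have "card {w \<in> C. h w < h u} < card {w \<in> C. h w < h v}"
      using finC by (intro psubset_card_mono) auto
    then have IH: "h u - Min (h ` C) = (\<Sum>T | ptube T \<and> u \<in> T. weight h T)"
      using less.hyps uC by blast
    have "(\<Sum>T | ptube T \<and> v \<in> T. weight h T)
        = (\<Sum>T\<in>insert K {T. ptube T \<and> u \<in> T \<and> 0 < weight h T}. weight h T)"
      unfolding drop using iff by (intro sum.cong) auto
    also have "\<dots> = weight h K + (\<Sum>T | ptube T \<and> u \<in> T. weight h T)"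
    proof -
      have "u \<notin> K" using u(1) ngh_disjoint[of K] by blast
      then show ?thesis unfolding drop by (subst sum.insert) (use finP in auto)
    qed
    finally show ?thesis using IH lamK by simp
  qed
qed

lemma nest_of_tubing:
  assumes "\<forall>T\<in>\<T>. ptube T" "\<forall>T\<in>\<T>. \<forall>T'\<in>\<T>. compat_tubes T T'"
  shows "nest (\<T> \<union> comps)"
proof -
  have "conn T" if "T \<in> \<T> \<union> comps" for T using that assms compsD(1) by (auto simp: ptube_def)
  moreover have "compat_tubes T T'" if "T \<in> \<T> \<union> comps" "T' \<in> \<T> \<union> comps" for T T'
    using that assms(2) calculation compat_comp by blast
  ultimately show ?thesis by (auto simp: nest_def)
qed

text \<open>Own vertices of a tube S have height exactly H S, and no vertex of S is lower. For T in
  the tubing with parent P, the minimum on T is H T and the maximum on its neighbours is H P; these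
  differ by \<mu> T. For any other T, some vertex of T is owned by the least tube S above T, and a
  neighbour of T inside S is at least as high.\<close>

lemma weight_realise:
  fixes \<mu> :: "'a set \<Rightarrow> real"
  assumes tub: "\<forall>T\<in>\<T>. ptube T" "\<forall>T\<in>\<T>. \<forall>T'\<in>\<T>. compat_tubes T T'"
    and pos: "\<forall>T\<in>\<T>. 0 \<le> \<mu> T" and T: "ptube T"
    and h: "h = (\<lambda>v. \<Sum>T | T \<in> \<T> \<and> v \<in> T. \<mu> T)"
  shows "weight h T = (if T \<in> \<T> then \<mu> T else 0)"
proof -
  let ?N = "\<T> \<union> comps"
  have N: "nest ?N" using nest_of_tubing[OF tub] .
  have fin: "finite \<T>" using nestD(4)[OF N] by simp
  have cT: "conn T" "T \<notin> comps" using T by (auto simp: ptube_iff)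
  have finT: "finite T" "T \<noteq> {}" "finite (ngh T)" "ngh T \<noteq> {}"
    using connD cT T finite_ngh by (auto simp: ptube_def)
  define H where "H = (\<lambda>S. \<Sum>T | T \<in> \<T> \<and> S \<subseteq> T. \<mu> T)"
  have h_own: "h v = H S" if "S \<in> ?N" "v \<in> own ?N S" for S v
    unfolding h H_def using own_least[OF N that(1) _ that(2)] own_subset[of ?N S] that(2)
    by (intro sum.cong) auto
  have h_ge: "H S \<le> h v" if "v \<in> S" for S v
    unfolding h H_def using that pos fin by (intro sum_mono2) auto
  show ?thesis
  proof (cases "T \<in> \<T>")
    case True
    then have TN: "T \<in> ?N" by simp
    obtain P where P: "P \<in> ?N" "child ?N P T" using parent_exists[OF N TN cT(2)] .
    obtain v where v: "v \<in> own ?N T" using own_nonempty[OF N TN] by blast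
    have "Min (h ` T) = H T"
    proof (rule Min_eqI)
      show "H T \<in> h ` T" using h_own[OF TN v] v own_subset[of ?N T] by force
    qed (use finT h_ge in auto)
    moreover obtain u where u: "u \<in> ngh T" "u \<in> P" "u \<in> own ?N P"
      using child_ngh[OF N P] by blast
    have "Max (h ` ngh T) = H P"
    proof (rule Max_eqI)
      show "H P \<in> h ` ngh T" using h_own[OF P(1) u(3)] u(1) by force
      fix x assume "x \<in> h ` ngh T"
      then obtain u' where u': "u' \<in> ngh T" "x = h u'" by blast
      have "P \<subseteq> T'" if "T' \<in> \<T>" "u' \<in> T'" for T'
        using nest_ngh_psubset[OF N TN _ u'(1) that(2)] P(2) that by (auto simp: child_def)
      then show "x \<le> H P"
        unfolding u'(2) h H_def using pos fin by (intro sum_mono2) auto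
    qed (use finT in auto)
    moreover have "H T = \<mu> T + H P"
    proof -
      have "{T' \<in> \<T>. T \<subseteq> T'} = insert T {T' \<in> \<T>. P \<subseteq> T'}"
        using True P(2) by (auto simp: child_def)
      moreover have "T \<notin> {T' \<in> \<T>. P \<subseteq> T'}" using P(2) by (auto simp: child_def)
      ultimately show ?thesis using fin by (simp add: H_def)
    qed
    ultimately show ?thesis using True pos by (simp add: weight_def)
  next
    case False
    obtain S where S: "S \<in> ?N" "T \<subseteq> S" "T \<inter> own ?N S \<noteq> {}" using nest_hull[OF N cT(1)] by metis
    then have "T \<noteq> S" using False cT(2) by blast
    then have "ngh T \<inter> S \<noteq> {}" using conn_cut[OF nestD(1)[OF N S(1)] S(2)] finT by blast
    then obtain u where u: "u \<in> ngh T" "u \<in> S" by blast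
    obtain x where x: "x \<in> T" "x \<in> own ?N S" using S(3) by blast
    have "Min (h ` T) \<le> h x" using x finT by simp
    also have "\<dots> \<le> h u" using h_own[OF S(1) x(2)] h_ge[OF u(2)] by simp
    also have "\<dots> \<le> Max (h ` ngh T)" using u finT by simp
    finally show ?thesis using False by (simp add: weight_def)
  qed
qed

end

section \<open>Coordinates relative to a maximal tubing\<close>

lemma continuous_on_Min_image:
  fixes f :: "'b \<Rightarrow> 'c::topological_space \<Rightarrow> real"
  assumes "finite A" "A \<noteq> {}" "\<And>v. v \<in> A \<Longrightarrow> continuous_on S (f v)"
  shows "continuous_on S (\<lambda>z. Min ((\<lambda>v. f v z) ` A))"
  using assms
proof (induction A rule: finite_ne_induct)
  case (insert x F)
  then show ?case by (simp add: continuous_on_min)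
qed simp

lemma continuous_on_Max_image:
  fixes f :: "'b \<Rightarrow> 'c::topological_space \<Rightarrow> real"
  assumes "finite A" "A \<noteq> {}" "\<And>v. v \<in> A \<Longrightarrow> continuous_on S (f v)"
  shows "continuous_on S (\<lambda>z. Max ((\<lambda>v. f v z) ` A))"
  using assms
proof (induction A rule: finite_ne_induct)
  case (insert x F)
  then show ?case by (simp add: continuous_on_max)
qed simp

locale ref_tubing = fin_graph V adj for V :: "'a set" and adj +
  fixes I :: "'n::finite set" and T0 :: "'n \<Rightarrow> 'a set"
  assumes inj_T0: "inj_on T0 I"
    and ptube_T0: "i \<in> I \<Longrightarrow> ptube (T0 i)"
    and compat_T0: "i \<in> I \<Longrightarrow> j \<in> I \<Longrightarrow> compat_tubes (T0 i) (T0 j)"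
    and maximal_T0: "ptube T \<Longrightarrow> \<forall>i\<in>I. compat_tubes (T0 i) T \<and> compat_tubes T (T0 i) \<Longrightarrow> T \<in> T0 ` I"
begin

definition is_tubing :: "'a set set \<Rightarrow> bool" where
  "is_tubing \<T> \<longleftrightarrow> (\<forall>T\<in>\<T>. ptube T) \<and> (\<forall>T\<in>\<T>. \<forall>T'\<in>\<T>. compat_tubes T T')"

definition ref_nest :: "'a set set" where
  "ref_nest = T0 ` I \<union> comps"

definition own_vertex :: "'a set \<Rightarrow> 'a" where
  "own_vertex S = the_elem (own ref_nest S)"

definition dual_vec :: "'a set \<Rightarrow> real ^ 'n" where
  "dual_vec T = (\<chi> i. if i \<in> I then cdegree T (T0 i) else 0)"

definition W :: "(real ^ 'n) set" where
  "W = {x. \<forall>i. i \<notin> I \<longrightarrow> x $ i = 0}"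

lemma is_tubing_nest: "is_tubing \<T> \<Longrightarrow> nest (\<T> \<union> comps)"
  using nest_of_tubing by (simp add: is_tubing_def)

lemma is_tubing_subset: "is_tubing \<T> \<Longrightarrow> \<T>' \<subseteq> \<T> \<Longrightarrow> is_tubing \<T>'"
  unfolding is_tubing_def by blast

lemma finite_ptube: "finite {T. ptube T \<and> Q T}"
  by (rule finite_subset[OF _ finite_conn]) (auto simp: ptube_def)

lemma is_tubing_finite: "is_tubing \<T> \<Longrightarrow> finite \<T>"
  using finite_subset[OF _ finite_ptube[of "\<lambda>_. True"], of \<T>] by (auto simp: is_tubing_def)

lemma finite_comps: "finite comps"
  using finite_subset[OF _ finite_conn, of comps] compsD(1) by blast

lemma is_tubing_card_Un: "is_tubing \<T> \<Longrightarrow> card (\<T> \<union> comps) = card \<T> + card comps"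
  by (rule card_Un_disjoint) (auto simp: is_tubing_finite finite_comps is_tubing_def ptube_iff)

lemma is_tubing_T0: "is_tubing (T0 ` I)"
  unfolding is_tubing_def using ptube_T0 compat_T0 by blast

lemma nest_ref_nest: "nest ref_nest"
  unfolding ref_nest_def using is_tubing_nest[OF is_tubing_T0] .

lemma is_tubing_maximal:
  assumes "is_tubing \<T>" "T0 ` I \<subseteq> \<T>"
  shows "\<T> = T0 ` I"
proof
  show "\<T> \<subseteq> T0 ` I"
  proof
    fix T assume "T \<in> \<T>"
    then have "ptube T" "\<forall>i\<in>I. compat_tubes (T0 i) T \<and> compat_tubes T (T0 i)"
      using assms unfolding is_tubing_def by blast+
    then show "T \<in> T0 ` I" by (rule maximal_T0)
  qed
qed (use assms in blast)

lemma card_I: "card I + card comps = card V"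
proof -
  have "T \<in> ref_nest" if "conn T" "nest (insert T ref_nest)" for T
  proof (cases "T \<in> comps")
    case False
    then have "ptube T" using that by (simp add: ptube_iff)
    moreover have "\<forall>i\<in>I. compat_tubes (T0 i) T \<and> compat_tubes T (T0 i)"
      using nestD(2)[OF that(2)] by (auto simp: ref_nest_def)
    ultimately show ?thesis using maximal_T0 by (auto simp: ref_nest_def)
  qed (simp add: ref_nest_def)
  then have "card ref_nest = card V" using maximal_nest_card[OF nest_ref_nest] by blast
  then show ?thesis using is_tubing_card_Un[OF is_tubing_T0] card_image[OF inj_T0] by (simp add: ref_nest_def)
qed

lemma card_ref_nest: "card ref_nest = card V"
  using card_I is_tubing_card_Un[OF is_tubing_T0] card_image[OF inj_T0] by (simp add: ref_nest_def)

lemma is_tubing_card_le: "is_tubing \<T> \<Longrightarrow> card \<T> \<le> card I"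
  using card_nest_le[OF is_tubing_nest] is_tubing_card_Un card_I by fastforce

lemma own_ref_nest: "S \<in> ref_nest \<Longrightarrow> own ref_nest S = {own_vertex S}"
  using card_nest_eq[OF nest_ref_nest card_ref_nest]
  by (metis own_vertex_def card_1_singleton_iff One_nat_def the_elem_eq)

lemma own_vertex_in: "S \<in> ref_nest \<Longrightarrow> own_vertex S \<in> S"
  using own_ref_nest own_subset[of ref_nest S] by blast

lemma own_vertex_mem_iff: "S \<in> ref_nest \<Longrightarrow> T \<in> ref_nest \<Longrightarrow> own_vertex S \<in> T \<longleftrightarrow> S \<subseteq> T"
  using own_least[OF nest_ref_nest, of S T "own_vertex S"] own_ref_nest[of S] own_vertex_in[of S] by blast

lemma own_vertex_inj: "S \<in> ref_nest \<Longrightarrow> T \<in> ref_nest \<Longrightarrow> own_vertex S = own_vertex T \<Longrightarrow> S = T"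
  using own_vertex_mem_iff[of S T] own_vertex_mem_iff[of T S] own_vertex_in by (metis subset_antisym)

lemma T0_ref_nest: "i \<in> I \<Longrightarrow> T0 i \<in> ref_nest" and comps_ref_nest: "C \<in> comps \<Longrightarrow> C \<in> ref_nest"
  by (simp_all add: ref_nest_def)

lemma ref_nest_minus_comps: "ref_nest - comps = T0 ` I"
  using ptube_T0 by (auto simp: ref_nest_def ptube_iff)

section \<open>Functionals in reference coordinates and linear independence\<close>

definition tube_sum :: "real ^ 'n \<Rightarrow> 'a \<Rightarrow> real" where
  "tube_sum y v = (\<Sum>i\<in>I. if v \<in> T0 i then y $ i else 0)"

lemma selection_ref_nest:
  obtains m U where "selection m U" "\<And>y T. ptube T \<Longrightarrow> y \<bullet> dual_vec T = slope m U (tube_sum y) T"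
proof -
  have "\<forall>T\<in>ref_nest. card (own ref_nest T) = 1" using card_nest_eq[OF nest_ref_nest card_ref_nest] by blast
  then obtain m U where sel: "selection m U" and
    eq: "\<And>y T. ptube T \<Longrightarrow> (\<Sum>T'\<in>ref_nest - comps. y T' * cdegree T T')
           = slope m U (\<lambda>v. \<Sum>T'\<in>ref_nest - comps. if v \<in> T' then y T' else 0) T"
    using selection_of_nest[OF nest_ref_nest] by blast
  have "y \<bullet> dual_vec T = slope m U (tube_sum y) T" if T: "ptube T" for y T
  proof -
    let ?y = "\<lambda>T'. y $ (the_inv_into I T0 T')"
    have inv: "?y (T0 i) = y $ i" if "i \<in> I" for i
      using the_inv_into_f_f[OF inj_T0 that] by simp
    have "y \<bullet> dual_vec T = (\<Sum>i\<in>UNIV. if i \<in> I then y $ i * cdegree T (T0 i) else 0)"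
      by (auto simp: inner_vec_def dual_vec_def intro!: sum.cong)
    also have "\<dots> = (\<Sum>i\<in>I. y $ i * cdegree T (T0 i))"
      by (subst sum.inter_restrict[symmetric]) auto
    also have "\<dots> = (\<Sum>T'\<in>ref_nest - comps. ?y T' * cdegree T T')"
      unfolding ref_nest_minus_comps sum.reindex[OF inj_T0] by (intro sum.cong) (simp_all add: inv)
    also have "\<dots> = slope m U (\<lambda>v. \<Sum>T'\<in>ref_nest - comps. if v \<in> T' then ?y T' else 0) T"
      by (rule eq[OF T])
    also have "(\<lambda>v. \<Sum>T'\<in>ref_nest - comps. if v \<in> T' then ?y T' else 0) = tube_sum y"
      unfolding ref_nest_minus_comps sum.reindex[OF inj_T0] tube_sum_def
      by (intro ext sum.cong) (simp_all add: inv)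
    finally show ?thesis .
  qed
  then show ?thesis using that sel by blast
qed

text \<open>Take an inclusion-maximal tube of reference S with nonzero coefficient. Its own vertex
  lies only in the tubes of reference that contain S, so \<open>tube_sum y\<close> equals that
  coefficient there.\<close>

lemma tube_sum_eq_0:
  assumes y: "y \<in> W" and k: "\<And>v. v \<in> V \<Longrightarrow> tube_sum y v = 0"
  shows "y = 0"
proof (rule ccontr)
  assume "y \<noteq> 0"
  then obtain j where "y $ j \<noteq> 0" by (auto simp: vec_eq_iff)
  then have "T0 ` {i \<in> I. y $ i \<noteq> 0} \<noteq> {}" using y by (auto simp: W_def)
  moreover have "finite (T0 ` {i \<in> I. y $ i \<noteq> 0})" by simp
  ultimately obtain S where S: "S \<in> T0 ` {i \<in> I. y $ i \<noteq> 0}"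
    "\<And>L. L \<in> T0 ` {i \<in> I. y $ i \<noteq> 0} \<Longrightarrow> S \<subseteq> L \<Longrightarrow> L = S"
    using finite_maximal_set[of "T0 ` {i \<in> I. y $ i \<noteq> 0}"] by (metis (no_types, lifting))
  then obtain i where i: "i \<in> I" "y $ i \<noteq> 0" "S = T0 i" by blast
  have "tube_sum y (own_vertex S) = (\<Sum>j\<in>I. if j = i then y $ i else 0)"
    unfolding tube_sum_def
  proof (intro sum.cong refl)
    fix j assume j: "j \<in> I"
    have "own_vertex S \<in> T0 j \<longleftrightarrow> S \<subseteq> T0 j" using own_vertex_mem_iff i T0_ref_nest j by simp
    moreover have "j = i" if "S \<subseteq> T0 j" "y $ j \<noteq> 0"
      using S(2)[of "T0 j"] that j i inj_onD[OF inj_T0] by blast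
    ultimately show "(if own_vertex S \<in> T0 j then y $ j else 0) = (if j = i then y $ i else 0)"
      using i(3) by auto
  qed
  also have "\<dots> = y $ i" using i(1) by simp
  finally have "tube_sum y (own_vertex S) = y $ i" .
  moreover have "own_vertex S \<in> V"
    using own_vertex_in[of S] T0_ref_nest i connD(2)[OF nestD(1)[OF nest_ref_nest]] by blast
  ultimately show False using k i(2) by simp
qed

text \<open>By \<open>kernel_constant\<close>, \<open>tube_sum y\<close> is constant on every
  component. The own vertex of a component lies in no \<open>T0 i\<close>, so this constant is
  0.\<close>

lemma orthogonal_full:
  assumes \<T>: "is_tubing \<T>" "card \<T> = card I" and y: "y \<in> W" "\<forall>T\<in>\<T>. y \<bullet> dual_vec T = 0"
  shows "y = 0"
proof (rule tube_sum_eq_0[OF y(1)])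
  fix v assume v: "v \<in> V"
  let ?N = "\<T> \<union> comps"
  have N: "nest ?N" using is_tubing_nest[OF \<T>(1)] .
  have cN: "card ?N = card V" using is_tubing_card_Un[OF \<T>(1)] \<T>(2) card_I by simp
  obtain m U where sel: "selection m U" and eq: "\<And>y T. ptube T \<Longrightarrow> y \<bullet> dual_vec T = slope m U (tube_sum y) T"
    using selection_ref_nest by blast
  have zero: "\<forall>T\<in>?N - comps. slope m U (tube_sum y) T = 0"
    using \<T>(1) y(2) eq by (auto simp: is_tubing_def)
  have const: "tube_sum y x = tube_sum y (m C)" if x: "x \<in> C" "C \<in> comps" for x C
  proof -
    have "x \<in> V" using x compsD(1) connD(2) by blast
    then obtain S where S: "S \<in> ?N" "x \<in> own ?N S" using own_exists[OF N] by blast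
    have cS: "conn S" using nestD(1)[OF N S(1)] .
    have xS: "x \<in> S" using S(2) own_subset[of ?N S] by blast
    have SC: "S \<subseteq> C" using comp_superset[OF cS x(2)] xS x(1) by blast
    show ?thesis
    proof (rule kernel_constant[OF sel N zero, of "{}"])
      show "\<forall>T\<in>?N. \<not> T \<subseteq> {} \<longrightarrow> card (own ?N T) = 1" using card_nest_eq[OF N cN] by blast
    qed (use S xS SC x in auto)
  qed
  obtain C where "C \<in> comps" "{v} \<subseteq> C" using comp_exists[OF conn_sing[OF v]] .
  then have C: "C \<in> comps" "v \<in> C" by auto
  have "tube_sum y (own_vertex C) = 0"
    unfolding tube_sum_def
  proof (intro sum.neutral ballI)
    fix i assume i: "i \<in> I"
    have "\<not> C \<subseteq> T0 i"
      using comp_maximal[OF _ C(1)] ptube_T0[OF i] ptube_iff C(1) by metis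
    then show "(if own_vertex C \<in> T0 i then y $ i else 0) = 0"
      using own_vertex_mem_iff[OF comps_ref_nest[OF C(1)] T0_ref_nest[OF i]] by simp
  qed
  then show "tube_sum y v = 0"
    using const[OF C(2,1)] const[OF own_vertex_in[OF comps_ref_nest[OF C(1)]] C(1)] by simp
qed

lemma subspace_W: "subspace W"
  by (auto simp: W_def subspace_def)

lemma dim_W: "dim W = card I"
  unfolding W_def using dim_substandard_cart[where 'a=real and 'n='n, of I] by (simp add: dim_vec_eq)

lemma dual_vec_in_W: "dual_vec T \<in> W"
  by (simp add: W_def dual_vec_def)

lemma orthogonal_exists:
  assumes "dim (dual_vec ` \<T>) < card I"
  obtains y where "y \<in> W" "y \<noteq> 0" "\<forall>T\<in>\<T>. y \<bullet> dual_vec T = 0"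
proof -
  have sub: "span (dual_vec ` \<T>) \<subseteq> W" using dual_vec_in_W subspace_W by (intro span_minimal) auto
  moreover have "span (dual_vec ` \<T>) \<noteq> W" using assms dim_W dim_span[of "dual_vec ` \<T>"] by (metis less_irrefl)
  ultimately have "span (dual_vec ` \<T>) \<subset> span W" using subspace_W by (simp add: span_eq_iff[THEN iffD2])
  then obtain y where y: "y \<noteq> 0" "y \<in> span W" "\<And>x. x \<in> span (dual_vec ` \<T>) \<Longrightarrow> orthogonal y x"
    using orthogonal_to_subspace_exists_gen by blast
  have "\<forall>T\<in>\<T>. y \<bullet> dual_vec T = 0" using y(3) by (auto simp: orthogonal_def span_base)
  then show ?thesis using that y(1,2) subspace_W by (simp add: span_eq_iff[THEN iffD2])
qed

lemma is_tubing_extend: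
  assumes "is_tubing \<T>"
  obtains \<T>' where "is_tubing \<T>'" "\<T> \<subseteq> \<T>'" "card \<T>' = card I"
proof -
  let ?A = "{\<T>'. is_tubing \<T>' \<and> \<T> \<subseteq> \<T>'}"
  have "?A \<subseteq> Pow {T. ptube T \<and> True}" by (auto simp: is_tubing_def)
  then have "finite ?A" using finite_subset finite_ptube[of "\<lambda>_. True"] by (metis finite_Pow_iff)
  moreover have "?A \<noteq> {}" using assms by blast
  ultimately obtain \<T>' where T': "\<T>' \<in> ?A" "\<And>L. L \<in> ?A \<Longrightarrow> \<T>' \<subseteq> L \<Longrightarrow> L = \<T>'"
    using finite_maximal_set[of ?A] by metis
  then have tub: "is_tubing \<T>'" by blast
  have "T \<in> \<T>' \<union> comps" if T: "conn T" "nest (insert T (\<T>' \<union> comps))" for T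
  proof (rule ccontr)
    assume no: "T \<notin> \<T>' \<union> comps"
    then have "ptube T" using T(1) by (simp add: ptube_iff)
    then have "is_tubing (insert T \<T>')"
      using tub nestD(2)[OF T(2)] by (auto simp: is_tubing_def)
    then have "insert T \<T>' = \<T>'" using T'(1) by (intro T'(2)) auto
    then show False using no by blast
  qed
  then have "card (\<T>' \<union> comps) = card V" using maximal_nest_card[OF is_tubing_nest[OF tub]] by blast
  then have "card \<T>' = card I" using is_tubing_card_Un[OF tub] card_I by simp
  then show ?thesis using that T'(1) by blast
qed

text \<open>Coefficients indexed by tubes express injectivity of \<open>dual_vec\<close> and
  independence of its image at once. After extension to \<open>card I\<close> tubes,
  \<open>orthogonal_full\<close> forces the span to have dimension \<open>card I\<close>.\<close>

lemma dual_vec_coeff_zero: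
  assumes \<T>: "is_tubing \<T>" and 0: "(\<Sum>T\<in>\<T>. c T *\<^sub>R dual_vec T) = 0" and T: "T \<in> \<T>"
  shows "c T = 0"
proof -
  obtain \<T>' where T': "is_tubing \<T>'" "\<T> \<subseteq> \<T>'" "card \<T>' = card I" using is_tubing_extend[OF \<T>] .
  have fin: "finite \<T>'" using is_tubing_finite[OF T'(1)] .
  have d: "dim (dual_vec ` \<T>') \<ge> card I"
  proof (rule ccontr)
    assume "\<not> ?thesis"
    then obtain y where "y \<in> W" "y \<noteq> 0" "\<forall>T\<in>\<T>'. y \<bullet> dual_vec T = 0"
      using orthogonal_exists[of \<T>'] by auto
    then show False using orthogonal_full[OF T'(1,3)] by blast
  qed
  have le: "dim (dual_vec ` \<T>') \<le> card (dual_vec ` \<T>')" using fin by (intro dim_le_card') auto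
  have ci: "card (dual_vec ` \<T>') \<le> card \<T>'" using fin by (rule card_image_le)
  have inj: "inj_on dual_vec \<T>'" using d le ci T'(3) fin by (intro eq_card_imp_inj_on) auto
  have "independent (dual_vec ` \<T>')"
    using d le ci T'(3) fin by (intro card_le_dim_spanning[of _ "dual_vec ` \<T>'"]) (auto intro: span_base)
  then have ind: "independent (dual_vec ` \<T>)" using T'(2) by (meson image_mono independent_mono)
  have injT: "inj_on dual_vec \<T>" using inj T'(2) by (rule inj_on_subset)
  let ?c = "\<lambda>x. c (the_inv_into \<T> dual_vec x)"
  have "(\<Sum>x\<in>dual_vec ` \<T>. ?c x *\<^sub>R x) = (\<Sum>T\<in>\<T>. c T *\<^sub>R dual_vec T)"
    unfolding sum.reindex[OF injT] by (intro sum.cong) (simp_all add: the_inv_into_f_f[OF injT])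
  then have "?c (dual_vec T) = 0"
    using independentD[OF ind, of "dual_vec ` \<T>" ?c "dual_vec T"] 0 T is_tubing_finite[OF \<T>] by simp
  then show ?thesis using the_inv_into_f_f[OF injT T] by simp
qed

text \<open>Pair the relation with a nonzero y vanishing on the common tubes and multiply by the
  value of y on T1: a positive multiple of a square is bounded by the nonpositive product from
  \<open>flip_slopes\<close>. So y vanishes on the maximal tubing \<open>insert T1 \<T>\<close> and
  is 0.\<close>

lemma flip_no_relation:
  assumes T1: "is_tubing (insert T1 \<T>)" "T1 \<notin> \<T>" and T2: "is_tubing (insert T2 \<T>)" "T2 \<notin> \<T>"
    and ne: "T1 \<noteq> T2" and card: "card \<T> + 1 = card I" and ab: "0 < a" "0 < b"
    and rel: "(\<Sum>T\<in>\<T>. c T *\<^sub>R dual_vec T) + a *\<^sub>R dual_vec T1 = b *\<^sub>R dual_vec T2"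
  shows False
proof -
  have tub: "is_tubing \<T>" using is_tubing_subset[OF T1(1)] by blast
  have N: "nest (\<T> \<union> comps)" using is_tubing_nest[OF tub] .
  have cN: "card (\<T> \<union> comps) + 1 = card V" using is_tubing_card_Un[OF tub] card card_I by simp
  have p: "ptube T1" "ptube T2" using T1(1) T2(1) by (auto simp: is_tubing_def)
  have n: "T1 \<notin> \<T> \<union> comps" "T2 \<notin> \<T> \<union> comps" using T1(2) T2(2) p by (auto simp: ptube_iff)
  have i: "nest (insert T1 (\<T> \<union> comps))" "nest (insert T2 (\<T> \<union> comps))"
    using is_tubing_nest[OF T1(1)] is_tubing_nest[OF T2(1)] by simp_all
  have "dim (dual_vec ` \<T>) \<le> card (dual_vec ` \<T>)"
    using is_tubing_finite[OF tub] by (intro dim_le_card') auto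
  also have "\<dots> \<le> card \<T>" using is_tubing_finite[OF tub] by (rule card_image_le)
  finally obtain y where y: "y \<in> W" "y \<noteq> 0" "\<forall>T\<in>\<T>. y \<bullet> dual_vec T = 0"
    using orthogonal_exists[of \<T>] card by auto
  obtain m U where sel: "selection m U" and eq: "\<And>y T. ptube T \<Longrightarrow> y \<bullet> dual_vec T = slope m U (tube_sum y) T"
    using selection_ref_nest by blast
  have zero: "\<forall>T\<in>\<T> \<union> comps - comps. slope m U (tube_sum y) T = 0"
    using tub y(3) eq by (auto simp: is_tubing_def)
  have le: "(y \<bullet> dual_vec T1) * (y \<bullet> dual_vec T2) \<le> 0"
    using flip_slopes[OF sel N cN zero n(1) i(1) n(2) i(2) ne] eq p by simp
  have "y \<bullet> ((\<Sum>T\<in>\<T>. c T *\<^sub>R dual_vec T) + a *\<^sub>R dual_vec T1) = y \<bullet> (b *\<^sub>R dual_vec T2)" using rel by simp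
  then have "a * (y \<bullet> dual_vec T1) = b * (y \<bullet> dual_vec T2)"
    using y(3) by (simp add: inner_add_right inner_sum_right)
  then have "a * (y \<bullet> dual_vec T1)\<^sup>2 = b * ((y \<bullet> dual_vec T1) * (y \<bullet> dual_vec T2))"
    by (simp add: power2_eq_square)
  also have "\<dots> \<le> 0" using ab le by (simp add: mult_le_0_iff)
  finally have "y \<bullet> dual_vec T1 = 0" using ab by (simp add: mult_le_0_iff)
  moreover have "card (insert T1 \<T>) = card I" using T1(2) is_tubing_finite[OF tub] card by simp
  ultimately have "y = 0" using orthogonal_full[OF T1(1) _ y(1)] y(3) by simp
  then show False using y(2) by simp
qed

section \<open>The piecewise linear map and its bijectivity\<close>

text \<open>Heights vanish at the own vertices of the components, which removes the additive constants.\<close>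

definition height :: "real ^ 'n \<Rightarrow> 'a \<Rightarrow> real" where
  "height z v = (\<Sum>i\<in>I. if v = own_vertex (T0 i) then z $ i else 0)"

definition weight_at :: "real ^ 'n \<Rightarrow> 'a set \<Rightarrow> real" where
  "weight_at z T = weight (height z) T"

definition weight_supp :: "real ^ 'n \<Rightarrow> 'a set set" where
  "weight_supp z = {T. ptube T \<and> 0 < weight_at z T}"

text \<open>\<open>Phi\<close> is the identity in the coordinates outside \<open>I\<close>, so that it acts on a full Euclidean space.\<close>

definition Phi :: "real ^ 'n \<Rightarrow> real ^ 'n" where
  "Phi z = (\<Sum>T | ptube T. weight_at z T *\<^sub>R dual_vec T) + (\<chi> i. if i \<in> I then 0 else z $ i)"

lemma finite_ptubes: "finite {T. ptube T}"
  using finite_ptube[of "\<lambda>_. True"] by simp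

lemma height_root: "i \<in> I \<Longrightarrow> height z (own_vertex (T0 i)) = z $ i"
proof -
  assume i: "i \<in> I"
  have "height z (own_vertex (T0 i)) = (\<Sum>j\<in>I. if j = i then z $ i else 0)"
    unfolding height_def
  proof (intro sum.cong refl)
    fix j assume j: "j \<in> I"
    have "own_vertex (T0 i) = own_vertex (T0 j) \<longleftrightarrow> j = i"
      using own_vertex_inj[OF T0_ref_nest[OF i] T0_ref_nest[OF j]] inj_onD[OF inj_T0] i j by auto
    then show "(if own_vertex (T0 i) = own_vertex (T0 j) then z $ j else 0) = (if j = i then z $ i else 0)"
      by auto
  qed
  then show ?thesis using i by simp
qed

lemma height_comp: "C \<in> comps \<Longrightarrow> height z (own_vertex C) = 0"
  unfolding height_def
proof (intro sum.neutral ballI)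
  fix i assume "C \<in> comps" "i \<in> I"
  then have "own_vertex C \<noteq> own_vertex (T0 i)"
    using own_vertex_inj[OF comps_ref_nest T0_ref_nest] ptube_T0 ptube_iff by blast
  then show "(if own_vertex C = own_vertex (T0 i) then z $ i else 0) = 0" by simp
qed

lemma own_vertex_cases:
  assumes "v \<in> V"
  obtains i where "i \<in> I" "v = own_vertex (T0 i)" | C where "C \<in> comps" "v = own_vertex C"
proof -
  obtain S where S: "S \<in> ref_nest" "v \<in> own ref_nest S" using own_exists[OF nest_ref_nest assms] .
  then have "v = own_vertex S" using own_ref_nest[OF S(1)] by blast
  then show ?thesis using S(1) that by (auto simp: ref_nest_def)
qed

lemma height_scale: "height (c *\<^sub>R z) v = c * height z v"
  unfolding height_def sum_distrib_left by (intro sum.cong) auto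

lemma continuous_height: "continuous_on UNIV (\<lambda>z. height z v)"
proof -
  have "continuous_on UNIV (\<lambda>z :: real ^ 'n. if v = own_vertex (T0 i) then z $ i else 0)" for i
    by (cases "v = own_vertex (T0 i)") (auto intro!: continuous_intros)
  then show ?thesis unfolding height_def by (intro continuous_on_sum)
qed

lemma continuous_weight_at: "ptube T \<Longrightarrow> continuous_on UNIV (\<lambda>z. weight_at z T)"
  unfolding weight_at_def weight_def
  using connD(1,3)[of T] finite_ngh[of T]
  by (intro continuous_on_max continuous_on_const continuous_on_diff
      continuous_on_Min_image continuous_on_Max_image continuous_height) (auto simp: ptube_def)

lemma weight_at_nonneg: "0 \<le> weight_at z T"
  by (simp add: weight_at_def weight_nonneg)

lemma weight_at_eq_0: "ptube T \<Longrightarrow> T \<notin> weight_supp z \<Longrightarrow> weight_at z T = 0"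
  using weight_at_nonneg[of z T] by (simp add: weight_supp_def)

lemma weight_at_scale:
  assumes "ptube T" "0 \<le> c"
  shows "weight_at (c *\<^sub>R z) T = c * weight_at z T"
proof -
  have m: "mono (\<lambda>x::real. c * x)" using assms(2) by (simp add: mono_def mult_left_mono)
  have fin: "finite T" "T \<noteq> {}" "finite (ngh T)" "ngh T \<noteq> {}"
    using assms(1) connD finite_ngh by (auto simp: ptube_def)
  have "height (c *\<^sub>R z) ` A = (\<lambda>x. c * x) ` height z ` A" for A
    by (simp add: image_image height_scale)
  then have "weight_at (c *\<^sub>R z) T = max 0 (c * Min (height z ` T) - c * Max (height z ` ngh T))"
    using mono_Min_commute[OF m, of "height z ` T"] mono_Max_commute[OF m, of "height z ` ngh T"] fin
    by (simp add: weight_at_def weight_def)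
  also have "\<dots> = c * weight_at z T"
    using max_mult_distrib_left[of c 0 "Min (height z ` T) - Max (height z ` ngh T)"] assms(2)
    by (simp add: weight_at_def weight_def right_diff_distrib)
  finally show ?thesis .
qed

lemma is_tubing_weight_supp: "is_tubing (weight_supp z)"
  unfolding is_tubing_def weight_supp_def weight_at_def using weight_pos_compat by blast

text \<open>The difference of \<open>sum_weight\<close> at the own vertex of a tube of reference and
  at that of its component, where the height is 0, recovers the coordinate.\<close>

lemma weight_at_inj:
  assumes eq: "\<And>T. ptube T \<Longrightarrow> weight_at z T = weight_at z' T" and off: "\<And>i. i \<notin> I \<Longrightarrow> z $ i = z' $ i"
  shows "z = z'"
proof -
  have "z $ i = z' $ i" if i: "i \<in> I" for i
  proof -
    have cT: "conn (T0 i)" using ptube_T0[OF i] by (simp add: ptube_def)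
    obtain C where C: "C \<in> comps" "T0 i \<subseteq> C" using comp_exists[OF cT] .
    have v: "own_vertex (T0 i) \<in> C" using own_vertex_in[OF T0_ref_nest[OF i]] C(2) by blast
    have r: "own_vertex C \<in> C" using own_vertex_in[OF comps_ref_nest[OF C(1)]] .
    have s: "(\<Sum>T | ptube T \<and> x \<in> T. weight (height z) T) = (\<Sum>T | ptube T \<and> x \<in> T. weight (height z') T)" for x
      using eq by (intro sum.cong) (auto simp: weight_at_def)
    show ?thesis
      using sum_weight[OF C(1) v, of "height z"] sum_weight[OF C(1) v, of "height z'"]
        sum_weight[OF C(1) r, of "height z"] sum_weight[OF C(1) r, of "height z'"]
        s[of "own_vertex (T0 i)"] s[of "own_vertex C"] height_comp[OF C(1)] height_root[OF i]
      by simp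
  qed
  then show ?thesis using off by (auto simp: vec_eq_iff)
qed

lemma weight_at_realise:
  assumes \<T>: "is_tubing \<T>" and c: "\<forall>T\<in>\<T>. 0 \<le> c T"
  obtains z where "z \<in> W" "\<And>T. ptube T \<Longrightarrow> weight_at z T = (if T \<in> \<T> then c T else 0)"
proof -
  define h where "h = (\<lambda>v. \<Sum>T | T \<in> \<T> \<and> v \<in> T. c T)"
  have weight: "weight h T = (if T \<in> \<T> then c T else 0)" if "ptube T" for T
    using weight_realise[OF _ _ c that h_def] \<T> by (simp add: is_tubing_def)
  define comp where "comp = (\<lambda>v. SOME C. C \<in> comps \<and> v \<in> C)"
  have comp: "comp v = C" if "C \<in> comps" "v \<in> C" for v C
  proof -
    have "comp v \<in> comps \<and> v \<in> comp v" unfolding comp_def by (rule someI[of _ C]) (use that in blast)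
    then show ?thesis using comp_maximal[of C "comp v"] comp_superset[of "comp v" C] that compsD(1)
      by (metis disjoint_iff subset_antisym comp_superset)
  qed
  \<comment> \<open>Subtracting the value of h at the own vertex of the component gives the
    normalised height. A tube and its neighbours lie in one component, so
    \<open>weight_shift\<close> preserves the weights.\<close>
  define z :: "real ^ 'n" where
    "z = (\<chi> i. if i \<in> I then h (own_vertex (T0 i)) - h (own_vertex (comp (own_vertex (T0 i)))) else 0)"
  have height: "height z v = h v - h (own_vertex C)" if v: "C \<in> comps" "v \<in> C" for v C
  proof -
    have "v \<in> V" using v compsD(1) connD(2) by blast
    then show ?thesis
    proof (cases rule: own_vertex_cases)
      case (1 i)
      then show ?thesis using height_root[of i z] comp[OF v] by (simp add: z_def)
    next
      case (2 C')
      then have "v \<in> C'" using own_vertex_in comps_ref_nest by blast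
      then have "C' = C" using comp[OF v] comp[OF 2(1)] by simp
      then show ?thesis using 2 height_comp by simp
    qed
  qed
  have "weight_at z T = (if T \<in> \<T> then c T else 0)" if T: "ptube T" for T
  proof -
    have cT: "conn T" using T by (simp add: ptube_def)
    obtain C where C: "C \<in> comps" "T \<subseteq> C" using comp_exists[OF cT] .
    have "weight (height z) T = weight h T"
    proof (rule weight_shift[OF T])
      fix v assume "v \<in> T \<union> ngh T"
      then have "v \<in> C" using C(2) comp_ngh[OF cT C] by blast
      then show "height z v = h v + (- h (own_vertex C))" using height[OF C(1)] by simp
    qed
    then show ?thesis using weight[OF T] by (simp add: weight_at_def)
  qed
  moreover have "z \<in> W" by (simp add: W_def z_def)
  ultimately show ?thesis using that by blast
qed

lemma Phi_off: "i \<notin> I \<Longrightarrow> Phi z $ i = z $ i"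
  by (simp add: Phi_def dual_vec_def)

lemma Phi_eq_diff:
  assumes "Phi z = Phi z'"
  shows "i \<notin> I \<Longrightarrow> z $ i = z' $ i" "(\<Sum>T | ptube T. (weight_at z T - weight_at z' T) *\<^sub>R dual_vec T) = 0"
proof -
  show off: "z $ i = z' $ i" if "i \<notin> I" for i using Phi_off[OF that] assms by metis
  have "(\<chi> i. if i \<in> I then 0 else z $ i) = (\<chi> i. if i \<in> I then 0 else z' $ i)"
    using off by (auto simp: vec_eq_iff)
  then show "(\<Sum>T | ptube T. (weight_at z T - weight_at z' T) *\<^sub>R dual_vec T) = 0"
    using assms by (simp add: Phi_def scaleR_diff_left sum_subtractf)
qed

lemma Phi_eq_common:
  assumes eq: "Phi z = Phi z'" and tub: "is_tubing (weight_supp z \<union> weight_supp z')"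
  shows "z = z'"
proof (rule weight_at_inj)
  let ?T = "weight_supp z \<union> weight_supp z'"
  have "(\<Sum>T | ptube T. (weight_at z T - weight_at z' T) *\<^sub>R dual_vec T) = (\<Sum>T\<in>?T. (weight_at z T - weight_at z' T) *\<^sub>R dual_vec T)"
  proof (rule sum.mono_neutral_right)
    show "\<forall>T\<in>{T. ptube T} - ?T. (weight_at z T - weight_at z' T) *\<^sub>R dual_vec T = 0" by (simp add: weight_at_eq_0)
  qed (use finite_ptubes in \<open>auto simp: weight_supp_def\<close>)
  then have "(\<Sum>T\<in>?T. (weight_at z T - weight_at z' T) *\<^sub>R dual_vec T) = 0" using Phi_eq_diff(2)[OF eq] by simp
  then have zero: "weight_at z T - weight_at z' T = 0" if "T \<in> ?T" for T
    using dual_vec_coeff_zero[OF tub _ that, of "\<lambda>T. weight_at z T - weight_at z' T"] by simp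
  show "weight_at z T = weight_at z' T" if "ptube T" for T
    using zero[of T] weight_at_eq_0[OF that] by (cases "T \<in> ?T") auto
qed (rule Phi_eq_diff(1)[OF eq])

lemma continuous_Phi: "continuous_on UNIV Phi"
proof -
  have "continuous_on UNIV (\<lambda>z :: real ^ 'n. \<chi> i. if i \<in> I then 0 else z $ i)"
  proof (rule continuous_on_vec_lambda)
    show "continuous_on UNIV (\<lambda>z :: real ^ 'n. if i \<in> I then 0 else z $ i)" for i
      by (cases "i \<in> I") (auto intro!: continuous_intros)
  qed
  then show ?thesis
    unfolding Phi_def[abs_def]
    by (intro continuous_on_add continuous_on_sum continuous_on_scaleR continuous_on_const continuous_weight_at) auto
qed

lemma Phi_scale: "0 \<le> c \<Longrightarrow> Phi (c *\<^sub>R z) = c *\<^sub>R Phi z"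
  by (auto simp: Phi_def weight_at_scale scaleR_add_right scaleR_sum_right vec_eq_iff intro!: sum.cong)

lemma weight_supp_0: "weight_supp 0 = {}"
  using weight_at_scale[of _ 0 0] by (auto simp: weight_supp_def)

lemma Phi_0: "Phi 0 = 0"
  using Phi_scale[of 0 0] by simp

lemma Phi_eq_0: "Phi z = 0 \<Longrightarrow> z = 0"
  using Phi_eq_common[of z 0] is_tubing_weight_supp[of z] by (simp add: weight_supp_0 Phi_0)

text \<open>\<open>Phi\<close> is positively homogeneous and vanishes only at 0, so its norm has a
  positive minimum on the unit sphere and grows at least linearly.\<close>

lemma bounded_vimage_Phi:
  assumes "bounded K" shows "bounded (Phi -` K)"
proof -
  have ne: "sphere (0 :: real ^ 'n) 1 \<noteq> {}" by simp
  have "continuous_on (sphere 0 1) (\<lambda>z. norm (Phi z))"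
    using continuous_on_subset[OF continuous_Phi] by (intro continuous_on_norm) auto
  then obtain x :: "real ^ 'n" where x: "x \<in> sphere 0 1" "\<And>z. z \<in> sphere 0 1 \<Longrightarrow> norm (Phi x) \<le> norm (Phi z)"
    using continuous_attains_inf[OF compact_sphere ne] by blast
  let ?e = "norm (Phi x)"
  have e: "0 < ?e" using x(1) Phi_eq_0[of x] by auto
  have low: "?e * norm z \<le> norm (Phi z)" for z
  proof (cases "z = 0")
    case False
    let ?u = "(1 / norm z) *\<^sub>R z"
    have "?e \<le> norm (Phi ?u)" using False by (intro x(2)) simp
    also have "\<dots> = norm (Phi z) / norm z" by (simp add: Phi_scale)
    finally show ?thesis using False by (simp add: field_simps)
  qed simp
  obtain B where B: "\<And>y. y \<in> K \<Longrightarrow> norm y \<le> B" using assms by (auto simp: bounded_iff)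
  have "norm z \<le> B / ?e" if "Phi z \<in> K" for z
    using low[of z] B[OF that] e by (simp add: field_simps)
  then show ?thesis by (auto simp: bounded_iff)
qed

lemma finite_vimage_Phi: "finite (Phi -` {y})"
proof -
  have "inj_on weight_supp (Phi -` {y})"
  proof (rule inj_onI)
    fix z z' assume "z \<in> Phi -` {y}" "z' \<in> Phi -` {y}" "weight_supp z = weight_supp z'"
    then show "z = z'" using Phi_eq_common[of z z'] is_tubing_weight_supp[of z'] by simp
  qed
  moreover have "weight_supp ` (Phi -` {y}) \<subseteq> Pow {T. ptube T}" by (auto simp: weight_supp_def)
  moreover have "finite (Pow {T. ptube T})" using finite_ptubes by simp
  ultimately show ?thesis using inj_on_finite by blast
qed

lemma open_weight_supp_superset: "open {z. weight_supp p \<subseteq> weight_supp z}"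
proof -
  have "open {z. 0 < weight_at z T}" if "ptube T" for T
    using open_Collect_less[OF continuous_on_const continuous_weight_at[OF that]] .
  then have "open (\<Inter>T\<in>weight_supp p. {z. 0 < weight_at z T})"
    using is_tubing_finite[OF is_tubing_weight_supp] by (intro open_INT) (auto simp: weight_supp_def)
  moreover have "{z. weight_supp p \<subseteq> weight_supp z} = (\<Inter>T\<in>weight_supp p. {z. 0 < weight_at z T})"
    by (auto simp: weight_supp_def)
  ultimately show ?thesis by simp
qed

text \<open>Near a point of U whose support has maximal size, supports can only grow and hence stay
  the same; there \<open>Phi_eq_common\<close> applies.\<close>

lemma Phi_locally_inj_dense:
  assumes "open U" "U \<noteq> {}"
  shows "\<exists>X\<subseteq>U. open X \<and> X \<noteq> {} \<and> inj_on Phi X"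
proof -
  let ?f = "\<lambda>z. card (weight_supp z)"
  have "finite (?f ` U)"
    by (rule finite_subset[of _ "{..card I}"]) (use is_tubing_card_le[OF is_tubing_weight_supp] in auto)
  then have "Max (?f ` U) \<in> ?f ` U" "\<And>z. z \<in> U \<Longrightarrow> ?f z \<le> Max (?f ` U)"
    using assms(2) by auto
  then obtain p where "p \<in> U" "Max (?f ` U) = ?f p" "\<And>z. z \<in> U \<Longrightarrow> ?f z \<le> Max (?f ` U)" by blast
  then have p: "p \<in> U" "\<And>z. z \<in> U \<Longrightarrow> ?f z \<le> ?f p" by simp_all
  let ?X = "U \<inter> {z. weight_supp p \<subseteq> weight_supp z}"
  have const: "weight_supp z = weight_supp p" if "z \<in> ?X" for z
    using that p(2)[of z] card_seteq[OF is_tubing_finite[OF is_tubing_weight_supp], of "weight_supp p" z] by auto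
  have "inj_on Phi ?X"
  proof (rule inj_onI)
    fix z z' assume z: "z \<in> ?X" "z' \<in> ?X" "Phi z = Phi z'"
    have "is_tubing (weight_supp z \<union> weight_supp z')" unfolding const[OF z(1)] const[OF z(2)] by (simp add: is_tubing_weight_supp)
    then show "z = z'" using Phi_eq_common z(3) by blast
  qed
  moreover have "open ?X" using assms(1) open_weight_supp_superset by (rule open_Int)
  moreover have "p \<in> ?X" using p(1) by simp
  ultimately show ?thesis by (intro exI[of _ ?X]) blast
qed

text \<open>Supports near p contain that of p, which is at most one tube short of maximal. If two of
  them do not form a common tubing, each adds exactly one tube, and equal values of
  \<open>Phi\<close> would be a relation excluded by \<open>flip_no_relation\<close>.\<close>

lemma Phi_locally_inj:
  assumes p: "card I < card (weight_supp p) + 2"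
  shows "\<exists>X. open X \<and> p \<in> X \<and> inj_on Phi X"
proof -
  let ?X = "{z. weight_supp p \<subseteq> weight_supp z}"
  have "inj_on Phi ?X"
  proof (rule inj_onI)
    fix z z' assume "z \<in> ?X" "z' \<in> ?X" and eq: "Phi z = Phi z'"
    then have z: "weight_supp p \<subseteq> weight_supp z" "weight_supp p \<subseteq> weight_supp z'" by auto
    show "z = z'"
    proof (cases "is_tubing (weight_supp z \<union> weight_supp z')")
      case True
      then show ?thesis using Phi_eq_common eq by blast
    next
      case False
      have tz: "is_tubing (weight_supp z)" "is_tubing (weight_supp z')" by (rule is_tubing_weight_supp)+
      then obtain T1 T2 where T: "T1 \<in> weight_supp z" "T2 \<in> weight_supp z'" "\<not> compat_tubes T1 T2 \<or> \<not> compat_tubes T2 T1"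
        using False unfolding is_tubing_def by blast
      have n: "T1 \<notin> weight_supp z'" "T2 \<notin> weight_supp z" using tz T unfolding is_tubing_def by blast+
      then have np: "T1 \<notin> weight_supp p" "T2 \<notin> weight_supp p" and ne: "T1 \<noteq> T2" using z T by blast+
      have fin: "finite (weight_supp z)" "finite (weight_supp z')" "finite (weight_supp p)"
        using is_tubing_finite is_tubing_weight_supp by blast+
      have c1: "card (insert T1 (weight_supp p)) = card (weight_supp p) + 1"
        and c2: "card (insert T2 (weight_supp p)) = card (weight_supp p) + 1" using np fin by simp_all
      have s1: "insert T1 (weight_supp p) \<subseteq> weight_supp z" and s2: "insert T2 (weight_supp p) \<subseteq> weight_supp z'"
        using T z by blast+
      have le: "card (weight_supp z) \<le> card I" "card (weight_supp z') \<le> card I" using is_tubing_card_le tz by blast+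
      have e1: "insert T1 (weight_supp p) = weight_supp z" using card_seteq[OF fin(1) s1] c1 le p by simp
      have e2: "insert T2 (weight_supp p) = weight_supp z'" using card_seteq[OF fin(2) s2] c2 le p by simp
      have cI: "card (weight_supp p) + 1 = card I" using card_mono[OF fin(1) s1] c1 le p by simp
      let ?f = "\<lambda>T. (weight_at z T - weight_at z' T) *\<^sub>R dual_vec T"
      have "(\<Sum>T | ptube T. ?f T) = (\<Sum>T\<in>insert T1 (insert T2 (weight_supp p)). ?f T)"
      proof (rule sum.mono_neutral_right)
        show "finite {T. ptube T}" using finite_ptubes by simp
        show "insert T1 (insert T2 (weight_supp p)) \<subseteq> {T. ptube T}" using T by (auto simp: weight_supp_def)
        show "\<forall>T\<in>{T. ptube T} - insert T1 (insert T2 (weight_supp p)). ?f T = 0"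
          using weight_at_eq_0 e1 e2 by (metis (no_types, lifting) DiffD1 DiffD2 diff_self insertCI insertE mem_Collect_eq scaleR_zero_left)
      qed
      also have "\<dots> = ?f T1 + (?f T2 + (\<Sum>T\<in>weight_supp p. ?f T))" using np ne fin by simp
      finally have "?f T1 + (?f T2 + (\<Sum>T\<in>weight_supp p. ?f T)) = 0" using Phi_eq_diff(2)[OF eq] by simp
      moreover have "weight_at z' T1 = 0" "weight_at z T2 = 0"
        using weight_at_eq_0 n T by (auto simp: weight_supp_def)
      ultimately have rel: "(\<Sum>T\<in>weight_supp p. ?f T) + weight_at z T1 *\<^sub>R dual_vec T1 = weight_at z' T2 *\<^sub>R dual_vec T2"
        by (simp add: algebra_simps eq_neg_iff_add_eq_0)
      have "0 < weight_at z T1" "0 < weight_at z' T2" using T by (auto simp: weight_supp_def)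
      then show ?thesis
        using flip_no_relation[OF _ np(1) _ np(2) ne cI _ _ rel] tz e1 e2 by simp
    qed
  qed
  moreover have "p \<in> ?X" by simp
  ultimately show ?thesis using open_weight_supp_superset by blast
qed

lemma bij_Phi: "bij Phi"
proof -
  \<comment> \<open>The axes outside I account for the coordinates where \<open>Phi\<close> is the
    identity; with them, codimension two inside \<open>W\<close> becomes codimension two in the
    whole space.\<close>
  let ?B = "\<lambda>\<T>. dual_vec ` \<T> \<union> (\<lambda>i. axis i 1) ` (- I)"
  let ?S = "(\<lambda>\<T>. span (?B \<T>)) ` {\<T>. is_tubing \<T> \<and> card \<T> + 2 \<le> card I}"
  let ?Q = "{y :: real ^ 'n. \<forall>i\<in>I. y $ i < 0}"
  show ?thesis
  proof (rule bij_if_locally_inj_off_codim2[of Phi ?S ?Q])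
    show "continuous_on UNIV Phi" by (rule continuous_Phi)
    have "{\<T>. is_tubing \<T>} \<subseteq> Pow {T. ptube T}" by (auto simp: is_tubing_def)
    then have "finite {\<T>. is_tubing \<T>}" using finite_subset finite_ptubes by (metis finite_Pow_iff)
    then show "finite ?S" by simp
    show "subspace S" if "S \<in> ?S" for S using that by (auto intro: subspace_span)
    show "dim S + 2 \<le> DIM(real ^ 'n)" if S: "S \<in> ?S" for S
    proof -
      obtain \<T> where T: "is_tubing \<T>" "card \<T> + 2 \<le> card I" "S = span (?B \<T>)" using S by blast
      have fin: "finite \<T>" using is_tubing_finite[OF T(1)] .
      have "dim S = dim (?B \<T>)" using T(3) by (simp add: dim_span)
      also have "\<dots> \<le> card (?B \<T>)" using fin by (intro dim_le_card') auto
      also have "\<dots> \<le> card (dual_vec ` \<T>) + card ((\<lambda>i. axis i (1::real)) ` (- I))" by (rule card_Un_le)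
      also have "\<dots> \<le> card \<T> + card (- I)" using fin by (intro add_mono card_image_le) auto
      finally have "dim S \<le> card \<T> + (CARD('n) - card I)" by (simp add: card_Diff_subset Compl_eq_Diff_UNIV)
      moreover have "card I \<le> CARD('n)" by (intro card_mono) auto
      ultimately show ?thesis using T(2) by simp
    qed
    show "bounded (Phi -` K)" if "bounded K" for K using bounded_vimage_Phi[OF that] .
    show "finite (Phi -` {y})" for y by (rule finite_vimage_Phi)
    show "\<exists>X\<subseteq>U. open X \<and> X \<noteq> {} \<and> inj_on Phi X" if "open U" "U \<noteq> {}" for U
      using Phi_locally_inj_dense[OF that] .
    show "\<exists>X. open X \<and> p \<in> X \<and> inj_on Phi X" if p: "Phi p \<notin> \<Union>?S" for p
    proof (rule Phi_locally_inj, rule ccontr)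
      assume "\<not> card I < card (weight_supp p) + 2"
      then have "span (?B (weight_supp p)) \<in> ?S" using is_tubing_weight_supp[of p] by auto
      moreover have "Phi p \<in> span (?B (weight_supp p))"
      proof -
        have "(\<Sum>T | ptube T. weight_at p T *\<^sub>R dual_vec T) = (\<Sum>T\<in>weight_supp p. weight_at p T *\<^sub>R dual_vec T)"
          using finite_ptubes weight_at_eq_0
          by (intro sum.mono_neutral_right) (auto simp: weight_supp_def)
        moreover have "(\<Sum>T\<in>weight_supp p. weight_at p T *\<^sub>R dual_vec T) \<in> span (?B (weight_supp p))"
          by (intro span_sum span_scale span_base) auto
        moreover have "(\<chi> i. if i \<in> I then 0 else p $ i) = (\<Sum>i\<in>- I. p $ i *\<^sub>R axis i (1::real))"
          by (simp add: vec_eq_iff axis_def if_distrib[of "\<lambda>x. _ * x"] cong: if_cong)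
        moreover have "(\<Sum>i\<in>- I. p $ i *\<^sub>R axis i (1::real)) \<in> span (?B (weight_supp p))"
          by (intro span_sum span_scale span_base) auto
        ultimately show ?thesis unfolding Phi_def by (simp add: span_add)
      qed
      ultimately show False using p by blast
    qed
    have "?Q = (\<Inter>i\<in>I. {y. y $ i < 0})" by auto
    moreover have "open (\<Inter>i\<in>I. {y :: real ^ 'n. y $ i < 0})"
      by (intro open_INT ballI open_Collect_less continuous_intros) auto
    ultimately show "open ?Q" by simp
    have "(\<chi> i. - 1) \<in> ?Q" by simp
    then show "?Q \<noteq> {}" by blast
    \<comment> \<open>The only negative degree is -1 at T = \<open>T0 i\<close>, so a negative i-th
      coordinate forces \<open>T0 i\<close> into the support.\<close>
    have sQ: "weight_supp z = T0 ` I" if z: "Phi z \<in> ?Q" for z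
    proof (rule is_tubing_maximal[OF is_tubing_weight_supp], rule ccontr)
      assume "\<not> T0 ` I \<subseteq> weight_supp z"
      then obtain i where i: "i \<in> I" "T0 i \<notin> weight_supp z" by blast
      have "0 \<le> weight_at z T * cdegree T (T0 i)" if "ptube T" for T
        using weight_at_nonneg[of z T] weight_at_eq_0[OF that] i(2) by (auto simp: cdegree_def)
      then have "0 \<le> (\<Sum>T | ptube T. weight_at z T * cdegree T (T0 i))" by (intro sum_nonneg) auto
      also have "\<dots> = Phi z $ i" using i(1) by (simp add: Phi_def dual_vec_def)
      finally show False using z i(1) by force
    qed
    show "z = z'" if "Phi z \<in> ?Q" "Phi z = Phi z'" for z z'
      using Phi_eq_common[OF that(2)] sQ[of z] sQ[of z'] that is_tubing_T0 by simp
  qed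
qed

lemma Phi_in_W_iff: "Phi z \<in> W \<longleftrightarrow> z \<in> W"
  using Phi_off[of _ z] by (auto simp: W_def)

lemma Phi_W: "z \<in> W \<Longrightarrow> Phi z = (\<Sum>T | ptube T. weight_at z T *\<^sub>R dual_vec T)"
  by (auto simp: Phi_def W_def vec_eq_iff)

lemma dual_vec_rep_exists:
  assumes "x \<in> W"
  shows "\<exists>\<T>. is_tubing \<T> \<and> (\<exists>c. (\<forall>T\<in>\<T>. 0 \<le> c T) \<and> x = (\<Sum>T\<in>\<T>. c T *\<^sub>R dual_vec T))"
proof -
  obtain z where z: "x = Phi z" using bij_Phi by (metis bij_pointE)
  then have "z \<in> W" using assms Phi_in_W_iff by simp
  then have "x = (\<Sum>T | ptube T. weight_at z T *\<^sub>R dual_vec T)" using z Phi_W by simp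
  also have "\<dots> = (\<Sum>T\<in>weight_supp z. weight_at z T *\<^sub>R dual_vec T)"
    using finite_ptubes weight_at_eq_0
    by (intro sum.mono_neutral_right) (auto simp: weight_supp_def)
  finally have "x = (\<Sum>T\<in>weight_supp z. weight_at z T *\<^sub>R dual_vec T)" .
  then show ?thesis using is_tubing_weight_supp weight_at_nonneg by (intro exI[of _ "weight_supp z"] conjI exI[of _ "weight_at z"]) auto
qed

text \<open>Both combinations are values of \<open>Phi\<close> at heights realising the given
  coefficients as weights, and \<open>Phi\<close> is injective.\<close>

lemma dual_vec_rep_unique:
  assumes \<T>: "is_tubing \<T>" "\<forall>T\<in>\<T>. 0 \<le> a T" and \<T>': "is_tubing \<T>'" "\<forall>T\<in>\<T>'. 0 \<le> b T"
    and eq: "(\<Sum>T\<in>\<T>. a T *\<^sub>R dual_vec T) = (\<Sum>T\<in>\<T>'. b T *\<^sub>R dual_vec T)"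
  shows "(if S \<in> \<T> then a S else 0) = (if S \<in> \<T>' then b S else 0)"
proof -
  have sum: "(\<Sum>T | ptube T. (if T \<in> \<S> then c T else 0) *\<^sub>R dual_vec T) = (\<Sum>T\<in>\<S>. c T *\<^sub>R dual_vec T)"
    if "is_tubing \<S>" for \<S> c
  proof -
    have "(\<Sum>T | ptube T. (if T \<in> \<S> then c T else 0) *\<^sub>R dual_vec T)
        = (\<Sum>T\<in>\<S>. (if T \<in> \<S> then c T else 0) *\<^sub>R dual_vec T)"
      using finite_ptubes that
      by (intro sum.mono_neutral_right) (auto simp: is_tubing_def)
    then show ?thesis by simp
  qed
  obtain z where z: "z \<in> W" "\<And>T. ptube T \<Longrightarrow> weight_at z T = (if T \<in> \<T> then a T else 0)"
    using weight_at_realise[OF \<T>] by blast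
  obtain z' where z': "z' \<in> W" "\<And>T. ptube T \<Longrightarrow> weight_at z' T = (if T \<in> \<T>' then b T else 0)"
    using weight_at_realise[OF \<T>'] by blast
  have "Phi z = Phi z'"
    using Phi_W[OF z(1)] Phi_W[OF z'(1)] z(2) z'(2) eq sum[OF \<T>(1), of a] sum[OF \<T>'(1), of b]
    by simp
  then have "z = z'" using bij_Phi by (simp add: bij_def inj_eq)
  show ?thesis
  proof (cases "ptube S")
    case True
    then show ?thesis using z(2) z'(2) \<open>z = z'\<close> by metis
  next
    case False
    then have "S \<notin> \<T>" "S \<notin> \<T>'" using \<T>(1) \<T>'(1) by (auto simp: is_tubing_def)
    then show ?thesis by simp
  qed
qed

end

section \<open>Simplicial fans from unique representations\<close>

lemma convex_cone_hull_image:
  fixes d :: "'b \<Rightarrow> 'v::real_vector"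
  assumes "finite A"
  shows "convex_cone hull (d ` A) = {\<Sum>T\<in>A. c T *\<^sub>R d T | c. \<forall>T\<in>A. 0 \<le> c T}" (is "_ = ?R")
proof
  show "convex_cone hull (d ` A) \<subseteq> ?R"
  proof (rule hull_minimal)
    show "d ` A \<subseteq> ?R"
    proof
      fix x assume "x \<in> d ` A"
      then obtain S where S: "S \<in> A" "x = d S" by blast
      then have "x = (\<Sum>T\<in>A. (if T = S then 1 else 0) *\<^sub>R d T)"
        using assms by (simp add: if_distrib[of "\<lambda>c. c *\<^sub>R _"] sum.delta cong: if_cong)
      moreover have "\<forall>T\<in>A. 0 \<le> (if T = S then 1 else 0 :: real)" by simp
      ultimately show "x \<in> ?R" by (intro CollectI exI[of _ "\<lambda>T. if T = S then 1 else 0"] conjI)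
    qed
    show "convex_cone ?R"
      unfolding convex_cone_iff
    proof (intro conjI ballI allI impI)
      show "0 \<in> ?R" by (intro CollectI exI[of _ "\<lambda>_. 0"]) auto
    next
      fix x y assume "x \<in> ?R" "y \<in> ?R"
      then obtain a b where "\<forall>T\<in>A. 0 \<le> a T" "x = (\<Sum>T\<in>A. a T *\<^sub>R d T)"
        "\<forall>T\<in>A. 0 \<le> b T" "y = (\<Sum>T\<in>A. b T *\<^sub>R d T)" by auto
      then show "x + y \<in> ?R"
        by (intro CollectI exI[of _ "\<lambda>T. a T + b T"]) (auto simp: scaleR_add_left sum.distrib)
    next
      fix x and r :: real assume "x \<in> ?R" "0 \<le> r"
      then obtain a where "\<forall>T\<in>A. 0 \<le> a T" "x = (\<Sum>T\<in>A. a T *\<^sub>R d T)" by auto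
      then show "r *\<^sub>R x \<in> ?R"
        using \<open>0 \<le> r\<close> by (intro CollectI exI[of _ "\<lambda>T. r * a T"]) (auto simp: scaleR_sum_right)
    qed
  qed
  show "?R \<subseteq> convex_cone hull (d ` A)"
  proof safe
    fix c :: "'b \<Rightarrow> real" assume c: "\<forall>T\<in>A. 0 \<le> c T"
    have "(\<Sum>T\<in>B. c T *\<^sub>R d T) \<in> convex_cone hull (d ` A)" if "B \<subseteq> A" for B
      using finite_subset[OF that assms] that
    proof (induction B rule: finite_induct)
      case empty
      then show ?case by (simp add: convex_cone_hull_contains_0)
    next
      case (insert T B)
      then have "c T *\<^sub>R d T \<in> convex_cone hull (d ` A)"
        using c by (intro convex_cone_hull_mul hull_inc) auto
      then show ?case
        using insert by (simp add: convex_cone_hull_add)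
    qed
    then show "(\<Sum>T\<in>A. c T *\<^sub>R d T) \<in> convex_cone hull (d ` A)" by blast
  qed
qed

text \<open>If x in F has a positive coefficient at S, it is the midpoint of twice its S-part and
  twice the rest. Both lie in the cone, so F contains the S-part and, by scaling, d S.\<close>

lemma cone_face_hull_subset:
  assumes F: "cone_face F (convex_cone hull (d ` A))" and A: "finite A"
  shows "F = convex_cone hull (d ` {T \<in> A. d T \<in> F})"
proof
  let ?C = "convex_cone hull (d ` A)" and ?B = "{T \<in> A. d T \<in> F}"
  have face: "F face_of ?C" and ne: "F \<noteq> {}" using F by (auto simp: cone_face_def)
  have conF: "conic F" using face_of_conic[OF conic_convex_cone_hull face] .
  have ccF: "convex_cone F" using face_of_imp_convex[OF face] conF ne by (simp add: convex_cone_def)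
  show "convex_cone hull (d ` ?B) \<subseteq> F" by (rule hull_minimal) (use ccF in auto)
  show "F \<subseteq> convex_cone hull (d ` ?B)"
  proof
    fix x assume x: "x \<in> F"
    then have "x \<in> ?C" using face_of_imp_subset[OF face] by blast
    then obtain c where c: "\<forall>T\<in>A. 0 \<le> c T" "x = (\<Sum>T\<in>A. c T *\<^sub>R d T)"
      unfolding convex_cone_hull_image[OF A] by blast
    have pos: "d S \<in> F" if S: "S \<in> A" "0 < c S" for S
    proof -
      let ?r = "\<Sum>T\<in>A - {S}. c T *\<^sub>R d T"
      have x': "x = c S *\<^sub>R d S + ?r" using c(2) sum.remove[OF A S(1)] by simp
      let ?a = "(2 * c S) *\<^sub>R d S" and ?b = "2 *\<^sub>R ?r"
      have rC: "?r \<in> ?C"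
      proof -
        have "?r \<in> convex_cone hull (d ` (A - {S}))"
          unfolding convex_cone_hull_image[OF finite_Diff[OF A]] using c(1) by auto
        then show ?thesis using hull_mono[of "d ` (A - {S})" "d ` A"] by blast
      qed
      have a: "?a \<in> ?C" using S by (intro convex_cone_hull_mul hull_inc) auto
      have b: "?b \<in> ?C" using rC by (intro convex_cone_hull_mul) auto
      have mid: "x = (1 - 1/2) *\<^sub>R ?a + (1/2) *\<^sub>R ?b" using x' by simp
      have "?a \<in> F"
      \<comment> \<open>Faces are defined by open segments, which are empty between equal endpoints;
        in that case x itself is \<open>?a\<close>.\<close>
      proof (cases "?a = ?b")
        case True
        then have "x = ?a" using mid by (metis scaleR_left_distrib scaleR_one diff_add_cancel)
        then show ?thesis using x by simp
      next
        case False
        then have "x \<in> open_segment ?a ?b"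
          unfolding in_segment using mid by (intro conjI exI[of _ "1/2"]) auto
        then show ?thesis using face a b x unfolding face_of_def by blast
      qed
      then have "(1 / (2 * c S)) *\<^sub>R ?a \<in> F" using S(2) conF unfolding conic_def by (meson less_imp_le divide_pos_pos zero_less_one mult_pos_pos zero_less_numeral)
      moreover have "(1 / (2 * c S)) *\<^sub>R ?a = d S" using S(2) by simp
      ultimately show ?thesis by metis
    qed
    have "x = (\<Sum>T\<in>?B. c T *\<^sub>R d T)"
      unfolding c(2)
    proof (rule sum.mono_neutral_right)
      show "\<forall>T\<in>A - ?B. c T *\<^sub>R d T = 0" using pos c(1) by (force simp: order_le_less)
    qed (use A in auto)
    then show "x \<in> convex_cone hull (d ` ?B)"
      using c(1) A by (subst convex_cone_hull_image) auto
  qed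
qed

text \<open>All fan properties follow from existence and uniqueness of nonnegative representations
  supported on faces. Coefficients are extended by 0, so different faces may represent one vector as
  long as their nonzero coefficients agree.\<close>

locale unique_cone_rep =
  fixes d :: "'b \<Rightarrow> 'v::euclidean_space" and \<Delta> :: "'b set set" and W :: "'v set"
  assumes finite_complex: "finite \<Delta>" and finite_face: "A \<in> \<Delta> \<Longrightarrow> finite A"
    and down_closed: "A \<in> \<Delta> \<Longrightarrow> B \<subseteq> A \<Longrightarrow> B \<in> \<Delta>"
    and subspace_W: "subspace W" and d_in_W: "A \<in> \<Delta> \<Longrightarrow> T \<in> A \<Longrightarrow> d T \<in> W"
    and rep_exists: "x \<in> W \<Longrightarrow> \<exists>A\<in>\<Delta>. \<exists>c. (\<forall>T\<in>A. 0 \<le> c T) \<and> x = (\<Sum>T\<in>A. c T *\<^sub>R d T)"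
    and rep_unique: "A \<in> \<Delta> \<Longrightarrow> B \<in> \<Delta> \<Longrightarrow> \<forall>T\<in>A. 0 \<le> a T \<Longrightarrow> \<forall>T\<in>B. 0 \<le> b T \<Longrightarrow>
      (\<Sum>T\<in>A. a T *\<^sub>R d T) = (\<Sum>T\<in>B. b T *\<^sub>R d T) \<Longrightarrow>
      (if T \<in> A then a T else 0) = (if T \<in> B then b T else 0)"
begin

abbreviation cone_of :: "'b set \<Rightarrow> 'v set" where
  "cone_of A \<equiv> convex_cone hull (d ` A)"

lemma coeff_zero:
  assumes A: "A \<in> \<Delta>" and 0: "(\<Sum>T\<in>A. c T *\<^sub>R d T) = 0" and S: "S \<in> A"
  shows "c S = 0"
proof -
  \<comment> \<open>N bounds all coefficients in absolute value: the coefficients N + c T and the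
    constant N are nonnegative and represent the same vector.\<close>
  define N where "N = (\<Sum>T\<in>A. \<bar>c T\<bar>)"
  have N: "\<bar>c T\<bar> \<le> N" if "T \<in> A" for T
    unfolding N_def using member_le_sum[of T A "\<lambda>T. \<bar>c T\<bar>"] that finite_face[OF A] by simp
  have "(\<Sum>T\<in>A. (N + c T) *\<^sub>R d T) = (\<Sum>T\<in>A. N *\<^sub>R d T)"
    using 0 by (simp add: scaleR_add_left sum.distrib)
  moreover have "\<forall>T\<in>A. 0 \<le> N + c T" "\<forall>T\<in>A. 0 \<le> N" using N abs_ge_minus_self order_trans[OF abs_ge_zero] by (force simp: abs_le_iff)+
  ultimately have "(if S \<in> A then N + c S else 0) = (if S \<in> A then N else 0)"
    using rep_unique[OF A A, of "\<lambda>T. N + c T" "\<lambda>_. N" S] by blast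
  then show ?thesis using S by simp
qed

lemma inj_independent:
  assumes A: "A \<in> \<Delta>"
  shows "inj_on d A" "independent (d ` A)"
proof -
  note fin = finite_face[OF A]
  show inj: "inj_on d A"
  proof (rule inj_onI, rule ccontr)
    fix S T assume ST: "S \<in> A" "T \<in> A" "d S = d T" "S \<noteq> T"
    let ?c = "\<lambda>R. if R = S then 1 else if R = T then - 1 else (0::real)"
    have "(\<Sum>R\<in>A. ?c R *\<^sub>R d R) = (\<Sum>R\<in>{S, T}. ?c R *\<^sub>R d R)"
      using ST fin by (intro sum.mono_neutral_right) auto
    also have "\<dots> = 0" using ST by simp
    finally show False using coeff_zero[OF A, of ?c S] ST by simp
  qed
  show "independent (d ` A)"
  proof (rule independent_if_scalars_zero)
    fix f x assume f: "(\<Sum>x\<in>d ` A. f x *\<^sub>R x) = 0" and x: "x \<in> d ` A"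
    then have "(\<Sum>T\<in>A. f (d T) *\<^sub>R d T) = 0" by (simp add: sum.reindex[OF inj])
    then show "f x = 0" using coeff_zero[OF A, of "\<lambda>T. f (d T)"] x by auto
  qed (use fin in simp)
qed

lemma cone_of_Int:
  assumes A: "A \<in> \<Delta>" and B: "B \<in> \<Delta>"
  shows "cone_of A \<inter> cone_of B = cone_of (A \<inter> B)"
proof
  show "cone_of (A \<inter> B) \<subseteq> cone_of A \<inter> cone_of B"
    using hull_mono[of "d ` (A \<inter> B)"] by (meson Int_greatest Int_lower1 Int_lower2 image_mono)
  show "cone_of A \<inter> cone_of B \<subseteq> cone_of (A \<inter> B)"
  proof
    fix x assume "x \<in> cone_of A \<inter> cone_of B"
    then obtain a b where a: "\<forall>T\<in>A. 0 \<le> a T" "x = (\<Sum>T\<in>A. a T *\<^sub>R d T)"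
      and b: "\<forall>T\<in>B. 0 \<le> b T" "x = (\<Sum>T\<in>B. b T *\<^sub>R d T)"
      unfolding convex_cone_hull_image[OF finite_face[OF A]]
        convex_cone_hull_image[OF finite_face[OF B]] by blast
    have eq: "(if T \<in> A then a T else 0) = (if T \<in> B then b T else 0)" for T
      using rep_unique[OF A B a(1) b(1)] a(2) b(2) by simp
    have "a T = 0" if "T \<in> A" "T \<notin> B" for T using eq[of T] that by simp
    then have "x = (\<Sum>T\<in>A \<inter> B. a T *\<^sub>R d T)"
      unfolding a(2) using finite_face[OF A] by (intro sum.mono_neutral_right) auto
    then show "x \<in> cone_of (A \<inter> B)"
      using a(1) finite_face[OF A] by (subst convex_cone_hull_image) auto
  qed
qed

lemma cone_of_subset_iff:
  assumes A: "A \<in> \<Delta>" and B: "B \<in> \<Delta>"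
  shows "cone_of A \<subseteq> cone_of B \<longleftrightarrow> A \<subseteq> B"
proof
  assume sub: "cone_of A \<subseteq> cone_of B"
  show "A \<subseteq> B"
  proof
    fix S assume S: "S \<in> A"
    then have "d S \<in> cone_of B" using sub hull_inc[of "d S" "d ` A"] by blast
    then obtain b where b: "\<forall>T\<in>B. 0 \<le> b T" "d S = (\<Sum>T\<in>B. b T *\<^sub>R d T)"
      unfolding convex_cone_hull_image[OF finite_face[OF B]] by blast
    have "{S} \<in> \<Delta>" using down_closed[OF A] S by simp
    then have "(if S \<in> {S} then 1 else 0) = (if S \<in> B then b S else 0)"
      using rep_unique[of "{S}" B "\<lambda>_. 1" b S] B b by simp
    then show "S \<in> B" by (auto split: if_splits)
  qed
qed (use hull_mono[of "d ` A" "d ` B"] in blast)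

text \<open>By uniqueness the coefficients of z are the convex combination of those of x and y. They
  vanish outside B, and being sums of nonnegative terms with positive factors they force those of x
  and y to vanish there.\<close>

lemma cone_of_face:
  assumes A: "A \<in> \<Delta>" and B: "B \<subseteq> A"
  shows "cone_face (cone_of B) (cone_of A)"
  unfolding cone_face_def face_of_def
proof (intro conjI ballI impI)
  note fA = finite_face[OF A] and fB = finite_subset[OF B finite_face[OF A]]
  show "cone_of B \<subseteq> cone_of A" using hull_mono[of "d ` B" "d ` A"] B by blast
  show "convex (cone_of B)" by (rule convex_convex_cone_hull)
  show "cone_of B \<noteq> {}" by (rule convex_cone_hull_nonempty)
  have in_B: "(\<Sum>T\<in>A. c T *\<^sub>R d T) \<in> cone_of B"
    if "\<forall>T\<in>A. 0 \<le> c T" "\<forall>T\<in>A - B. c T = 0" for c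
  proof -
    have "(\<Sum>T\<in>A. c T *\<^sub>R d T) = (\<Sum>T\<in>B. c T *\<^sub>R d T)"
      using that fA B by (intro sum.mono_neutral_right) auto
    then show ?thesis using that(1) B by (subst convex_cone_hull_image[OF fB]) auto
  qed
  fix x y z assume x: "x \<in> cone_of A" and y: "y \<in> cone_of A" and z: "z \<in> cone_of B"
    and seg: "z \<in> open_segment x y"
  obtain a where a: "\<forall>T\<in>A. 0 \<le> a T" "x = (\<Sum>T\<in>A. a T *\<^sub>R d T)"
    using x unfolding convex_cone_hull_image[OF fA] by blast
  obtain b where b: "\<forall>T\<in>A. 0 \<le> b T" "y = (\<Sum>T\<in>A. b T *\<^sub>R d T)"
    using y unfolding convex_cone_hull_image[OF fA] by blast
  obtain e where e: "\<forall>T\<in>B. 0 \<le> e T" "z = (\<Sum>T\<in>B. e T *\<^sub>R d T)"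
    using z unfolding convex_cone_hull_image[OF fB] by blast
  obtain u where u: "0 < u" "u < 1" "z = (1 - u) *\<^sub>R x + u *\<^sub>R y"
    using seg unfolding in_segment by blast
  have "z = (\<Sum>T\<in>A. ((1 - u) * a T + u * b T) *\<^sub>R d T)"
    unfolding u(3) a(2) b(2) by (simp add: scaleR_sum_right scaleR_add_left sum.distrib)
  moreover have "\<forall>T\<in>A. 0 \<le> (1 - u) * a T + u * b T" using a(1) b(1) u by simp
  ultimately have eq: "(if T \<in> A then (1 - u) * a T + u * b T else 0) = (if T \<in> B then e T else 0)" for T
    using rep_unique[OF A down_closed[OF A B], of "\<lambda>T. (1 - u) * a T + u * b T" e T] e by simp
  have zero: "a T = 0 \<and> b T = 0" if T: "T \<in> A - B" for T
  proof -
    have "(1 - u) * a T + u * b T = 0" using eq[of T] T by simp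
    moreover have "0 \<le> (1 - u) * a T" "0 \<le> u * b T" using a(1) b(1) u T by simp_all
    ultimately have "(1 - u) * a T = 0 \<and> u * b T = 0" by linarith
    then show ?thesis using u by simp
  qed
  show "x \<in> cone_of B" unfolding a(2) using a(1) zero by (intro in_B) auto
  show "y \<in> cone_of B" unfolding b(2) using b(1) zero by (intro in_B) auto
qed

theorem complete_simplicial_fan: "complete_simplicial_fan W (cone_of ` \<Delta>)"
proof -
  have "F \<in> cone_of ` \<Delta>" if "A \<in> \<Delta>" "cone_face F (cone_of A)" for A F
  proof -
    have "F = cone_of {T \<in> A. d T \<in> F}"
      using cone_face_hull_subset[OF that(2) finite_face[OF that(1)]] .
    moreover have "{T \<in> A. d T \<in> F} \<in> \<Delta>" using down_closed[OF that(1)] by simp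
    ultimately show ?thesis by blast
  qed
  moreover have "cone_face (cone_of A \<inter> cone_of B) (cone_of A)"
    "cone_face (cone_of A \<inter> cone_of B) (cone_of B)" if "A \<in> \<Delta>" "B \<in> \<Delta>" for A B
    unfolding cone_of_Int[OF that] using that by (auto intro: cone_of_face)
  moreover have "polyhedral_cone (cone_of A)" if "A \<in> \<Delta>" for A
    unfolding polyhedral_cone_def using finite_face[OF that] by blast
  ultimately have "fan (cone_of ` \<Delta>)"
    unfolding fan_def using finite_complex by (intro conjI ballI allI impI) auto
  moreover have "\<forall>C\<in>cone_of ` \<Delta>. simplicial_cone C"
    unfolding simplicial_cone_def using finite_face inj_independent(2) by blast
  moreover have "\<Union> (cone_of ` \<Delta>) = W"
  proof
    have "convex_cone W"
      using subspace_W by (simp add: convex_cone_iff subspace_0 subspace_add subspace_scale)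
    then have "cone_of A \<subseteq> W" if "A \<in> \<Delta>" for A
      using d_in_W[OF that] by (intro hull_minimal) auto
    then show "\<Union> (cone_of ` \<Delta>) \<subseteq> W" by blast
    show "W \<subseteq> \<Union> (cone_of ` \<Delta>)"
    proof
      fix x assume "x \<in> W"
      then obtain A c where A: "A \<in> \<Delta>" "\<forall>T\<in>A. 0 \<le> c T" "x = (\<Sum>T\<in>A. c T *\<^sub>R d T)"
        using rep_exists by blast
      then have "x \<in> cone_of A"
        by (subst convex_cone_hull_image[OF finite_face[OF A(1)]]) auto
      then show "x \<in> \<Union> (cone_of ` \<Delta>)" using A(1) by blast
    qed
  qed
  ultimately show ?thesis by (simp add: complete_simplicial_fan_def)
qed

theorem face_poset_iso: "face_poset_iso cone_of \<Delta> (cone_of ` \<Delta>)"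
  unfolding face_poset_iso_def bij_betw_def
proof (intro conjI ballI inj_onI refl)
  show "A = B" if "A \<in> \<Delta>" "B \<in> \<Delta>" "cone_of A = cone_of B" for A B
    using cone_of_subset_iff[OF that(1,2)] cone_of_subset_iff[OF that(2,1)] that(3) by blast
  show "A \<subseteq> B \<longleftrightarrow> cone_of A \<subseteq> cone_of B" if "A \<in> \<Delta>" "B \<in> \<Delta>" for A B
    using cone_of_subset_iff[OF that] by blast
qed

end

section \<open>The dual compatibility fan\<close>

text \<open>\<open>connected\<close> refers to the symmetrised digraph; an induced subgraph of a
  symmetric digraph is symmetric, so reachability is unchanged.\<close>

lemma connected_induce_subgraph_iff:
  assumes G: "graph G" and T: "T \<subseteq> verts G"
  shows "Digraph_Component.connected (G \<restriction> T) \<longleftrightarrow> T \<noteq> {} \<and> (\<forall>u\<in>T. \<forall>v\<in>T. u \<rightarrow>\<^sup>*\<^bsub>G \<restriction> T\<^esub> v)"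
proof -
  interpret graph G by fact
  have "symmetric (G \<restriction> T)"
    using induced_graph_imp_symmetric[OF sym_arcs induced_induce[OF T]] .
  then show ?thesis
    using wf_digraph.reachable_mk_symmetric_eq[OF wellformed_induce_subgraph[of T]]
    by (simp add: Digraph_Component.connected_def strongly_connected_def)
qed

lemma dominates_induce_subgraph:
  "u \<rightarrow>\<^bsub>G \<restriction> T\<^esub> v \<longleftrightarrow> u \<in> T \<and> v \<in> T \<and> u \<rightarrow>\<^bsub>G\<^esub> v"
  by (auto simp: arcs_ends_def arc_to_ends_def)

context
  fixes G :: "('a, 'b) pre_digraph"
  assumes G: "graph G"
begin

interpretation graph G by (rule G)

interpretation fin_graph "verts G" "\<lambda>u v. u \<rightarrow>\<^bsub>G\<^esub> v"
  by unfold_locales (use graph_symmetric in auto)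

text \<open>The set of vertices reachable from u within T has no neighbour in T, so the cut
  condition makes it all of T. Conversely, a walk leaving a part of T crosses from it to a
  neighbour.\<close>

lemma tube_iff_conn: "tube G T \<longleftrightarrow> conn T"
proof (cases "T \<noteq> {} \<and> T \<subseteq> verts G")
  case True
  then have T: "T \<noteq> {}" "T \<subseteq> verts G" by blast+
  let ?R = "\<lambda>u v. u \<rightarrow>\<^sup>*\<^bsub>G \<restriction> T\<^esub> v"
  have step: "?R u v \<Longrightarrow> v \<rightarrow>\<^bsub>G \<restriction> T\<^esub> w \<Longrightarrow> ?R u w" for u v w
    unfolding reachable_def
    by (rule rtrancl_on_into_rtrancl_on) (auto simp: dominates_induce_subgraph)
  have "(\<forall>u\<in>T. \<forall>v\<in>T. ?R u v) \<longleftrightarrow> (\<forall>A\<subseteq>T. A \<noteq> {} \<longrightarrow> A \<noteq> T \<longrightarrow> ngh A \<inter> T \<noteq> {})"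
  proof
    assume R: "\<forall>u\<in>T. \<forall>v\<in>T. ?R u v"
    show "\<forall>A\<subseteq>T. A \<noteq> {} \<longrightarrow> A \<noteq> T \<longrightarrow> ngh A \<inter> T \<noteq> {}"
    proof (intro allI impI notI)
      fix A assume A: "A \<subseteq> T" "A \<noteq> {}" "A \<noteq> T" "ngh A \<inter> T = {}"
      then obtain a b where ab: "a \<in> A" "b \<in> T" "b \<notin> A" by blast
      then have "(a, b) \<in> rtrancl_on T (arcs_ends (G \<restriction> T))"
        using R A by (auto simp: reachable_def)
      then have "b \<in> A"
      proof (induction rule: rtrancl_on_induct)
        case base
        then show ?case using ab by simp
      next
        case (step y z)
        then have "y \<rightarrow>\<^bsub>G\<^esub> z" "z \<in> T" by (auto simp: dominates_induce_subgraph)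
        then show ?case using step A(4) T(2) by (auto simp: ngh_def)
      qed
      then show False using ab by blast
    qed
  next
    assume cut: "\<forall>A\<subseteq>T. A \<noteq> {} \<longrightarrow> A \<noteq> T \<longrightarrow> ngh A \<inter> T \<noteq> {}"
    show "\<forall>u\<in>T. \<forall>v\<in>T. ?R u v"
    proof
      fix u assume u: "u \<in> T"
      let ?A = "{v \<in> T. ?R u v}"
      have "?R u u" using u by (simp add: reachable_def)
      then have "?A \<noteq> {}" using u by blast
      moreover have "ngh ?A \<inter> T = {}"
      proof (rule ccontr)
        assume "ngh ?A \<inter> T \<noteq> {}"
        then obtain v w where "v \<in> ?A" "w \<in> T" "w \<notin> ?A" "v \<rightarrow>\<^bsub>G\<^esub> w" by (auto simp: ngh_def)
        then show False using step[of u v w] by (simp add: dominates_induce_subgraph)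
      qed
      ultimately have "?A = T" using cut by (metis (no_types, lifting) mem_Collect_eq subsetI)
      then show "\<forall>v\<in>T. ?R u v" by blast
    qed
  qed
  then show ?thesis
    using connected_induce_subgraph_iff[OF G T(2)] T by (simp add: tube_def conn_def)
next
  case False
  then show ?thesis by (auto simp: tube_def conn_def)
qed

lemma components_of_eq: "components_of G = comps"
proof -
  have "ngh C = {}" if C: "conn C" and max: "\<forall>T. conn T \<and> C \<subseteq> T \<longrightarrow> T = C" for C
  proof -
    obtain D where "D \<in> comps" "C \<subseteq> D" using comp_exists[OF C] .
    then show ?thesis using max compsD by metis
  qed
  then show ?thesis
    unfolding components_of_def tube_iff_conn
    using comp_maximal by (intro equalityI subsetI) (auto simp: comps_def)
qed

lemma proper_tube_iff: "proper_tube G T \<longleftrightarrow> ptube T"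
  by (simp add: proper_tube_def tube_iff_conn components_of_eq ptube_iff)

lemma compatible_tubes_iff:
  assumes "conn T" "conn T'"
  shows "compatible_tubes G T T' \<longleftrightarrow> compat_tubes T T'"
proof -
  have "conn (T \<union> T') \<longleftrightarrow> ngh T \<inter> T' \<noteq> {}" if "T \<inter> T' = {}"
  proof
    assume "conn (T \<union> T')"
    then have "ngh T \<inter> (T \<union> T') \<noteq> {}"
      using conn_cut[of "T \<union> T'" T] connD(1)[OF assms(1)] connD(1)[OF assms(2)] that by blast
    then show "ngh T \<inter> T' \<noteq> {}" using ngh_disjoint[of T] by blast
  qed (use conn_Un assms in blast)
  then show ?thesis unfolding compatible_tubes_def tube_iff_conn compat_tubes_def by blast
qed

lemma tubing_iff:
  "tubing G \<T> \<longleftrightarrow> (\<forall>T\<in>\<T>. ptube T) \<and> (\<forall>T\<in>\<T>. \<forall>T'\<in>\<T>. compat_tubes T T')"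
  unfolding tubing_def proper_tube_iff using compatible_tubes_iff by (auto simp: ptube_iff)

lemma compat_degree_eq:
  assumes "T' \<subseteq> verts G"
  shows "real_of_int (compat_degree G T T') = cdegree T T'"
proof -
  have "{v \<in> T' - T. \<exists>u\<in>T. u \<rightarrow>\<^bsub>G\<^esub> v} = ngh T \<inter> T'" using assms by (auto simp: ngh_def)
  then show ?thesis by (simp add: compat_degree_def cdegree_def)
qed

lemma dual_compat_fan_complete:
  fixes I :: "'n::finite set" and T0 :: "'n \<Rightarrow> 'a set"
  assumes max: "maximal_tubing G \<T>" and bij: "bij_betw T0 I \<T>"
  shows "card I + card (components_of G) = card (verts G)
    \<and> (\<forall>\<T>\<in>nested_complex G.
          inj_on (dual_compat_vector G I T0) \<T> \<and> independent (dual_compat_vector G I T0 ` \<T>))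
    \<and> complete_simplicial_fan (coord_space I) (dual_compat_fan G I T0)
    \<and> face_poset_iso (dual_compat_cone G I T0) (nested_complex G) (dual_compat_fan G I T0)"
proof -
  have inj: "inj_on T0 I" and im: "T0 ` I = \<T>" using bij by (auto simp: bij_betw_def)
  have tub: "(\<forall>T\<in>\<T>. ptube T) \<and> (\<forall>T\<in>\<T>. \<forall>T'\<in>\<T>. compat_tubes T T')"
    and top: "\<And>\<T>'. tubing G \<T>' \<Longrightarrow> \<T> \<subseteq> \<T>' \<Longrightarrow> \<T>' = \<T>"
    using max by (auto simp: maximal_tubing_def tubing_iff)
  interpret R: ref_tubing "verts G" "\<lambda>u v. u \<rightarrow>\<^bsub>G\<^esub> v" I T0
  proof
    show "inj_on T0 I" by (rule inj)
    show "ptube (T0 i)" if "i \<in> I" for i using tub im that by blast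
    show "compat_tubes (T0 i) (T0 j)" if "i \<in> I" "j \<in> I" for i j using tub im that by blast
    fix T assume T: "ptube T" "\<forall>i\<in>I. compat_tubes (T0 i) T \<and> compat_tubes T (T0 i)"
    then have "\<forall>S\<in>\<T>. compat_tubes S T \<and> compat_tubes T S" using im by blast
    then have "tubing G (insert T \<T>)"
      using tub T(1) by (auto simp: tubing_iff compat_tubes_def)
    then have "insert T \<T> = \<T>" by (rule top) blast
    then show "T \<in> T0 ` I" using im by blast
  qed
  have tubing: "tubing G \<S> \<longleftrightarrow> R.is_tubing \<S>" for \<S> by (simp add: tubing_iff R.is_tubing_def)
  have vec: "dual_compat_vector G I T0 = R.dual_vec"
  proof
    fix T
    have "T0 i \<subseteq> verts G" if "i \<in> I" for i using R.ptube_T0[OF that] connD(2) by (simp add: ptube_def)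
    then show "dual_compat_vector G I T0 T = R.dual_vec T"
      by (auto simp: dual_compat_vector_def R.dual_vec_def vec_eq_iff compat_degree_eq)
  qed
  have W: "coord_space I = R.W" by (simp add: coord_space_def R.W_def)
  have complex: "nested_complex G = {\<S>. R.is_tubing \<S>}" by (simp add: nested_complex_def tubing)
  interpret U: unique_cone_rep R.dual_vec "nested_complex G" "coord_space I"
  proof
    have "nested_complex G \<subseteq> Pow {T. ptube T}" by (auto simp: complex R.is_tubing_def)
    then show "finite (nested_complex G)" using R.finite_ptubes by (simp add: finite_subset)
    show "finite \<S>" if "\<S> \<in> nested_complex G" for \<S> using that R.is_tubing_finite by (simp add: complex)
    show "\<S>' \<in> nested_complex G" if "\<S> \<in> nested_complex G" "\<S>' \<subseteq> \<S>" for \<S> \<S>'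
      using that R.is_tubing_subset by (auto simp: complex)
    show "subspace (coord_space I)" using R.subspace_W by (simp add: W)
    show "R.dual_vec T \<in> coord_space I" for T using R.dual_vec_in_W by (simp add: W)
    show "\<exists>\<S>\<in>nested_complex G. \<exists>c. (\<forall>T\<in>\<S>. 0 \<le> c T) \<and> x = (\<Sum>T\<in>\<S>. c T *\<^sub>R R.dual_vec T)"
      if "x \<in> coord_space I" for x
      using R.dual_vec_rep_exists[of x] that by (auto simp: W complex)
    show "(if T \<in> A then a T else 0) = (if T \<in> B then b T else 0)"
      if "A \<in> nested_complex G" "B \<in> nested_complex G" "\<forall>T\<in>A. 0 \<le> a T" "\<forall>T\<in>B. 0 \<le> b T"
        "(\<Sum>T\<in>A. a T *\<^sub>R R.dual_vec T) = (\<Sum>T\<in>B. b T *\<^sub>R R.dual_vec T)" for A B a b T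
      using R.dual_vec_rep_unique[of A a B b T] that by (simp add: complex)
  qed
  have cone: "dual_compat_cone G I T0 = U.cone_of" by (simp add: dual_compat_cone_def fun_eq_iff vec)
  have fan: "dual_compat_fan G I T0 = U.cone_of ` nested_complex G"
    by (auto simp: dual_compat_fan_def nested_complex_def cone)
  show ?thesis
    using R.card_I U.inj_independent U.complete_simplicial_fan U.face_poset_iso
    unfolding vec cone fan components_of_eq by blast
qed

end

theorem theorem3p10:
  fixes G :: "('a, 'b) pre_digraph"
    and \<T>\<^sub>0 :: "'a set set"
    and I :: "'n::finite set"
    and T0 :: "'n \<Rightarrow> 'a set"
  assumes "graph G"
    and "maximal_tubing G \<T>\<^sub>0"
    and "bij_betw T0 I \<T>\<^sub>0"
  shows "card I = card (verts G) - card (components_of G)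
    \<and> (\<forall>\<T>\<in>nested_complex G.
          inj_on (dual_compat_vector G I T0) \<T> \<and>
          independent (dual_compat_vector G I T0 ` \<T>))
    \<and> complete_simplicial_fan (coord_space I) (dual_compat_fan G I T0)
    \<and> face_poset_iso (dual_compat_cone G I T0) (nested_complex G) (dual_compat_fan G I T0)"
  using dual_compat_fan_complete[OF assms] by auto

end
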